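(* Let $\mathcal{B}$ be the complete quadrilateral, a real arrangement of $6$ lines in $\mathbb{P}^2=\mathbb{CP}^2$. Let $\bar X$ be the blow up of $\mathbb{P}^2$ at the set $\operatorname{Sing}\mathcal{B}$ of its multiple points and let $D\subset\bar X$ be the union of the strict transforms of the lines of $\mathcal{B}$ and of the exceptional divisors. Then there exists a partial compactification $X$ of $\bar X\setminus D$, of the form $X=\bar X\setminus D_\infty$ with $D_\infty$ the union of some of the irreducible components of $D$, such that $\pi_1(X)$ is infinite and $H_1(X,\mathbb{Z})$ is finite with exactly $4$ elements.
   Context: The complete quadrilateral is the arrangement of the six lines joining pairs of points among four points in general position in $\mathbb{P}^2$; in suitable coordinates it is $(z_1^2-z_2^2)(z_1^2-z_3^2)(z_2^2-z_3^2)=0$. It has $4$ triple points and $3$ double points; $\operatorname{Sing}\mathcal{B}$ is the set of these $7$ points. *)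

theory Defs
  imports "HOL-Analysis.Analysis" "HOL-Homology.Homology"
begin

section \<open>The complex projective plane\<close>

quotient_type cp2 = "complex ^ 3" /
  partial: "\<lambda>v w. v \<noteq> 0 \<and> w \<noteq> 0 \<and> (\<exists>c. w = c *s v)"
proof (rule part_equivpI)
  show "\<exists>v::complex ^ 3. v \<noteq> 0 \<and> v \<noteq> 0 \<and> (\<exists>c. v = c *s v)"
    by (rule exI[of _ "axis 1 1"], auto simp: axis_eq_0_iff intro!: exI[of _ 1])
  show "symp (\<lambda>v w::complex ^ 3. v \<noteq> 0 \<and> w \<noteq> 0 \<and> (\<exists>c. w = c *s v))"
  proof (rule sympI, clarify)
    fix v :: "complex ^ 3" and c
    assume "c *s v \<noteq> 0"
    then have "v = inverse c *s (c *s v)" by (auto simp: vector_smult_assoc)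
    then show "\<exists>d. v = d *s (c *s v)" by blast
  qed
  show "transp (\<lambda>v w::complex ^ 3. v \<noteq> 0 \<and> w \<noteq> 0 \<and> (\<exists>c. w = c *s v))"
    by (rule transpI) (auto simp: vector_smult_assoc)
qed

text \<open>The topology is the quotient topology of the nonzero vectors.\<close>

instantiation cp2 :: topological_space
begin

definition open_cp2 :: "cp2 set \<Rightarrow> bool" where
  "open U \<longleftrightarrow> open {v. v \<noteq> 0 \<and> abs_cp2 v \<in> U}"

instance
proof
  show "open (UNIV :: cp2 set)"
    unfolding open_cp2_def by (simp add: Collect_neg_eq open_Compl)
next
  fix S T :: "cp2 set"
  assume "open S" "open T"
  then have "open ({v. v \<noteq> 0 \<and> abs_cp2 v \<in> S} \<inter> {v. v \<noteq> 0 \<and> abs_cp2 v \<in> T})"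
    unfolding open_cp2_def by (rule open_Int)
  then show "open (S \<inter> T)"
    unfolding open_cp2_def by (rule back_subst[where P = "open"]) auto
next
  fix K :: "cp2 set set"
  assume "\<forall>S\<in>K. open S"
  then have "open (\<Union>S\<in>K. {v. v \<noteq> 0 \<and> abs_cp2 v \<in> S})"
    unfolding open_cp2_def by (intro open_UN) auto
  then show "open (\<Union>K)"
    unfolding open_cp2_def by (rule back_subst[where P = "open"]) auto
qed

end

text \<open>
  The dual plane is represented by the same type: a nonzero vector \<open>a\<close> is the equation
  \<open>a\<^sub>1 x\<^sub>1 + a\<^sub>2 x\<^sub>2 + a\<^sub>3 x\<^sub>3 = 0\<close> of a line.
\<close>

lift_definition on_line :: "cp2 \<Rightarrow> cp2 \<Rightarrow> bool" is
  "\<lambda>a x. (\<Sum>i\<in>UNIV. a $ i * x $ i) = 0"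
proof -
  fix a a' x x' :: "complex ^ 3"
  assume a: "a \<noteq> 0 \<and> a' \<noteq> 0 \<and> (\<exists>c. a' = c *s a)"
    and x: "x \<noteq> 0 \<and> x' \<noteq> 0 \<and> (\<exists>c. x' = c *s x)"
  then obtain c d where cd: "a' = c *s a" "x' = d *s x" by blast
  have "(\<Sum>i\<in>UNIV. a' $ i * x' $ i) = c * d * (\<Sum>i\<in>UNIV. a $ i * x $ i)"
    by (simp add: cd sum_distrib_left mult_ac)
  moreover have "c \<noteq> 0" "d \<noteq> 0" using a x cd by auto
  ultimately show "((\<Sum>i\<in>UNIV. a $ i * x $ i) = 0) = ((\<Sum>i\<in>UNIV. a' $ i * x' $ i) = 0)"
    by simp
qed

definition line :: "cp2 \<Rightarrow> cp2 set" where
  "line a = {x. on_line a x}"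


section \<open>Line arrangements\<close>

definition general_position :: "cp2 set \<Rightarrow> bool" where
  "general_position P \<longleftrightarrow> finite P \<and> (\<forall>a. card (P \<inter> line a) \<le> 2)"

text \<open>An arrangement is the set of its lines, each line being a set of points.\<close>

definition complete_quadrilateral :: "cp2 set set \<Rightarrow> bool" where
  "complete_quadrilateral B \<longleftrightarrow>
    (\<exists>P. card P = 4 \<and> general_position P \<and>
      B = {L \<in> range line. \<exists>p\<in>P. \<exists>q\<in>P. p \<noteq> q \<and> p \<in> L \<and> q \<in> L})"

definition Sing :: "cp2 set set \<Rightarrow> cp2 set" where
  "Sing B = {x. \<exists>L\<in>B. \<exists>M\<in>B. L \<noteq> M \<and> x \<in> L \<and> x \<in> M}"


section \<open>Blow-up of the plane at finitely many points\<close>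

text \<open>
  The blow-up of the plane at one point \<open>p\<close> is the incidence variety of the pairs \<open>(x, l)\<close>
  with \<open>l\<close> a line through \<open>p\<close> and \<open>x \<in> l\<close>.  The blow-up at a finite set \<open>S\<close> is the
  fibre product over the plane of the blow-ups at the points of \<open>S\<close>: a point of it is a point
  \<open>x\<close> of the plane and a family \<open>l\<close> of lines, indexed by \<open>S\<close>, such that \<open>l p\<close> passes
  through \<open>p\<close> and \<open>x\<close>.  Outside \<open>S\<close> the family takes the junk value \<open>undefined\<close>, so that
  the topology induced by the type is that of a subspace of the product of the plane with
  \<open>card S\<close> dual planes.
\<close>

definition blowup :: "cp2 set \<Rightarrow> (cp2 \<times> (cp2 \<Rightarrow> cp2)) set" where
  "blowup S = {(x, l). l \<in> extensional S \<and> (\<forall>p\<in>S. p \<in> line (l p) \<and> x \<in> line (l p))}"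

definition exceptional_divisor :: "cp2 set \<Rightarrow> cp2 \<Rightarrow> (cp2 \<times> (cp2 \<Rightarrow> cp2)) set" where
  "exceptional_divisor S p = {y \<in> blowup S. fst y = p}"

definition strict_transform :: "cp2 set \<Rightarrow> cp2 set \<Rightarrow> (cp2 \<times> (cp2 \<Rightarrow> cp2)) set" where
  "strict_transform S L = Abstract_Topology.closure_of (top_of_set (blowup S)) {y \<in> blowup S. fst y \<in> L - S}"

text \<open>
  The strict transforms of the lines and the exceptional divisors are pairwise distinct
  irreducible curves (each is a projective line), so they are the irreducible components of
  their union.
\<close>

definition boundary_components :: "cp2 set set \<Rightarrow> (cp2 \<times> (cp2 \<Rightarrow> cp2)) set set" where
  "boundary_components B =
    strict_transform (Sing B) ` B \<union> exceptional_divisor (Sing B) ` Sing B"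


section \<open>The fundamental group\<close>

definition loops_at :: "'a::topological_space set \<Rightarrow> 'a \<Rightarrow> (real \<Rightarrow> 'a) set" where
  "loops_at X x = {g. path g \<and> path_image g \<subseteq> X \<and> pathstart g = x \<and> pathfinish g = x}"

definition fundamental_group ::
    "'a::topological_space set \<Rightarrow> 'a \<Rightarrow> (real \<Rightarrow> 'a) set monoid" where
  "fundamental_group X x =
    \<lparr>carrier = loops_at X x // {(g, h). g \<in> loops_at X x \<and> homotopic_paths X g h},
     mult = (\<lambda>C D. {k. \<exists>g\<in>C. \<exists>h\<in>D. homotopic_paths X (g +++ h) k}),
     one = {g. homotopic_paths X (\<lambda>_. x) g}\<rparr>"

end

theory Submission
  imports Defs
begin

text \<open>All seven multiple points are blown up, and the components removed are the six strict transforms and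
the exceptional curves over one double point \<open>d\<close> and one triple point \<open>t\<close>. The pencil of conics through
the four triple points maps what remains to an affine line: the conic singular at \<open>d\<close> is removed
altogether, and of the other two singular conics only the exceptional curves over their nodes survive,
which are double fibres. Since one base point is removed, the general fibre is an affine line, so \<open>\<pi>\<^sub>1(X)\<close>
is the infinite dihedral group \<open>\<int>/2 * \<int>/2\<close>, whose abelianization has order four.

Concretely \<open>X\<close> is the surface \<open>w\<^sup>2 = (1 - c\<^sup>2) m\<close> without its two singular points. Its universal cover is
the set of \<open>(f, u) \<in> \<complex>\<^sup>2\<close> with \<open>(sin 2f, u) \<noteq> (0, 0)\<close>, mapped to \<open>X\<close> by \<open>c = cos 2f\<close>, \<open>w = u sin 2f\<close>,
\<open>m = u\<^sup>2\<close>. It is simply connected, being the complement of a countable closed set in \<open>\<complex>\<^sup>2\<close>. Hence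
\<open>H\<^sub>1(X)\<close> is generated by the images of paths joining points of one orbit, and two cocycles with values
in \<open>\<int>/2\<close> separate its four classes.\<close>

section \<open>Paths and singular 1-chains\<close>

text \<open>The three singular conics \<open>x1 (x2 - x3)\<close>, \<open>x2 (x1 - x3)\<close> and
  \<open>D = x3 (x1 - x2)\<close> satisfy \<open>x2 (x1 - x3) - x1 (x2 - x3) = D\<close>. As
  \<open>D\<close> is removed, it can be divided out, and the relation reads
  \<open>al^2 + be^2 = 1\<close> with \<open>al^2 = - x1 (x2 - x3) / D\<close>. This is why sine and
  cosine uniformise the pencil; its parameter is \<open>c = 1 - 2 al^2\<close>. The other functions
  are \<open>w = 2 x1 x2 / D\<close> and \<open>m = - x1 x2 / ((x1 - x3) (x2 - x3))\<close>. A
  general fibre of the model is a line with coordinate \<open>w\<close>. For \<open>c = 1\<close>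
  and \<open>c = -1\<close> the equation becomes \<open>w^2 = 0\<close>, and \<open>m\<close>, which
  is nonzero there, is the coordinate on the exceptional curve without the two points where strict
  transforms met it.

  The blow-up lies in a product of projective planes, without a norm, while lifting is used in
  normed spaces. Covering theory and homology are therefore done on the model and carried over. The
  delicate point is continuity of \<open>c\<close>, \<open>w\<close>, \<open>m\<close> along the
  exceptional curves, where quotients of linear forms become 0/0 and must be read off the lines that
  the blow-up records.\<close>

definition path_simplex :: "(real \<Rightarrow> 'a) \<Rightarrow> (nat \<Rightarrow> real) \<Rightarrow> 'a" where
  "path_simplex g = restrict (\<lambda>x. g (x 1)) (standard_simplex 1)"

text \<open>The coordinates \<open>(x 1 + x 2, x 2)\<close> identify the standard 2-simplex with
  \<open>simplex_domain\<close>, so the faces become the right edge \<open>T (1, t)\<close>, the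
  diagonal \<open>T (t, t)\<close> and the bottom edge \<open>T (t, 0)\<close>. A homotopy on a
  square can then be cut along its diagonal.\<close>

definition triangle_simplex :: "(real \<times> real \<Rightarrow> 'a) \<Rightarrow> (nat \<Rightarrow> real) \<Rightarrow> 'a" where
  "triangle_simplex T = restrict (\<lambda>x. T (x 1 + x 2, x 2)) (standard_simplex 2)"

definition simplex_domain :: "(real \<times> real) set" where
  "simplex_domain = {(a, b). 0 \<le> b \<and> b \<le> a \<and> a \<le> 1}"

lemma mem_standard_simplex_1:
  "x \<in> standard_simplex 1 \<longleftrightarrow> 0 \<le> x 0 \<and> 0 \<le> x 1 \<and> x 0 + x 1 = 1 \<and> (\<forall>i>1. x i = 0)"
proof -
  have "(\<forall>i. 0 \<le> x i \<and> x i \<le> 1)"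
    if "0 \<le> x 0" "0 \<le> x 1" "x 0 + x 1 = 1" "\<forall>i>1. x i = 0"
  proof
    fix i :: nat
    have "i = 0 \<or> i = 1 \<or> i > 1" by linarith
    then show "0 \<le> x i \<and> x i \<le> 1" using that by auto
  qed
  then show ?thesis
    by (auto simp: standard_simplex_def)
qed

lemmas mem_standard_simplex_1_Suc = mem_standard_simplex_1[unfolded One_nat_def]

lemma mem_standard_simplex_2:
  "x \<in> standard_simplex 2 \<longleftrightarrow>
    0 \<le> x 0 \<and> 0 \<le> x 1 \<and> 0 \<le> x 2 \<and> x 0 + x 1 + x 2 = 1 \<and> (\<forall>i>2. x i = 0)"
proof -
  have "(\<forall>i. 0 \<le> x i \<and> x i \<le> 1)"
    if "0 \<le> x 0" "0 \<le> x 1" "0 \<le> x 2" "x 0 + x 1 + x 2 = 1" "\<forall>i>2. x i = 0"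
  proof
    fix i :: nat
    have "i = 0 \<or> i = 1 \<or> i = 2 \<or> i > 2" by linarith
    then show "0 \<le> x i \<and> x i \<le> 1" using that by auto
  qed
  then show ?thesis
    by (auto simp: standard_simplex_def numeral_2_eq_2)
qed

lemma path_simplex_cong:
  assumes "\<And>t. t \<in> {0..1} \<Longrightarrow> g t = h t"
  shows "path_simplex g = path_simplex h"
  unfolding path_simplex_def
  by (intro restrict_ext assms) (auto simp: mem_standard_simplex_1_Suc)

lemma singular_simplex_path_simplex:
  assumes "path g" "path_image g \<subseteq> X"
  shows "singular_simplex 1 (top_of_set X) (path_simplex g)"
proof -
  have "continuous_map (subtopology (powertop_real UNIV) (standard_simplex 1)) (top_of_set {0..1}) (\<lambda>x. x 1)"
    by (auto simp: continuous_map_in_subtopology mem_standard_simplex_1_Suc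
        intro!: continuous_map_from_subtopology continuous_map_product_projection)
  moreover have "continuous_map (top_of_set {0..1}) (top_of_set X) g"
    using assms by (auto simp: path_def path_image_def)
  ultimately have "continuous_map (subtopology (powertop_real UNIV) (standard_simplex 1)) (top_of_set X) (g \<circ> (\<lambda>x. x 1))"
    by (rule continuous_map_compose)
  then show ?thesis
    unfolding singular_simplex_def path_simplex_def
    by (auto elim: continuous_map_eq)
qed

lemma singular_simplex_triangle_simplex:
  assumes "continuous_on simplex_domain T" "T ` simplex_domain \<subseteq> X"
  shows "singular_simplex 2 (top_of_set X) (triangle_simplex T)"
proof -
  have "continuous_map (subtopology (powertop_real UNIV) (standard_simplex 2)) euclidean (\<lambda>x. (x 1 + x 2, x 2))"
    unfolding prod_topology_euclidean[symmetric]
    by (intro continuous_map_from_subtopology continuous_map_pairedI continuous_map_add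
        continuous_map_product_projection UNIV_I)
  then have "continuous_map (subtopology (powertop_real UNIV) (standard_simplex 2)) (top_of_set simplex_domain) (\<lambda>x. (x 1 + x 2, x 2))"
    by (auto simp: continuous_map_in_subtopology mem_standard_simplex_2 simplex_domain_def)
  moreover have "continuous_map (top_of_set simplex_domain) (top_of_set X) T"
    using assms by auto
  ultimately have "continuous_map (subtopology (powertop_real UNIV) (standard_simplex 2)) (top_of_set X) (T \<circ> (\<lambda>x. (x 1 + x 2, x 2)))"
    by (rule continuous_map_compose)
  then show ?thesis
    unfolding singular_simplex_def triangle_simplex_def
    by (auto elim: continuous_map_eq)
qed

lemma simplical_face_in_2:
  assumes "x \<in> standard_simplex 1" "k \<le> 2"
  shows "simplical_face k x \<in> standard_simplex 2"
  using simplical_face_in_standard_simplex[of 2 k x] assms by simp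

lemma chain_boundary_triangle_simplex:
  "chain_boundary 2 (frag_of (triangle_simplex T)) =
    frag_of (path_simplex (\<lambda>t. T (1, t))) - frag_of (path_simplex (\<lambda>t. T (t, t)))
      + frag_of (path_simplex (\<lambda>t. T (t, 0)))"
proof -
  have 0: "singular_face 2 0 (triangle_simplex T) = path_simplex (\<lambda>t. T (1, t))"
    unfolding singular_face_def path_simplex_def triangle_simplex_def
    by (auto intro!: restrict_ext simp: simplical_face_in_2)
       (auto simp: simplical_face_def mem_standard_simplex_1_Suc)
  have 1: "singular_face 2 1 (triangle_simplex T) = path_simplex (\<lambda>t. T (t, t))"
    unfolding singular_face_def path_simplex_def triangle_simplex_def
    by (auto intro!: restrict_ext simp: simplical_face_in_2)
       (auto simp: simplical_face_def mem_standard_simplex_1_Suc)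
  have 2: "singular_face 2 2 (triangle_simplex T) = path_simplex (\<lambda>t. T (t, 0))"
    unfolding singular_face_def path_simplex_def triangle_simplex_def
    by (auto intro!: restrict_ext simp: simplical_face_in_2)
       (auto simp: simplical_face_def mem_standard_simplex_1_Suc)
  have "{..2::nat} = {0,1,2}" by auto
  then show ?thesis
    by (simp add: chain_boundary_of 0 1[simplified] 2)
qed

abbreviation null_homologous :: "'a::topological_space set \<Rightarrow> 'a chain \<Rightarrow> bool" where
  "null_homologous X \<equiv> singular_relboundary 1 (top_of_set X) {}"

abbreviation path_chain :: "(real \<Rightarrow> 'a) \<Rightarrow> 'a chain" where
  "path_chain g \<equiv> frag_of (path_simplex g)"

lemma null_homologous_triangle:
  assumes "continuous_on simplex_domain T" "T ` simplex_domain \<subseteq> X"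
  shows "null_homologous X
    (path_chain (\<lambda>t. T (1, t)) - path_chain (\<lambda>t. T (t, t)) + path_chain (\<lambda>t. T (t, 0)))"
  unfolding singular_boundary chain_boundary_triangle_simplex[symmetric]
  using singular_simplex_triangle_simplex[OF assms]
  by (metis One_nat_def numeral_2_eq_2 singular_chain_of)

text \<open>The faces of a constant triangle enter its boundary with signs \<open>+\<close>,
  \<open>-\<close>, \<open>+\<close>, so exactly one constant path survives.\<close>

lemma null_homologous_const:
  assumes "a \<in> X" shows "null_homologous X (path_chain (\<lambda>t. a))"
  using null_homologous_triangle[of "\<lambda>_. a" X] assms by auto

text \<open>The diagonal cuts the homotopy square into two triangles. It cancels in the difference
  of their boundaries, and besides \<open>g\<close> and \<open>h\<close> only two constant edges are
  left, which are boundaries themselves.\<close>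

lemma homotopic_paths_imp_null_homologous:
  assumes "homotopic_paths X g h"
  shows "null_homologous X (path_chain g - path_chain h)"
proof -
  obtain H where H': "continuous_on ({0..1} \<times> {0..1}) H" "H \<in> ({0..1} \<times> {0..1}) \<rightarrow> X"
    "\<forall>x\<in>{0..1}. H (0, x) = g x" "\<forall>x\<in>{0..1}. H (1, x) = h x"
    "\<forall>t\<in>{0..1::real}. pathstart (H \<circ> Pair t) = pathstart g \<and> pathfinish (H \<circ> Pair t) = pathfinish g"
    using assms unfolding homotopic_paths by blast
  then have H: "continuous_on ({0..1} \<times> {0..1}) H" "H ` ({0..1} \<times> {0..1}) \<subseteq> X"
    "\<And>x. x \<in> {0..1} \<Longrightarrow> H (0, x) = g x" "\<And>x. x \<in> {0..1} \<Longrightarrow> H (1, x) = h x"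
    "\<And>t. t \<in> {0..1} \<Longrightarrow> H (t, 0) = pathstart g" "\<And>t. t \<in> {0..1} \<Longrightarrow> H (t, 1) = pathfinish g"
    by (auto simp: pathstart_def pathfinish_def)
  have X: "pathstart g \<in> X" "pathfinish g \<in> X"
    using homotopic_paths_imp_subset[OF assms] pathstart_in_path_image pathfinish_in_path_image by blast+
  \<comment> \<open>\<open>T1\<close> swaps the arguments of \<open>H\<close>, so that both halves
    of the square are parametrised by \<open>simplex_domain\<close> with the same diagonal
    edge.\<close>
  define T1 where "T1 = (\<lambda>(a, b). H (b, a))"
  define T2 where "T2 = (\<lambda>(a, b). H (a, b))"
  have "continuous_on simplex_domain T1" "T1 ` simplex_domain \<subseteq> X"
    unfolding T1_def simplex_domain_def case_prod_beta'
    using H(2) by (auto intro!: continuous_intros continuous_on_compose2[OF H(1)])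
  note n1 = null_homologous_triangle[OF this]
  have "continuous_on simplex_domain T2" "T2 ` simplex_domain \<subseteq> X"
    unfolding T2_def simplex_domain_def case_prod_beta'
    using H(2) by (auto intro!: continuous_intros continuous_on_compose2[OF H(1)])
  note n2 = null_homologous_triangle[OF this]
  have s1: "path_simplex (\<lambda>t. T1 (1, t)) = path_simplex (\<lambda>t. pathfinish g)"
    "path_simplex (\<lambda>t. T1 (t, t)) = path_simplex (\<lambda>t. H (t, t))"
    "path_simplex (\<lambda>t. T1 (t, 0)) = path_simplex g"
    by (auto intro!: path_simplex_cong simp: T1_def H)
  have s2: "path_simplex (\<lambda>t. T2 (1, t)) = path_simplex h"
    "path_simplex (\<lambda>t. T2 (t, t)) = path_simplex (\<lambda>t. H (t, t))"
    "path_simplex (\<lambda>t. T2 (t, 0)) = path_simplex (\<lambda>t. pathstart g)"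
    by (auto intro!: path_simplex_cong simp: T2_def H)
  have "null_homologous X
     ((path_chain (\<lambda>t. pathfinish g) - path_chain (\<lambda>t. H (t, t)) + path_chain g) -
      (path_chain h - path_chain (\<lambda>t. H (t, t)) + path_chain (\<lambda>t. pathstart g)))"
    using singular_relboundary_diff[OF n1 n2] by (simp add: s1 s2)
  from singular_relboundary_add[OF singular_relboundary_diff[OF this null_homologous_const[OF X(2)]]
      null_homologous_const[OF X(1)]]
  show ?thesis by (simp add: algebra_simps)
qed

text \<open>A triangle map that depends only on \<open>a + b\<close> has \<open>g\<close> as its
  bottom edge, \<open>h\<close> as its right edge and the joined path as its diagonal.\<close>

lemma null_homologous_joinpaths:
  assumes "path g" "path h" "path_image g \<subseteq> X" "path_image h \<subseteq> X" "pathfinish g = pathstart h"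
  shows "null_homologous X (path_chain (g +++ h) - path_chain g - path_chain h)"
proof -
  define T where "T = (\<lambda>(a::real, b::real). (g +++ h) ((a + b) / 2))"
  have p: "continuous_on {0..1} (g +++ h)" "(g +++ h) ` {0..1} \<subseteq> X"
    using path_join_imp[of g h] path_image_join[of g h] assms by (auto simp: path_def path_image_def)
  have "continuous_on simplex_domain T" "T ` simplex_domain \<subseteq> X"
    unfolding T_def simplex_domain_def case_prod_beta'
    using p(2) by (auto intro!: continuous_intros continuous_on_compose2[OF p(1)])
  note n = null_homologous_triangle[OF this]
  have "path_simplex (\<lambda>t. T (1, t)) = path_simplex h"
    using assms(5)
    by (intro path_simplex_cong)
      (auto simp: T_def joinpaths_def pathfinish_def pathstart_def field_simps)
  moreover have "path_simplex (\<lambda>t. T (t, t)) = path_simplex (g +++ h)"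
    "path_simplex (\<lambda>t. T (t, 0)) = path_simplex g"
    by (auto intro!: path_simplex_cong simp: T_def joinpaths_def)
  ultimately have "null_homologous X (path_chain h - path_chain (g +++ h) + path_chain g)"
    using n by simp
  from singular_relboundary_minus[THEN iffD2, OF this] show ?thesis by (simp add: algebra_simps)
qed

lemma null_homologous_reversepath:
  fixes g :: "real \<Rightarrow> 'a::real_normed_vector"
  assumes "path g" "path_image g \<subseteq> X"
  shows "null_homologous X (path_chain g + path_chain (reversepath g))"
proof -
  have s: "pathstart g \<in> X" using assms pathstart_in_path_image by blast
  have "null_homologous X (path_chain (g +++ reversepath g) - path_chain (linepath (pathstart g) (pathstart g)))"
    by (intro homotopic_paths_imp_null_homologous homotopic_paths_rinv assms)
  moreover have "path_chain (linepath (pathstart g) (pathstart g)) = path_chain (\<lambda>t. pathstart g)"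
    by (simp add: linepath_refl)
  ultimately have "null_homologous X (path_chain (g +++ reversepath g))"
    using singular_relboundary_add[OF _ null_homologous_const[OF s]] by fastforce
  from singular_relboundary_diff[OF this null_homologous_joinpaths[of g "reversepath g" X]] assms
  show ?thesis by (simp add: add.commute)
qed

lemma chain_boundary_path_chain:
  "chain_boundary 1 (path_chain g) =
    frag_of (restrict (\<lambda>_. g 1) (standard_simplex 0)) - frag_of (restrict (\<lambda>_. g 0) (standard_simplex 0))"
proof -
  have f: "simplical_face k x \<in> standard_simplex 1" if "x \<in> standard_simplex 0" "k \<le> 1" for x :: "nat \<Rightarrow> real" and k
    using simplical_face_in_standard_simplex[of 1 k x] that by simp
  have 0: "singular_face 1 0 (path_simplex g) = restrict (\<lambda>_. g 1) (standard_simplex 0)"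
    unfolding singular_face_def path_simplex_def
    by (auto intro!: restrict_ext simp: f[unfolded One_nat_def]) (auto simp: simplical_face_def standard_simplex_0)
  have 1: "singular_face 1 1 (path_simplex g) = restrict (\<lambda>_. g 0) (standard_simplex 0)"
    unfolding singular_face_def path_simplex_def
    by (auto intro!: restrict_ext simp: f[unfolded One_nat_def]) (auto simp: simplical_face_def standard_simplex_0)
  have "{..1::nat} = {0,1}" by auto
  then show ?thesis
    by (simp add: chain_boundary_of 0[simplified] 1[simplified])
qed

definition simplex_path :: "((nat \<Rightarrow> real) \<Rightarrow> 'a) \<Rightarrow> real \<Rightarrow> 'a" where
  "simplex_path s t = s (\<lambda>i. if i = 0 then 1 - t else if i = 1 then t else 0)"

lemma path_simplex_path:
  assumes "singular_simplex 1 (top_of_set X) s"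
  shows "path (simplex_path s)" "path_image (simplex_path s) \<subseteq> X" "path_simplex (simplex_path s) = s"
proof -
  let ?i = "\<lambda>(t::real) i::nat. if i = 0 then 1 - t else if i = 1 then t else 0"
  have "continuous_map (top_of_set {0..1}) (powertop_real UNIV) ?i"
    unfolding continuous_map_componentwise_UNIV
  proof
    fix k :: nat
    have "k = 0 \<or> k = 1 \<or> k = 2 \<or> 2 < k" by linarith
    then show "continuous_map (top_of_set {0..1}) euclidean (\<lambda>x. ?i x k)"
      by (auto intro!: continuous_intros)
  qed
  then have "continuous_map (top_of_set {0..1}) (subtopology (powertop_real UNIV) (standard_simplex 1)) ?i"
    by (auto simp: continuous_map_in_subtopology mem_standard_simplex_1_Suc)
  then have "continuous_map (top_of_set {0..1}) (top_of_set X) (s \<circ> ?i)"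
    using assms unfolding singular_simplex_def by (blast intro: continuous_map_compose)
  moreover have "s \<circ> ?i = simplex_path s"
    by (auto simp: simplex_path_def)
  ultimately show "path (simplex_path s)" "path_image (simplex_path s) \<subseteq> X"
    by (auto simp: path_def path_image_def)
  show "path_simplex (simplex_path s) = s"
  proof
    fix x
    show "path_simplex (simplex_path s) x = s x"
    proof (cases "x \<in> standard_simplex 1")
      case True
      then have "?i (x 1) = x"
        by (auto simp: mem_standard_simplex_1_Suc fun_eq_iff)
      from arg_cong[OF this, of s] True show ?thesis
        by (simp add: path_simplex_def simplex_path_def del: One_nat_def)
    next
      case False
      with assms show ?thesis by (auto simp: singular_simplex_def path_simplex_def extensional_def)
    qed
  qed
qed

lemma triangle_simplex_of_simplex:
  assumes "singular_simplex 2 (top_of_set X) s"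
  obtains T where "continuous_on simplex_domain T" "T ` simplex_domain \<subseteq> X" "triangle_simplex T = s"
proof
  \<comment> \<open>\<open>1 - a\<close>, \<open>a - b\<close>, \<open>b\<close> are the barycentric
    coordinates of \<open>(a, b)\<close> with respect to the vertices \<open>(0, 0)\<close>,
    \<open>(1, 0)\<close>, \<open>(1, 1)\<close>.\<close>
  let ?i = "\<lambda>(p::real \<times> real) i::nat. if i = 0 then 1 - fst p else if i = 1 then fst p - snd p else if i = 2 then snd p else 0"
  have "continuous_map (top_of_set simplex_domain) (powertop_real UNIV) ?i"
    unfolding continuous_map_componentwise_UNIV
  proof
    fix k :: nat
    have "k = 0 \<or> k = 1 \<or> k = 2 \<or> 2 < k" by linarith
    then show "continuous_map (top_of_set simplex_domain) euclidean (\<lambda>x. ?i x k)"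
      by (auto intro!: continuous_intros)
  qed
  then have "continuous_map (top_of_set simplex_domain) (subtopology (powertop_real UNIV) (standard_simplex 2)) ?i"
    by (auto simp: continuous_map_in_subtopology mem_standard_simplex_2 simplex_domain_def)
  then have "continuous_map (top_of_set simplex_domain) (top_of_set X) (s \<circ> ?i)"
    using assms unfolding singular_simplex_def by (blast intro: continuous_map_compose)
  then show "continuous_on simplex_domain (s \<circ> ?i)" "(s \<circ> ?i) ` simplex_domain \<subseteq> X" by auto
  show "triangle_simplex (s \<circ> ?i) = s"
  proof
    fix x
    show "triangle_simplex (s \<circ> ?i) x = s x"
    proof (cases "x \<in> standard_simplex 2")
      case True
      then have "?i (x 1 + x 2, x 2) = x"
        by (auto simp: mem_standard_simplex_2 fun_eq_iff)
      from arg_cong[OF this, of s] True show ?thesis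
        by (simp add: triangle_simplex_def del: One_nat_def)
    next
      case False
      with assms show ?thesis by (auto simp: singular_simplex_def triangle_simplex_def extensional_def)
    qed
  qed
qed

section \<open>Covering spaces and the first homology group\<close>

text \<open>Paths in \<open>U\<close> from one point of the fibre to the others become loops at
  \<open>y\<close>. If two of these loops were homotopic in \<open>Y\<close>, their images under
  \<open>f\<close> would be homotopic in \<open>X\<close>, and monodromy of \<open>p\<close> would
  identify the end points. The detour through \<open>f\<close> allows \<open>Y\<close> to be the
  blow-up, which does not lie in a normed space.\<close>

lemma infinite_fundamental_group:
  fixes p :: "'a::real_normed_vector \<Rightarrow> 'b::real_normed_vector" and q :: "'a \<Rightarrow> 'c::topological_space"
  assumes cov: "covering_space U p X" and U: "path_connected U"
    and q: "continuous_on U q" "q ` U \<subseteq> Y" and f: "continuous_on Y f" "f ` Y \<subseteq> X"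
    and fq: "\<And>u. u \<in> U \<Longrightarrow> f (q u) = p u"
    and inf: "infinite {u \<in> U. q u = y}"
  shows "infinite (carrier (fundamental_group Y y))"
proof -
  obtain u0 where u0: "u0 \<in> U" "q u0 = y"
    using inf by (metis (mono_tags, lifting) Collect_empty_eq finite.emptyI)
  have "\<exists>g. path g \<and> path_image g \<subseteq> U \<and> pathstart g = u0 \<and> pathfinish g = v" if "v \<in> U" for v
    using U u0 that unfolding path_connected_def by blast
  then obtain g where g: "\<And>v. v \<in> U \<Longrightarrow> path (g v)" "\<And>v. v \<in> U \<Longrightarrow> path_image (g v) \<subseteq> U"
    "\<And>v. v \<in> U \<Longrightarrow> pathstart (g v) = u0" "\<And>v. v \<in> U \<Longrightarrow> pathfinish (g v) = v"
    by metis
  let ?R = "{(g, h). g \<in> loops_at Y y \<and> homotopic_paths Y g h}"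
  have loop: "q \<circ> g v \<in> loops_at Y y" if "v \<in> U" "q v = y" for v
    unfolding loops_at_def
    using that g[OF that(1)] q u0
    by (auto simp: pathstart_compose pathfinish_compose path_image_compose
        intro!: path_continuous_image continuous_on_subset[OF q(1)])
  have "inj_on (\<lambda>v. ?R `` {q \<circ> g v}) {u \<in> U. q u = y}"
  proof (rule inj_onI)
    fix v w
    assume "v \<in> {u \<in> U. q u = y}" "w \<in> {u \<in> U. q u = y}" then have v: "v \<in> U" "q v = y" and w: "w \<in> U" "q w = y" by auto
    assume eq: "?R `` {q \<circ> g v} = ?R `` {q \<circ> g w}"
    have lw: "q \<circ> g w \<in> loops_at Y y" using loop v w by auto
    then have "q \<circ> g w \<in> ?R `` {q \<circ> g w}"
      by (auto simp: loops_at_def)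
    then have "homotopic_paths Y (q \<circ> g v) (q \<circ> g w)" using eq by blast
    then have "homotopic_paths X (f \<circ> (q \<circ> g v)) (f \<circ> (q \<circ> g w))"
      by (rule homotopic_paths_continuous_image) (use f in auto)
    \<comment> \<open>\<open>f \<circ> q\<close> agrees with \<open>p\<close> on \<open>U\<close>
      only, so the composites with \<open>g x\<close> coincide on the unit interval and not as
      functions; \<open>homotopic_paths_eq\<close> bridges this.\<close>
    moreover have "f (q (g x t)) = p (g x t)" if "x \<in> U" "t \<in> {0..1}" for x t
      using g(2)[OF that(1)] that(2) by (auto simp: path_image_def intro!: fq)
    moreover have "path (p \<circ> g x)" "path_image (p \<circ> g x) \<subseteq> X" if "x \<in> U" for x
      using g[OF that] covering_space_imp_continuous[OF cov] covering_space_imp_surjective[OF cov]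
      by (auto simp: path_image_compose intro!: path_continuous_image intro: continuous_on_subset)
    ultimately have "homotopic_paths X (p \<circ> g x) (f \<circ> (q \<circ> g x))" if "x \<in> U" for x
      using that by (intro homotopic_paths_eq) auto
    with \<open>homotopic_paths X (f \<circ> (q \<circ> g v)) (f \<circ> (q \<circ> g w))\<close> v(1) w(1)
    have h: "homotopic_paths X (p \<circ> g v) (p \<circ> g w)"
      by (meson homotopic_paths_sym homotopic_paths_trans)
    have "pathfinish (g v) = pathfinish (g w)"
      by (rule covering_space_monodromy[OF cov _ _ _ _ h])
        (use g v w h in \<open>auto dest: homotopic_paths_imp_path homotopic_paths_imp_subset\<close>)
    then show "v = w" using g(4) v(1) w(1) by metis
  qed
  then have "infinite ((\<lambda>v. ?R `` {q \<circ> g v}) ` {u \<in> U. q u = y})"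
    using inf by (simp add: finite_image_iff)
  moreover have "(\<lambda>v. ?R `` {q \<circ> g v}) ` {u \<in> U. q u = y} \<subseteq> carrier (fundamental_group Y y)"
    using loop by (auto simp: fundamental_group_def quotient_def)
  ultimately show ?thesis by (rule infinite_super[rotated])
qed

lemma chain_induct [consumes 1, case_names zero simplex diff]:
  assumes "singular_chain n X c" "P 0" "\<And>s. singular_simplex n X s \<Longrightarrow> P (frag_of s)"
    "\<And>a b. P a \<Longrightarrow> P b \<Longrightarrow> P (a - b)"
  shows "P c"
  using assms(1) unfolding singular_chain_def
proof (rule frag_induction)
  show "P 0" by (rule assms(2))
  show "P (frag_of s)" if "s \<in> singular_simplex_set n X" for s
    using that by (simp add: assms(3))
  show "P (a - b)" if "P a" "P b" for a b using that by (rule assms(4))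
qed

text \<open>Let \<open>k x\<close> be a path from \<open>b\<close> to \<open>x\<close>, and let
  \<open>K\<close> send a vertex to the chain of that path. Modulo boundaries, \<open>c\<close>
  minus \<open>K\<close> of its boundary is a combination of loops at \<open>b\<close>, one for each
  simplex; for a cycle the correction vanishes.\<close>

lemma cycles_generated_by_loops:
  fixes X :: "'a::real_normed_vector set"
  assumes X: "path_connected X" "b \<in> X"
    and null: "\<And>c. null_homologous X c \<Longrightarrow> Q c"
    and diff: "\<And>c d. Q c \<Longrightarrow> Q d \<Longrightarrow> Q (c - d)"
    and loop: "\<And>g. path g \<Longrightarrow> path_image g \<subseteq> X \<Longrightarrow> pathstart g = b \<Longrightarrow> pathfinish g = b \<Longrightarrow> Q (path_chain g)"
    and c: "singular_relcycle 1 (top_of_set X) {} c"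
  shows "Q c"
proof -
  have "\<exists>g. path g \<and> path_image g \<subseteq> X \<and> pathstart g = b \<and> pathfinish g = x" if "x \<in> X" for x
    using X that unfolding path_connected_def by blast
  then obtain k where k: "\<And>x. x \<in> X \<Longrightarrow> path (k x)" "\<And>x. x \<in> X \<Longrightarrow> path_image (k x) \<subseteq> X"
    "\<And>x. x \<in> X \<Longrightarrow> pathstart (k x) = b" "\<And>x. x \<in> X \<Longrightarrow> pathfinish (k x) = x"
    by metis
  define K where "K s = path_chain (k (s (\<lambda>j. if j = 0 then 1 else 0)))" for s :: "(nat \<Rightarrow> real) \<Rightarrow> 'a"
  have add: "Q (c + d)" if "Q c" "Q d" for c d
    using diff[OF that(1) diff[OF null[OF singular_relboundary_0] that(2)]] by simp
  \<comment> \<open>The claim is made for all chains, because the simplices of a cycle are not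
    cycles themselves and the induction passes through them.\<close>
  have "Q (c - frag_extend K (chain_boundary 1 c))" if "singular_chain 1 (top_of_set X) c" for c
    using that
  proof (induction rule: chain_induct)
    case zero
    then show ?case using null by simp
  next
    case (simplex s)
    define g where "g = simplex_path s"
    have g: "path g" "path_image g \<subseteq> X" "path_simplex g = s"
      unfolding g_def using path_simplex_path[OF simplex] by auto
    have gX: "pathstart g \<in> X" "pathfinish g \<in> X"
      using g pathstart_in_path_image pathfinish_in_path_image by blast+
    let ?r = "reversepath (k (pathfinish g))"
    let ?l = "k (pathstart g) +++ (g +++ ?r)"
    have *: "null_homologous X (path_chain (g +++ ?r) - path_chain g - path_chain ?r)"
      "null_homologous X (path_chain ?l - path_chain (k (pathstart g)) - path_chain (g +++ ?r))"
      by (rule null_homologous_joinpaths; use g gX k in \<open>auto intro!: path_join_imp simp: path_image_join\<close>)+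
    have "null_homologous X (path_chain (k (pathfinish g)) + path_chain ?r)"
      by (rule null_homologous_reversepath; use gX k in auto)
    from null[OF singular_relboundary_add[OF singular_relboundary_add[OF *] this]]
    have "Q (path_chain ?l - (path_chain (k (pathstart g)) + frag_of s - path_chain (k (pathfinish g))))"
      by (simp add: algebra_simps g)
    moreover have "Q (path_chain ?l)"
      by (rule loop) (use g gX k in \<open>auto intro!: path_join_imp simp: path_image_join\<close>)
    ultimately have "Q (path_chain (k (pathstart g)) + frag_of s - path_chain (k (pathfinish g)))"
      using diff by fastforce
    moreover have cb: "chain_boundary 1 (frag_of s) =
      frag_of (restrict (\<lambda>_. g 1) (standard_simplex 0)) - frag_of (restrict (\<lambda>_. g 0) (standard_simplex 0))"
      using chain_boundary_path_chain[of g] g by simp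
    ultimately show ?case unfolding cb
      by (simp add: frag_extend_diff K_def standard_simplex_0 pathstart_def pathfinish_def algebra_simps)
  next
    case (diff a b)
    have "a - b - frag_extend K (chain_boundary 1 (a - b)) =
      (a - frag_extend K (chain_boundary 1 a)) - (b - frag_extend K (chain_boundary 1 b))"
      by (simp add: chain_boundary_diff frag_extend_diff)
    then show ?case using assms(4)[OF diff] by (simp only:)
  qed
  from this[of c] c show ?thesis by (simp add: singular_cycle)
qed

text \<open>By \<open>two\<close> the coefficients may be reduced modulo 2, which leaves the classes
  of \<open>0\<close>, \<open>a\<close>, \<open>b\<close>, \<open>a + b\<close>; \<open>nz\<close>
  keeps these apart. Integer coefficients in \<open>gen\<close> make it a property stable under
  differences, the form needed for an induction over generators.\<close>

lemma card_homology_group_4: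
  assumes "singular_relcycle 1 (top_of_set X) {} a" "singular_relcycle 1 (top_of_set X) {} b"
    and two: "null_homologous X (a + a)" "null_homologous X (b + b)"
    and nz: "\<not> null_homologous X a" "\<not> null_homologous X b" "\<not> null_homologous X (a + b)"
    and gen: "\<And>c. singular_relcycle 1 (top_of_set X) {} c \<Longrightarrow>
      \<exists>i j. null_homologous X (c - (frag_cmul i a + frag_cmul j b))"
  shows "finite (carrier (homology_group 1 (top_of_set X))) \<and> card (carrier (homology_group 1 (top_of_set X))) = 4"
proof -
  define H where "H = homologous_rel_set 1 (top_of_set X) {}"
  note add = singular_relboundary_add[where p=1 and S="{}" and X="top_of_set X"]
  note cmul = singular_relboundary_cmul[where p=1 and S="{}" and X="top_of_set X"]
  have eq: "H c = H d \<longleftrightarrow> null_homologous X (c - d)" for c d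
    unfolding H_def homologous_rel_set_eq by (simp only: homologous_rel_def)
  have par: "\<exists>e\<in>{0, 1}. null_homologous X (frag_cmul i a' - frag_cmul e a')"
    if "null_homologous X (a' + a')" for i :: int and a'
  proof
    show "i mod 2 \<in> {0, 1}" by auto
    have "frag_cmul i a' - frag_cmul (i mod 2) a' = frag_cmul (i div 2) (a' + a')"
      by (simp add: frag_cmul_distrib2 flip: frag_cmul_distrib frag_cmul_diff_distrib)
        (simp add: minus_mod_eq_mult_div mult.commute)
    then show "null_homologous X (frag_cmul i a' - frag_cmul (i mod 2) a')"
      using cmul[OF that] by simp
  qed
  have "carrier (homology_group 1 (top_of_set X)) = H ` singular_relcycle_set 1 (top_of_set X) {}"
    using carrier_relative_homology_group[of 1] by (simp add: H_def)
  also have "\<dots> = {H 0, H a, H b, H (a + b)}"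
  proof
    show "H ` singular_relcycle_set 1 (top_of_set X) {} \<subseteq> {H 0, H a, H b, H (a + b)}"
    proof (rule image_subsetI)
      fix c assume "c \<in> singular_relcycle_set 1 (top_of_set X) {}"
      then have c: "singular_relcycle 1 (top_of_set X) {} c" by simp
      obtain i j where ij: "null_homologous X (c - (frag_cmul i a + frag_cmul j b))"
        using gen[OF c] by blast
      obtain e where e: "e \<in> {0,1}" "null_homologous X (frag_cmul i a - frag_cmul e a)"
        using par[OF two(1)] by blast
      obtain f where f: "f \<in> {0,1}" "null_homologous X (frag_cmul j b - frag_cmul f b)"
        using par[OF two(2)] by blast
      have "null_homologous X (c - (frag_cmul e a + frag_cmul f b))"
        using add[OF ij add[OF e(2) f(2)]] by (simp add: algebra_simps)
      then have "H c = H (frag_cmul e a + frag_cmul f b)" by (simp only: eq)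
      then show "H c \<in> {H 0, H a, H b, H (a + b)}"
        using e(1) f(1) by (elim insertE emptyE; simp)
    qed
    show "{H 0, H a, H b, H (a + b)} \<subseteq> H ` singular_relcycle_set 1 (top_of_set X) {}"
      using assms(1,2) singular_relcycle_add[OF assms(1,2)] by (intro insert_subsetI imageI CollectI) simp_all
  qed
  finally have *: "carrier (homology_group 1 (top_of_set X)) = {H 0, H a, H b, H (a + b)}" .
  have m: "null_homologous X c" if "null_homologous X (- c)" for c
    using that by (simp add: singular_relboundary_minus)
  have "H 0 \<noteq> H a" "H 0 \<noteq> H b" "H 0 \<noteq> H (a + b)" "H a \<noteq> H (a + b)" "H b \<noteq> H (a + b)"
    using nz m[of a] m[of b] m[of "a + b"] unfolding eq diff_0 by (auto simp: add_diff_cancel_left' diff_add_cancel algebra_simps)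
  \<comment> \<open>\<open>a - b\<close> and \<open>a + b\<close> differ by \<open>b + b\<close>, so
    equal classes of \<open>a\<close> and \<open>b\<close> would make \<open>a + b\<close> a
    boundary.\<close>
  moreover have "H a \<noteq> H b"
    using nz(3) add[OF _ two(2), of "a - b"] unfolding eq by (auto simp: algebra_simps)
  ultimately show ?thesis unfolding * by (simp add: card_insert_if)
qed

locale regular_cover =
  fixes U :: "'a::real_normed_vector set" and p :: "'a \<Rightarrow> 'b::real_normed_vector"
    and X :: "'b set" and G :: "('a \<Rightarrow> 'a) set"
  assumes cover: "covering_space U p X"
    and continuous_deck: "h \<in> G \<Longrightarrow> continuous_on U h"
    and deck_in: "h \<in> G \<Longrightarrow> u \<in> U \<Longrightarrow> h u \<in> U"
    and p_deck: "h \<in> G \<Longrightarrow> u \<in> U \<Longrightarrow> p (h u) = p u"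
    and deck_transitive: "u \<in> U \<Longrightarrow> v \<in> U \<Longrightarrow> p u = p v \<Longrightarrow> \<exists>h\<in>G. v = h u"
begin

lemma path_p: "path g \<Longrightarrow> path_image g \<subseteq> U \<Longrightarrow> path (p \<circ> g)"
  by (rule path_continuous_image[OF _ continuous_on_subset[OF covering_space_imp_continuous[OF cover]]])

lemma path_image_p: "path_image g \<subseteq> U \<Longrightarrow> path_image (p \<circ> g) \<subseteq> X"
  using covering_space_imp_surjective[OF cover] by (auto simp: path_image_compose)

text \<open>Transitivity on the fibre gives \<open>h\<close> with \<open>g' 0 = h (g 0)\<close>.
  Then \<open>h \<circ> g\<close> and \<open>g'\<close> lift the same path from the same point, and
  lifts are unique.\<close>

lemma lift_translate:
  assumes "path g" "path_image g \<subseteq> U" "path g'" "path_image g' \<subseteq> U"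
    and eq: "\<And>t. t \<in> {0..1} \<Longrightarrow> p (g t) = p (g' t)"
  shows "\<exists>h\<in>G. \<forall>t\<in>{0..1}. g' t = h (g t)"
proof -
  have "g 0 \<in> U" "g' 0 \<in> U" using assms by (auto simp: path_image_def)
  then obtain h where h: "h \<in> G" "g' 0 = h (g 0)"
    using deck_transitive eq by fastforce
  have "g' t = (h \<circ> g) t" if "t \<in> {0..1}" for t
  proof (rule covering_space_lift_unique[OF cover, where a = 0 and T = "{0..1}" and f = "p \<circ> g"
        and ?g1.0 = g' and ?g2.0 = "h \<circ> g" and x = t])
    show "continuous_on {0..1} (p \<circ> g)" using path_p assms by (simp add: path_def)
    show "continuous_on {0..1} g'" using assms by (simp add: path_def)
    show "continuous_on {0..1} (h \<circ> g)" using assms h continuous_deck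
      by (metis continuous_on_compose continuous_on_subset path_def path_image_def)
    have gU: "g ` {0..1} \<subseteq> U" "g' ` {0..1} \<subseteq> U" using assms by (auto simp: path_image_def)
    then show "g' \<in> {0..1} \<rightarrow> U" "h \<circ> g \<in> {0..1} \<rightarrow> U"
      using deck_in[OF h(1)] by auto
    show "p \<circ> g \<in> {0..1} \<rightarrow> X"
      using gU covering_space_imp_surjective[OF cover] by auto
    show "(p \<circ> g) x = p (g' x)" if "x \<in> {0..1}" for x
      using eq[OF that] by simp
    show "(p \<circ> g) x = p ((h \<circ> g) x)" if "x \<in> {0..1}" for x
    proof -
      have "g x \<in> U" using gU that by blast
      from p_deck[OF h(1) this] show ?thesis by simp
    qed
  qed (use h that in auto)
  then show ?thesis using h(1) by (intro bexI[of _ h]) simp_all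
qed

text \<open>Along any lift of a path the change of an equivariant two-valued label is the same, so it is
  a cocycle modulo 2.\<close>

lemma parity_cocycle:
  assumes e: "\<And>h. h \<in> G \<Longrightarrow> \<exists>b. \<forall>u\<in>U. e (h u) \<longleftrightarrow> (e u \<noteq> b)"
  obtains E :: "'b chain \<Rightarrow> int" where "\<And>c d. E (c + d) = E c + E d"
    "\<And>c. null_homologous X c \<Longrightarrow> even (E c)"
    "\<And>g. path g \<Longrightarrow> path_image g \<subseteq> U \<Longrightarrow>
      E (path_chain (p \<circ> g)) = of_bool (e (pathstart g) \<noteq> e (pathfinish g))"
proof -
  define lift where "lift s g \<longleftrightarrow> path g \<and> path_image g \<subseteq> U \<and> path_simplex (p \<circ> g) = s" for s g
  define ch where "ch s = (\<exists>g. lift s g \<and> e (pathstart g) \<noteq> e (pathfinish g))" for s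
  \<comment> \<open>The linear extension takes values in the free abelian group on a one-element
    type, whose single coefficient is the wanted integer.\<close>
  define E where "E c = Poly_Mapping.lookup (frag_extend (\<lambda>s. frag_cmul (of_bool (ch s)) (frag_of ())) c) ()" for c
  have E_of: "E (frag_of s) = of_bool (ch s)" for s
    by (simp add: E_def)
  have E_add: "E (c + d) = E c + E d" "E (c - d) = E c - E d" for c d
    by (simp_all add: E_def frag_extend_add frag_extend_diff lookup_add lookup_minus)
  have same: "(e (pathstart g) \<noteq> e (pathfinish g)) = (e (pathstart g') \<noteq> e (pathfinish g'))"
    if "lift s g" "lift s g'" for s g g'
  proof -
    have "p (g t) = p (g' t)" if t: "t \<in> {0..1}" for t
    proof -
      have "path_simplex (p \<circ> g) = path_simplex (p \<circ> g')" using \<open>lift s g\<close> \<open>lift s g'\<close> by (simp add: lift_def)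
      from fun_cong[OF this, of "\<lambda>i. if i = 0 then 1 - t else if i = 1 then t else 0"] t
      show ?thesis by (simp add: path_simplex_def mem_standard_simplex_1_Suc)
    qed
    moreover have "path g" "path_image g \<subseteq> U" "path g'" "path_image g' \<subseteq> U"
      using that by (simp_all add: lift_def)
    ultimately obtain h where "h \<in> G" and h: "\<forall>t\<in>{0..1}. g' t = h (g t)"
      using lift_translate[of g g'] by blast
    then obtain b where "\<forall>u\<in>U. e (h u) \<longleftrightarrow> (e u \<noteq> b)" using e by blast
    moreover have "pathstart g \<in> U" "pathfinish g \<in> U"
      using that pathstart_in_path_image pathfinish_in_path_image unfolding lift_def by blast+
    ultimately show ?thesis
      using h by (auto simp: pathstart_def pathfinish_def)
  qed
  have E_path: "E (path_chain (p \<circ> g)) = of_bool (e (pathstart g) \<noteq> e (pathfinish g))"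
    if "path g" "path_image g \<subseteq> U" for g
  proof -
    have "lift (path_simplex (p \<circ> g)) g" using that by (simp add: lift_def)
    then have "ch (path_simplex (p \<circ> g)) \<longleftrightarrow> e (pathstart g) \<noteq> e (pathfinish g)"
      unfolding ch_def using same by blast
    then show ?thesis by (simp add: E_of)
  qed
  have E_tri: "even (E (chain_boundary 2 (frag_of s)))" if s: "singular_simplex 2 (top_of_set X) s" for s
  proof -
    obtain T where T: "continuous_on simplex_domain T" "T ` simplex_domain \<subseteq> X" "triangle_simplex T = s"
      using triangle_simplex_of_simplex[OF s] by metis
    have conv: "convex simplex_domain"
      unfolding simplex_domain_def convex_alt
      by (auto intro!: add_mono mult_left_mono convex_bound_le)
    \<comment> \<open>A triangle is convex, so the map lifts. Its edges then compare the values of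
      \<open>e\<close> at the three vertices of one lift, and among three truth values the number of
      unequal pairs is 0 or 2.\<close>
    obtain L where L: "continuous_on simplex_domain L" "L \<in> simplex_domain \<rightarrow> U"
      "\<And>y. y \<in> simplex_domain \<Longrightarrow> p (L y) = T y"
      using covering_space_lift[OF cover convex_imp_simply_connected[OF conv]
          convex_imp_locally_path_connected[OF conv] T(1)] T(2) by blast
    have edge: "E (path_chain (\<lambda>t. T (m t))) = of_bool (e (L (m 0)) \<noteq> e (L (m 1)))"
      if m: "continuous_on {0..1} m" "m ` {0..1} \<subseteq> simplex_domain" for m
    proof -
      have "path (L \<circ> m)" unfolding path_def using m L(1)
        by (metis continuous_on_compose continuous_on_subset)
      moreover have "path_image (L \<circ> m) \<subseteq> U" using m L(2) by (auto simp: path_image_def)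
      moreover have "path_simplex (\<lambda>t. T (m t)) = path_simplex (p \<circ> (L \<circ> m))"
        using m by (intro path_simplex_cong) (simp add: L(3) image_subset_iff)
      ultimately show ?thesis using E_path[of "L \<circ> m"]
        by (simp add: pathstart_def pathfinish_def)
    qed
    have e1: "E (path_chain (\<lambda>t. T (1, t))) = of_bool (e (L (1,0)) \<noteq> e (L (1,1)))"
      by (rule edge) (auto simp: simplex_domain_def intro!: continuous_intros)
    have e2: "E (path_chain (\<lambda>t. T (t, t))) = of_bool (e (L (0,0)) \<noteq> e (L (1,1)))"
      by (rule edge) (auto simp: simplex_domain_def intro!: continuous_intros)
    have e3: "E (path_chain (\<lambda>t. T (t, 0))) = of_bool (e (L (0,0)) \<noteq> e (L (1,0)))"
      by (rule edge) (auto simp: simplex_domain_def intro!: continuous_intros)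
    show ?thesis
      unfolding T(3)[symmetric] chain_boundary_triangle_simplex
      by (simp only: E_add e1 e2 e3) auto
  qed
  have "even (E (chain_boundary 2 d))" if "singular_chain 2 (top_of_set X) d" for d
    using that
  proof (induction rule: chain_induct)
    case zero
    then show ?case by (simp add: E_def)
  next
    case (diff a b)
    then show ?case by (simp add: chain_boundary_diff E_add)
  qed (rule E_tri)
  then have "even (E c)" if "null_homologous X c" for c
    using that unfolding singular_boundary by (auto simp: numeral_2_eq_2)
  with that E_add(1) E_path show ?thesis by blast
qed

end

locale universal_cover = regular_cover +
  assumes simply_connected: "simply_connected U"
begin

definition joining_path :: "'a \<Rightarrow> 'a \<Rightarrow> real \<Rightarrow> 'a" where
  "joining_path u v = (SOME g. path g \<and> path_image g \<subseteq> U \<and> pathstart g = u \<and> pathfinish g = v)"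

definition joining_chain :: "'a \<Rightarrow> 'a \<Rightarrow> 'b chain" where
  "joining_chain u v = path_chain (p \<circ> joining_path u v)"

lemma joining_path:
  assumes "u \<in> U" "v \<in> U"
  shows "path (joining_path u v)" "path_image (joining_path u v) \<subseteq> U"
    "pathstart (joining_path u v) = u" "pathfinish (joining_path u v) = v"
proof -
  have "\<exists>g. path g \<and> path_image g \<subseteq> U \<and> pathstart g = u \<and> pathfinish g = v"
    using simply_connected_imp_path_connected[OF simply_connected] assms unfolding path_connected_def by blast
  from someI_ex[OF this] show "path (joining_path u v)" "path_image (joining_path u v) \<subseteq> U"
    "pathstart (joining_path u v) = u" "pathfinish (joining_path u v) = v"
    unfolding joining_path_def by blast+
qed

text \<open>Paths with the same ends are homotopic in a simply connected \<open>U\<close>, so the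
  arbitrary choice in \<open>joining_path\<close> does not matter modulo boundaries.\<close>

lemma null_homologous_joining_chain:
  assumes "path g" "path_image g \<subseteq> U" "pathstart g = u" "pathfinish g = v"
  shows "null_homologous X (path_chain (p \<circ> g) - joining_chain u v)"
proof -
  have uv: "u \<in> U" "v \<in> U" using assms pathstart_in_path_image pathfinish_in_path_image by blast+
  have "homotopic_paths U g (joining_path u v)"
    using simply_connected joining_path[OF uv] assms unfolding simply_connected_eq_homotopic_paths by metis
  then have "homotopic_paths X (p \<circ> g) (p \<circ> joining_path u v)"
    by (rule homotopic_paths_continuous_image)
      (use covering_space_imp_continuous[OF cover] covering_space_imp_surjective[OF cover] in auto)
  then show ?thesis unfolding joining_chain_def by (rule homotopic_paths_imp_null_homologous)
qed

lemma joining_chain_trans: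
  assumes "u \<in> U" "v \<in> U" "w \<in> U"
  shows "null_homologous X (joining_chain u v + joining_chain v w - joining_chain u w)"
proof -
  note j = joining_path[OF assms(1,2)] joining_path[OF assms(2,3)]
  have "null_homologous X (path_chain (p \<circ> (joining_path u v +++ joining_path v w)) - joining_chain u w)"
    by (rule null_homologous_joining_chain) (use j in \<open>auto intro!: path_join_imp simp: path_image_join\<close>)
  moreover have "null_homologous X (path_chain ((p \<circ> joining_path u v) +++ (p \<circ> joining_path v w))
      - joining_chain u v - joining_chain v w)"
    unfolding joining_chain_def
    by (rule null_homologous_joinpaths) (use j in \<open>auto intro!: path_p path_image_p simp: pathstart_compose pathfinish_compose\<close>)
  ultimately have "null_homologous X ((path_chain ((p \<circ> joining_path u v) +++ (p \<circ> joining_path v w)) - joining_chain u w) -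
    (path_chain ((p \<circ> joining_path u v) +++ (p \<circ> joining_path v w)) - joining_chain u v - joining_chain v w))"
    unfolding path_compose_join by (rule singular_relboundary_diff)
  then show ?thesis by (simp add: algebra_simps)
qed

text \<open>The map \<open>h\<close> carries the chosen path to one that joins \<open>h u\<close> to
  \<open>h v\<close> and has the same image under \<open>p\<close>.\<close>

lemma joining_chain_deck:
  assumes "h \<in> G" "u \<in> U" "v \<in> U"
  shows "null_homologous X (joining_chain u v - joining_chain (h u) (h v))"
proof -
  note j = joining_path[OF assms(2,3)]
  have "null_homologous X (path_chain (p \<circ> (h \<circ> joining_path u v)) - joining_chain (h u) (h v))"
    by (rule null_homologous_joining_chain)
      (use j deck_in[OF assms(1)] continuous_deck[OF assms(1)] in
        \<open>auto simp: pathstart_compose pathfinish_compose path_image_compose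
         intro!: path_continuous_image intro: continuous_on_subset\<close>)
  moreover have "path_simplex (p \<circ> (h \<circ> joining_path u v)) = path_simplex (p \<circ> joining_path u v)"
    using j(2) by (intro path_simplex_cong) (simp add: p_deck[OF assms(1)] path_image_def image_subset_iff)
  ultimately show ?thesis by (simp add: joining_chain_def)
qed

lemma joining_chain_self:
  assumes "u \<in> U" shows "null_homologous X (joining_chain u u)"
  using joining_chain_trans[OF assms assms assms] by simp

text \<open>Once the path to \<open>k u\<close> is translated by \<open>h\<close>, it continues the
  path from \<open>u\<close> to \<open>h u\<close>. Composition of deck maps thus turns into
  addition of homology classes.\<close>

lemma joining_chain_comp:
  assumes "h \<in> G" "k u \<in> U" "u \<in> U"
  shows "null_homologous X (joining_chain u (h u) + joining_chain u (k u) - joining_chain u (h (k u)))"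
proof -
  have "h u \<in> U" "h (k u) \<in> U" using deck_in[OF assms(1)] assms by auto
  from singular_relboundary_add[OF joining_chain_trans[OF assms(3) this] joining_chain_deck[OF assms(1,3,2)]]
  show ?thesis by (simp add: algebra_simps)
qed

lemma cycle_joining_chain:
  assumes "u \<in> U" "v \<in> U" "p u = p v"
  shows "singular_relcycle 1 (top_of_set X) {} (joining_chain u v)"
proof -
  note j = joining_path[OF assms(1,2)]
  have "singular_chain 1 (top_of_set X) (joining_chain u v)"
    using singular_simplex_path_simplex[OF path_p path_image_p] j
    unfolding joining_chain_def by (simp add: singular_chain_of)
  moreover have "chain_boundary 1 (joining_chain u v) = 0"
    using j assms(3) by (simp add: joining_chain_def chain_boundary_path_chain[unfolded One_nat_def] pathstart_def pathfinish_def)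
  ultimately show ?thesis by (simp add: singular_cycle)
qed

text \<open>A loop at \<open>p u\<close> lifts to a path that starts at \<open>u\<close> and ends in
  the same fibre, hence at some \<open>h u\<close>.\<close>

lemma cycles_generated_by_joining_chains:
  assumes u: "u \<in> U"
    and null: "\<And>c. null_homologous X c \<Longrightarrow> Q c"
    and diff: "\<And>c d. Q c \<Longrightarrow> Q d \<Longrightarrow> Q (c - d)"
    and joining: "\<And>h. h \<in> G \<Longrightarrow> Q (joining_chain u (h u))"
    and c: "singular_relcycle 1 (top_of_set X) {} c"
  shows "Q c"
proof (rule cycles_generated_by_loops[where Q = Q and b = "p u", OF _ _ null diff _ c])
  show "path_connected X"
    using path_connected_continuous_image[OF covering_space_imp_continuous[OF cover]]
      covering_space_imp_surjective[OF cover] simply_connected simply_connected_imp_path_connected by metis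
  show "p u \<in> X" using covering_space_imp_surjective[OF cover] u by blast
next
  fix g assume g: "path g" "path_image g \<subseteq> X" "pathstart g = p u" "pathfinish g = p u"
  obtain l where l: "path l" "path_image l \<subseteq> U" "pathstart l = u" "\<And>t. t \<in> {0..1} \<Longrightarrow> p (l t) = g t"
    using covering_space_lift_path_strong[OF cover u g(1-3)] by metis
  have "pathfinish l \<in> U" "p (pathfinish l) = p u"
    using l pathfinish_in_path_image g(4) by (auto simp: pathfinish_def)
  then obtain h where h: "h \<in> G" "pathfinish l = h u"
    using deck_transitive[OF u] by metis
  have "null_homologous X (path_chain (p \<circ> l) - joining_chain u (h u))"
    by (rule null_homologous_joining_chain) (use l h in auto)
  moreover have "path_simplex (p \<circ> l) = path_simplex g"
    using l by (intro path_simplex_cong) auto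
  ultimately have "Q (path_chain g - joining_chain u (h u))" using null by simp
  moreover have "Q (0 - joining_chain u (h u))"
    by (rule diff[OF null[OF singular_relboundary_0] joining[OF h(1)]])
  ultimately show "Q (path_chain g)" using diff by fastforce
qed

end

section \<open>Complements of countable closed sets\<close>

text \<open>Every loop is homotopic to a polynomial one, and the cone over that loop from a generic vertex
  misses a given countable set.\<close>

lemma simply_connected_complement_countable:
  fixes S :: "'a::euclidean_space set"
  assumes dim: "3 \<le> DIM('a)" and S: "closed S" "countable S"
  shows "simply_connected (- S)"
  unfolding simply_connected_eq_contractible_loop_some
proof (intro conjI allI impI)
  show "path_connected (- S)"
    using dim S by (intro path_connected_complement_countable) auto
  fix g :: "real \<Rightarrow> 'a"
  assume g: "path g \<and> path_image g \<subseteq> - S \<and> pathfinish g = pathstart g"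
  obtain e where e: "e > 0" "\<And>x y. x \<in> path_image g \<Longrightarrow> y \<in> S \<Longrightarrow> e \<le> dist x y"
    using separate_compact_closed[of "path_image g" S] compact_path_image S g
    by (metis (no_types, lifting) disjoint_eq_subset_Compl)
  \<comment> \<open>A polynomial loop is differentiable, which the measure estimate for
    \<open>N\<close> requires.\<close>
  obtain f where f: "polynomial_function f" "pathstart f = pathstart g" "pathfinish f = pathfinish g"
    "\<And>t. t \<in> {0..1} \<Longrightarrow> norm (f t - g t) < e"
    using path_approx_polynomial_function[of g e] g e(1) by metis
  have pf: "path f" using f(1) by (rule path_polynomial_function)
  have "homotopic_loops (- S) g f"
  proof (rule homotopic_loops_nearby_explicit)
    fix t :: real and x assume "t \<in> {0..1}" "x \<notin> - S"
    then have "e \<le> dist (g t) x" using e(2) by (auto simp: path_image_def)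
    then show "norm (f t - g t) < norm (g t - x)"
      using f(4)[OF \<open>t \<in> {0..1}\<close>] by (simp add: dist_norm)
  qed (use g f pf in auto)
  have fS: "f t \<notin> S" if "t \<in> {0..1}" for t
    using homotopic_loops_imp_subset[OF \<open>homotopic_loops (- S) g f\<close>] that by (simp add: path_image_def image_subset_iff)
  \<comment> \<open>\<open>N\<close> contains the bad vertices: all points of the lines through some
    \<open>r\<close> in \<open>S\<close> and some \<open>f t\<close>. For each \<open>r\<close> they
    form the image of a plane under a differentiable map, which is negligible in dimension at least
    3.\<close>
  define N where "N = (\<Union>r\<in>S. (\<lambda>p. r + snd p *\<^sub>R (r - f (fst p))) ` (UNIV :: (real \<times> real) set))"
  have "negligible N"
    unfolding N_def
  proof (rule negligible_countable_Union)
    show "countable ((\<lambda>r. (\<lambda>p. r + snd p *\<^sub>R (r - f (fst p))) ` (UNIV :: (real \<times> real) set)) ` S)"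
      using S(2) by simp
    fix T assume "T \<in> (\<lambda>r. (\<lambda>p. r + snd p *\<^sub>R (r - f (fst p))) ` (UNIV :: (real \<times> real) set)) ` S"
    then obtain r where T: "T = (\<lambda>p. r + snd p *\<^sub>R (r - f (fst p))) ` (UNIV :: (real \<times> real) set)" by blast
    have "f differentiable (at x)" for x
      by (rule differentiable_at_polynomial_function[OF f(1)])
    from differentiable_chain_at[OF bounded_linear_imp_differentiable[OF bounded_linear_fst] this]
    have d: "(\<lambda>p. f (fst p)) differentiable (at p)" for p :: "real \<times> real"
      by (simp add: o_def)
    have "(\<lambda>p. r + snd p *\<^sub>R (r - f (fst p))) differentiable_on (UNIV :: (real \<times> real) set)"
      unfolding differentiable_on_def
    proof
      fix p :: "real \<times> real"
      have "(snd :: real \<times> real \<Rightarrow> real) differentiable (at p)"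
        by (rule bounded_linear_imp_differentiable[OF bounded_linear_snd])
      from differentiable_add[OF differentiable_const differentiable_scaleR[OF this differentiable_diff[OF differentiable_const d]]]
      show "(\<lambda>p. r + snd p *\<^sub>R (r - f (fst p))) differentiable (at p)" .
    qed
    then show "negligible T"
      unfolding T by (rule negligible_differentiable_image_lowdim[rotated]) (use dim in simp)
  qed
  then have "N \<noteq> UNIV" by auto
  then obtain q where q: "q \<notin> N" by blast
  have qS: "q \<notin> S"
  proof
    assume "q \<in> S"
    \<comment> \<open>The parameters \<open>(0, 0)\<close> give \<open>r\<close> itself, so
      \<open>S\<close> is contained in \<open>N\<close>.\<close>
    then have "q \<in> N" unfolding N_def by (intro UN_I[of q] image_eqI[of _ _ "(0, 0)"]) auto
    with q show False by blast
  qed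
  have "homotopic_loops (- S) f (linepath q q)"
  proof (rule homotopic_loops_linear)
    fix t :: real and x assume t: "t \<in> {0..1}"
    show "closed_segment (f t) (linepath q q t) \<subseteq> - S"
    proof (rule subsetI, rule ComplI)
      fix r assume "r \<in> closed_segment (f t) (linepath q q t)" "r \<in> S"
      then obtain u where u: "r = (1 - u) *\<^sub>R f t + u *\<^sub>R q" "0 \<le> u" "u \<le> 1"
        by (auto simp: closed_segment_def linepath_refl)
      have "u \<noteq> 0" using u fS[OF t] \<open>r \<in> S\<close> by auto
      then have "q = (1 / u) *\<^sub>R (r - (1 - u) *\<^sub>R f t)" unfolding u(1) by simp
      also have "\<dots> = r + ((1 - u) / u) *\<^sub>R (r - f t)"
      proof -
        have "(1 / u) *\<^sub>R r = r + ((1 - u) / u) *\<^sub>R r"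
          using \<open>u \<noteq> 0\<close> by (simp add: diff_divide_distrib algebra_simps)
        then show ?thesis by (simp add: scaleR_diff_right)
      qed
      finally have "q \<in> N" unfolding N_def using \<open>r \<in> S\<close> by (intro UN_I[of r] image_eqI[of _ _ "(t, (1 - u) / u)"]) auto
      with q show False by blast
    qed
  qed (use f g pf in auto)
  with \<open>homotopic_loops (- S) g f\<close> qS
  show "\<exists>a. a \<in> - S \<and> homotopic_loops (- S) g (linepath a a)"
    by (auto intro!: exI[of _ q] intro: homotopic_loops_trans)
qed

text \<open>If every nontrivial element moves \<open>u\<close> by at least \<open>e\<close>, the
  sheets near \<open>p u\<close> are the translates of the ball of radius \<open>e / 2\<close> about
  \<open>u\<close>. Isometries carry balls to balls, and two points of the ball in one fibre would
  give an element moving \<open>u\<close> by less than \<open>e\<close>. \<open>G_group\<close>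
  supplies the quotient of two elements, by which overlapping sheets are compared.\<close>

lemma covering_space_isometric_deck:
  fixes U :: "'a::metric_space set" and p :: "'a \<Rightarrow> 'b::metric_space"
  assumes p: "continuous_on U p" "p ` U = X"
    and p_open: "\<And>V. openin (top_of_set U) V \<Longrightarrow> openin (top_of_set X) (p ` V)"
    and G_in: "\<And>h u. h \<in> G \<Longrightarrow> u \<in> U \<Longrightarrow> h u \<in> U"
    and G_isometry: "\<And>h u v. h \<in> G \<Longrightarrow> dist (h u) (h v) = dist u v"
    and G_group: "\<And>h k. h \<in> G \<Longrightarrow> k \<in> G \<Longrightarrow> \<exists>j\<in>G. \<forall>u. j (k u) = h u"
    and G_surj: "\<And>h u. h \<in> G \<Longrightarrow> u \<in> U \<Longrightarrow> \<exists>v\<in>U. h v = u"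
    and fibre: "\<And>u v. u \<in> U \<Longrightarrow> v \<in> U \<Longrightarrow> p u = p v \<longleftrightarrow> (\<exists>h\<in>G. v = h u)"
    and free: "\<And>u. u \<in> U \<Longrightarrow> \<exists>e>0. \<forall>h\<in>G. (\<forall>v. h v = v) \<or> e \<le> dist (h u) u"
  shows "covering_space U p X"
proof (rule covering_spaceI[OF p])
  fix x assume "x \<in> X"
  then obtain u where u: "u \<in> U" "x = p u" using p by blast
  then obtain e where e: "e > 0" "\<And>h. h \<in> G \<Longrightarrow> (\<forall>v. h v = v) \<or> e \<le> dist (h u) u"
    using free by metis
  define V where "V h = U \<inter> ball (h u) (e / 2)" for h
  have p_G: "p (h v) = p v" if "h \<in> G" "v \<in> U" for h v
    using fibre[of v "h v"] that G_in by auto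
  have hV: "h ` V id = V h" if h: "h \<in> G" for h
  proof
    show "h ` V id \<subseteq> V h" using G_in[OF h] G_isometry[OF h] by (auto simp: V_def)
    show "V h \<subseteq> h ` V id"
    proof
      fix v assume v: "v \<in> V h"
      then obtain w where "w \<in> U" "h w = v" using G_surj[OF h] by (auto simp: V_def)
      then show "v \<in> h ` V id" using v G_isometry[OF h, of u w] by (auto simp: V_def)
    qed
  qed
  have inj_V: "a = b" if ab: "a \<in> V id" "b \<in> V id" "p a = p b" for a b
  proof -
    obtain j where j: "j \<in> G" "b = j a" using ab fibre[of a b] by (auto simp: V_def)
    have "dist (j u) u \<le> dist (j u) (j a) + dist b u" unfolding j(2) by (rule dist_triangle)
    also have "\<dots> < e" using ab G_isometry[OF j(1)] by (simp add: V_def dist_commute)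
    finally show ?thesis using e(2)[OF j(1)] j by auto
  qed
  have opV: "openin (top_of_set U) (V h)" for h
    unfolding V_def by (simp add: openin_open_Int)
  have opT: "openin (top_of_set X) (p ` V id)" using p_open opV by blast
  show "\<exists>T. x \<in> T \<and> openin (top_of_set X) T \<and>
      (\<exists>v. \<Union>v = U \<inter> p -` T \<and> (\<forall>u\<in>v. openin (top_of_set U) u) \<and> pairwise disjnt v \<and>
        (\<forall>u\<in>v. \<exists>q. homeomorphism u T p q))"
  proof (intro exI conjI)
    show "x \<in> p ` V id" using u e(1) by (auto simp: V_def)
    show "openin (top_of_set X) (p ` V id)" by (rule opT)
    show "\<Union>(V ` G) = U \<inter> p -` p ` V id"
    proof
      show "\<Union>(V ` G) \<subseteq> U \<inter> p -` p ` V id"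
      proof (rule UN_least, rule subsetI)
        fix h a assume h: "h \<in> G" and a: "a \<in> V h"
        then obtain b where b: "b \<in> V id" "a = h b" using hV[OF h] by blast
        then have "p a = p b" using p_G[OF h, of b] by (simp add: V_def)
        then show "a \<in> U \<inter> p -` p ` V id" using a b(1) by (simp add: V_def)
      qed
      show "U \<inter> p -` p ` V id \<subseteq> \<Union>(V ` G)"
      proof clarify
        fix a b assume a: "a \<in> U" "p a = p b" "b \<in> V id"
        then obtain h where h: "h \<in> G" "a = h b" using fibre[of b a] by (auto simp: V_def)
        then show "a \<in> \<Union>(V ` G)" using hV[OF h(1)] a(3) by blast
      qed
    qed
    show "\<forall>u\<in>V ` G. openin (top_of_set U) u" using opV by blast
    show "pairwise disjnt (V ` G)"
    proof (clarsimp simp: pairwise_def disjnt_iff)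
      fix h k c assume hk: "h \<in> G" "k \<in> G" "V h \<noteq> V k" and c: "c \<in> V h" "c \<in> V k"
      obtain a b where ab: "a \<in> V id" "c = h a" "b \<in> V id" "c = k b" using hV hk c by blast
      then have "p a = p b" using p_G hk by (metis IntE V_def)
      then have "a = b" using ab inj_V by blast
      \<comment> \<open>\<open>j\<close> plays the role of \<open>h\<close> times the inverse of
        \<open>k\<close>. It fixes the common point \<open>c\<close>, so freeness at
        \<open>c\<close> makes it the identity and the two sheets coincide.\<close>
      obtain j where j: "j \<in> G" "\<And>v. j (k v) = h v" using G_group[OF hk(1,2)] by blast
      have "j c = c" using j(2)[of b] ab \<open>a = b\<close> by simp
      have "c \<in> U" using c by (simp add: V_def)
      then obtain e' where "e' > 0" "(\<forall>v. j v = v) \<or> e' \<le> dist (j c) c" using free j(1) by metis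
      then have "\<forall>v. j v = v" using \<open>j c = c\<close> by auto
      then have "V h = V k" using j(2)[of u] by (simp add: V_def)
      with hk show False by simp
    qed
    show "\<forall>W\<in>V ` G. \<exists>q. homeomorphism W (p ` V id) p q"
    proof clarify
      fix h assume h: "h \<in> G"
      show "\<exists>q. homeomorphism (V h) (p ` V id) p q"
      proof (rule homeomorphism_injective_open_map[of "V h" p "p ` V id"])
        show "continuous_on (V h) p" using p(1) by (rule continuous_on_subset) (auto simp: V_def)
        have "p ` h ` V id = p ` V id"
          unfolding image_image by (rule image_cong) (use p_G[OF h] in \<open>auto simp: V_def\<close>)
        then show img: "p ` V h = p ` V id" by (simp add: hV[OF h])
        show "inj_on p (V h)"
        proof (rule inj_onI)
          fix a b assume ab: "a \<in> V h" "b \<in> V h" "p a = p b"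
          obtain a' b' where *: "a' \<in> V id" "a = h a'" "b' \<in> V id" "b = h b'" using hV[OF h] ab by blast
          then have "p a' = p b'" using p_G[OF h] ab(3) by (metis IntE V_def)
          then show "a = b" using * inj_V by blast
        qed
        show "openin (top_of_set (p ` V id)) (p ` W)" if "openin (top_of_set (V h)) W" for W
        proof (rule openin_subset_trans)
          show "openin (top_of_set X) (p ` W)"
            using p_open openin_trans[OF that opV] by blast
          show "p ` W \<subseteq> p ` V id" using openin_imp_subset[OF that] img by blast
          show "p ` V id \<subseteq> X" using openin_imp_subset[OF opT] .
        qed
      qed blast
    qed
  qed
qed

section \<open>The model surface and its universal cover\<close>

definition model_cover :: "(complex \<times> complex) set" where
  "model_cover = - {(f, u). sin (2 * f) = 0 \<and> u = 0}"

definition model :: "(complex \<times> complex \<times> complex) set" where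
  "model = {(c, w, m). w\<^sup>2 = (1 - c\<^sup>2) * m \<and> \<not> (c\<^sup>2 = 1 \<and> m = 0)}"

definition model_map :: "complex \<times> complex \<Rightarrow> complex \<times> complex \<times> complex" where
  "model_map = (\<lambda>(f, u). (cos (2 * f), u * sin (2 * f), u\<^sup>2))"

text \<open>This is the infinite dihedral group, \<open>s\<close> marking the reflections. A
  reflection reverses \<open>sin (2 * f)\<close>, so \<open>u\<close> has to change sign too if
  \<open>u * sin (2 * f)\<close> is to stay the same.\<close>

definition deck :: "int \<Rightarrow> bool \<Rightarrow> complex \<times> complex \<Rightarrow> complex \<times> complex" where
  "deck k s = (\<lambda>(f, u). if s then (of_real (k * pi) - f, - u) else (of_real (k * pi) + f, u))"

lemma deck_deck: "deck k s (deck l t x) = deck (if s then k - l else k + l) (s \<noteq> t) x"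
  by (cases x) (auto simp: deck_def algebra_simps)

lemma deck_0 [simp]: "deck 0 False = id"
  by (auto simp: deck_def)

lemma dist_deck: "dist (deck k s x) (deck k s y) = dist x y"
proof (cases x; cases y)
  fix a b c d :: complex
  assume "x = (a, b)" "y = (c, d)"
  moreover have "dist (of_real (k * pi) - a) (of_real (k * pi) - c) = dist a c" "dist (- b) (- d) = dist b d"
    by (simp_all add: dist_norm norm_minus_commute)
  ultimately show ?thesis by (simp add: deck_def dist_Pair_Pair)
qed

lemma sin_add_int_pi: "sin (2 * (of_real (of_int k * pi) + z)) = sin (2 * z :: complex)"
  and cos_add_int_pi: "cos (2 * (of_real (of_int k * pi) + z)) = cos (2 * z :: complex)"
proof -
  have e: "2 * (of_real (of_int k * pi) + z) = 2 * z + of_real (2 * of_int k * pi)"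
    by (simp add: algebra_simps)
  show "sin (2 * (of_real (of_int k * pi) + z)) = sin (2 * z)"
    unfolding e complex_sin_eq by (rule bexI[of _ "of_int k"]) auto
  show "cos (2 * (of_real (of_int k * pi) + z)) = cos (2 * z)"
    unfolding e complex_cos_eq by (rule bexI[of _ "of_int k"]) auto
qed

lemma deck_in_model_cover: "x \<in> model_cover \<Longrightarrow> deck k s x \<in> model_cover"
  using sin_add_int_pi[of k "- fst x"] sin_add_int_pi[of k "fst x"]
  by (auto simp: model_cover_def deck_def split: prod.splits)

lemma model_map_deck: "model_map (deck k s x) = model_map x"
  using sin_add_int_pi[of k "- fst x"] sin_add_int_pi[of k "fst x"]
    cos_add_int_pi[of k "- fst x"] cos_add_int_pi[of k "fst x"]
  by (auto simp: model_map_def deck_def split: prod.splits)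

lemma sin_2_eq_0: "sin (2 * z :: complex) = 0 \<longleftrightarrow> (\<exists>j::int. 2 * z = of_real (j * pi))"
  by (rule sin_eq_0)

text \<open>Equal cosines leave \<open>g = n pi + f\<close> or \<open>g = n pi - f\<close>, and the
  other two equations then tie the sign of \<open>v\<close> to that of \<open>u\<close>. The
  exception is \<open>sin (2 * f) = 0\<close>; there \<open>2 f = j pi\<close> turns a translate of
  \<open>f\<close> into a reflected point and conversely, so the other sign is reached as
  well.\<close>

lemma model_map_eq_imp_deck:
  assumes "x \<in> model_cover" "y \<in> model_cover" "model_map x = model_map y"
  shows "\<exists>k s. y = deck k s x"
proof -
  obtain f u g v where xy: "x = (f, u)" "y = (g, v)" by fastforce
  have eqs: "cos (2 * g) = cos (2 * f)" "u * sin (2 * f) = v * sin (2 * g)" "u\<^sup>2 = v\<^sup>2"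
    using assms(3) by (auto simp: xy model_map_def)
  obtain r :: real where "r \<in> \<int>" and r: "2 * g = 2 * f + of_real (2 * r * pi) \<or> 2 * g = - (2 * f) + of_real (2 * r * pi)"
    using eqs(1) unfolding complex_cos_eq by blast
  obtain n :: int where n: "r = of_int n" using \<open>r \<in> \<int>\<close> by (rule Ints_cases)
  have "2 * g = 2 * (of_real (n * pi) + f) \<or> 2 * g = 2 * (of_real (n * pi) - f)"
    using r by (simp add: n algebra_simps)
  then consider "g = of_real (n * pi) + f" | "g = of_real (n * pi) - f"
    by (metis mult_cancel_left zero_neq_numeral)
  then show ?thesis
  proof cases
    case 1
    then have s: "sin (2 * g) = sin (2 * f)" using sin_add_int_pi by simp
    show ?thesis
    proof (cases "u = v")
      case True
      then show ?thesis using 1 by (intro exI[of _ n] exI[of _ False]) (simp add: xy deck_def)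
    next
      case False
      then have "sin (2 * f) = 0" and v: "v = - u" using eqs s by (auto simp: power2_eq_iff)
      then obtain j :: int where j: "2 * f = of_real (j * pi)" unfolding sin_2_eq_0 by blast
      have "g = of_real ((n + j) * pi) - f" using 1 j by (simp add: algebra_simps)
      then show ?thesis using v by (intro exI[of _ "n + j"] exI[of _ True]) (simp add: xy deck_def)
    qed
  next
    case 2
    then have s: "sin (2 * g) = - sin (2 * f)" using sin_add_int_pi[of n "- f"] by simp
    show ?thesis
    proof (cases "v = - u")
      case True
      then show ?thesis using 2 by (intro exI[of _ n] exI[of _ True]) (simp add: xy deck_def)
    next
      case False
      then have v: "v = u" using eqs(3) by (auto simp: power2_eq_iff)
      have "u \<noteq> 0" using False v by auto
      then have "sin (2 * f) = 0" using eqs(2) s v by auto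
      then obtain j :: int where j: "2 * f = of_real (j * pi)" unfolding sin_2_eq_0 by blast
      then have "of_int j * of_real pi = f + f" by simp
      then have "g = of_real ((n - j) * pi) + f" by (simp add: 2 left_diff_distrib)
      then show ?thesis using v by (intro exI[of _ "n - j"] exI[of _ False]) (simp add: xy deck_def)
    qed
  qed
qed

text \<open>A translation and a reflection that agree at \<open>x\<close> force \<open>u = 0\<close>
  and \<open>2 f\<close> to be a multiple of \<open>pi\<close>, and exactly these points are missing
  from \<open>model_cover\<close>.\<close>

lemma deck_free:
  assumes "x \<in> model_cover" "deck k s x = deck l t x"
  shows "k = l \<and> s = t"
proof -
  obtain f u where x: "x = (f, u)" by fastforce
  have no: "s = t"
  proof (rule ccontr)
    assume "s \<noteq> t"
    then have "u = 0" "2 * f = of_real ((if s then k - l else l - k) * pi)"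
      using assms(2) by (auto simp: x deck_def algebra_simps split: if_splits)
    then show False using assms(1) sin_2_eq_0[of f] by (auto simp: x model_cover_def)
  qed
  then have "of_real (k * pi) = (of_real (l * pi) :: complex)"
    using assms(2) by (auto simp: x deck_def split: if_splits)
  then show ?thesis using no by (simp flip: of_real_mult)
qed

text \<open>A nontrivial translation moves \<open>f\<close> by at least \<open>pi\<close>. A
  reflection moves \<open>u\<close> by \<open>2 * norm u\<close>; if \<open>u = 0\<close>, it moves
  \<open>f\<close> by the distance of \<open>2 f\<close> from a zero of the sine, which is bounded
  below because \<open>sin (2 * f)\<close> is nonzero.\<close>

lemma deck_properly_discontinuous:
  assumes "x \<in> model_cover"
  shows "\<exists>e>0. \<forall>k s. (k = 0 \<and> \<not> s) \<or> e \<le> dist (deck k s x) x"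
proof -
  obtain f u where x: "x = (f, u)" by fastforce
  have "\<exists>e>0. \<forall>k. e \<le> dist (deck k True x) x"
  proof (cases "u = 0")
    case False
    have "2 * norm u \<le> dist (deck k True x) x" for k
    proof -
      have "norm (- u - u) = 2 * norm u" by (simp flip: mult_2 add: norm_mult)
      then have "dist (- u) u = 2 * norm u" by (simp add: dist_norm)
      moreover have "dist (- u) u \<le> dist (deck k True x) x"
        using dist_snd_le[of "deck k True x" x] by (simp add: x deck_def)
      ultimately show ?thesis by simp
    qed
    then show ?thesis using False by (intro exI[of _ "2 * norm u"]) auto
  next
    case True
    have "open {z::complex. sin z \<noteq> 0}"
      by (intro open_Collect_neq continuous_intros)
    moreover have "sin (2 * f) \<noteq> 0" using assms True by (simp add: x model_cover_def)
    ultimately obtain e where e: "e > 0" "ball (2 * f) e \<subseteq> {z. sin z \<noteq> 0}"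
      by (metis (mono_tags, lifting) mem_Collect_eq openE)
    have "e \<le> dist (deck k True x) x" for k
    proof -
      have "sin (of_real (k * pi) :: complex) = 0" using sin_eq_0 by blast
      then have "e \<le> dist (2 * f) (of_real (k * pi))" using e(2) by (force simp: subset_iff)
      also have "\<dots> = dist (of_real (k * pi) - f) f"
        by (simp add: dist_norm norm_minus_commute algebra_simps)
      also have "\<dots> \<le> dist (deck k True x) x"
        using dist_fst_le[of "deck k True x" x] by (simp add: x deck_def)
      finally show ?thesis .
    qed
    then show ?thesis using e(1) by blast
  qed
  then obtain e where e: "e > 0" "\<And>k. e \<le> dist (deck k True x) x" by blast
  have "pi \<le> dist (deck k False x) x" if "k \<noteq> 0" for k
  proof -
    have "1 * pi \<le> \<bar>real_of_int k\<bar> * pi" using that by (intro mult_right_mono) auto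
    also have "\<dots> = dist (of_real (k * pi) + f) f" by (simp add: dist_norm norm_mult)
    also have "\<dots> \<le> dist (deck k False x) x"
      using dist_fst_le[of "deck k False x" x] by (simp add: x deck_def)
    finally show ?thesis by simp
  qed
  then show ?thesis
    using e by (intro exI[of _ "min e pi"]) (auto simp: min_le_iff_disj all_bool_eq)
qed

section \<open>Simple connectedness of the cover\<close>

lemma closed_complement_model_cover: "closed (- model_cover)"
proof -
  have "closed {p::complex \<times> complex. sin (2 * fst p) = 0 \<and> snd p = 0}"
    by (intro closed_Collect_conj closed_Collect_eq continuous_intros)
  then show ?thesis by (simp add: model_cover_def case_prod_beta')
qed

lemma countable_complement_model_cover: "countable (- model_cover)"
proof -
  have "- model_cover \<subseteq> range (\<lambda>j::int. (of_real (j * pi) / 2, 0))"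
  proof clarify
    fix f u assume "(f, u) \<notin> model_cover"
    then have "u = 0" "sin (2 * f) = 0" by (simp_all add: model_cover_def)
    then obtain j :: int where "2 * f = of_real (j * pi)" unfolding sin_2_eq_0 by blast
    then have "f = of_real (j * pi) / 2" by (simp add: eq_divide_eq mult.commute)
    then show "(f, u) \<in> range (\<lambda>j::int. (of_real (j * pi) / 2, 0))" using \<open>u = 0\<close> by blast
  qed
  then show ?thesis by (rule countable_subset) simp
qed

lemma simply_connected_model_cover: "simply_connected model_cover"
  using simply_connected_complement_countable[of "- model_cover"]
    closed_complement_model_cover countable_complement_model_cover by simp

lemma model_map_in_model: "x \<in> model_cover \<Longrightarrow> model_map x \<in> model"
proof (cases x)
  case (Pair f u)
  have "(sin (2 * f))\<^sup>2 = 1 - (cos (2 * f))\<^sup>2" by (rule sin_squared_eq)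
  then show "x \<in> model_cover \<Longrightarrow> model_map x \<in> model"
    by (auto simp: Pair model_cover_def model_def model_map_def power_mult_distrib)
qed

section \<open>Local inverses of \<open>model_map\<close> and the covering property\<close>

lemma model_map_of_exp:
  assumes E: "exp (2 * \<i> * f) = c + \<i> * s" and "s\<^sup>2 = 1 - c\<^sup>2" "u * s = w" "u\<^sup>2 = m"
  shows "model_map (f, u) = (c, w, m)"
proof -
  have "(c + \<i> * s) * (c - \<i> * s) = 1"
    using assms(2) by (simp add: algebra_simps power2_eq_square)
  then have E': "exp (- (2 * \<i> * f)) = c - \<i> * s"
    unfolding exp_minus E by (metis inverse_unique)
  have "cos (2 * f) = ((c + \<i> * s) + (c - \<i> * s)) / 2" "sin (2 * f) = ((c + \<i> * s) - (c - \<i> * s)) / (2 * \<i>)"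
    unfolding E[symmetric] E'[symmetric] cos_exp_eq sin_exp_eq by (simp_all add: mult_ac)
  then have "cos (2 * f) = c" "sin (2 * f) = s" by simp_all
  then show ?thesis using assms(3,4) by (simp add: model_map_def)
qed

text \<open>Dividing by \<open>z0\<close> turns the branch cut of the logarithm to the ray opposite
  to \<open>z0\<close>, so a neighbourhood of \<open>z0\<close> is free of it whatever the argument
  of \<open>z0\<close>.\<close>

lemma continuous_branches:
  fixes z0 :: complex
  assumes "z0 \<noteq> 0"
  obtains S where "open S" "z0 \<in> S" "0 \<notin> S" "continuous_on S (\<lambda>z. Ln (z / z0))"
    "\<And>z. z \<in> S \<Longrightarrow> exp (Ln (z / z0)) = z / z0"
proof
  show "open {z. z / z0 \<notin> \<real>\<^sub>\<le>\<^sub>0}"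
  proof -
    have "closed ((\<lambda>z. z / z0) -` \<real>\<^sub>\<le>\<^sub>0)"
      by (intro closed_vimage closed_nonpos_Reals_complex continuous_intros) (simp add: assms)
    then show ?thesis by (simp add: closed_def vimage_def Collect_neg_eq)
  qed
  show "continuous_on {z. z / z0 \<notin> \<real>\<^sub>\<le>\<^sub>0} (\<lambda>z. Ln (z / z0))"
    by (intro continuous_intros) (auto simp: assms)
  show "exp (Ln (z / z0)) = z / z0" if "z \<in> {z. z / z0 \<notin> \<real>\<^sub>\<le>\<^sub>0}" for z
    using that by (intro exp_Ln) auto
qed (use assms in auto)

lemma continuous_sqrt_branch:
  fixes r0 :: complex
  assumes "r0 \<noteq> 0"
  obtains S r where "open S" "r0\<^sup>2 \<in> S" "continuous_on S r" "r (r0\<^sup>2) = r0"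
    "\<And>z. z \<in> S \<Longrightarrow> (r z)\<^sup>2 = z" "\<And>z. z \<in> S \<Longrightarrow> r z \<noteq> 0"
proof -
  obtain S where S: "open S" "r0\<^sup>2 \<in> S" "0 \<notin> S" "continuous_on S (\<lambda>z. Ln (z / r0\<^sup>2))"
    "\<And>z. z \<in> S \<Longrightarrow> exp (Ln (z / r0\<^sup>2)) = z / r0\<^sup>2"
    using continuous_branches[of "r0\<^sup>2"] assms by auto
  have "(r0 * exp (Ln (z / r0\<^sup>2) / 2))\<^sup>2 = z" if "z \<in> S" for z
    using S(5)[OF that] assms by (simp add: power_mult_distrib flip: exp_double)
  then show ?thesis
    using S assms by (intro that[of S "\<lambda>z. r0 * exp (Ln (z / r0\<^sup>2) / 2)"]) (auto intro!: continuous_intros)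
qed

lemma continuous_angle_branch:
  fixes f0 :: complex
  obtains S l where "open S" "exp (2 * \<i> * f0) \<in> S" "continuous_on S l" "l (exp (2 * \<i> * f0)) = f0"
    "\<And>z. z \<in> S \<Longrightarrow> exp (2 * \<i> * l z) = z"
proof -
  let ?e = "exp (2 * \<i> * f0)"
  obtain S where S: "open S" "?e \<in> S" "0 \<notin> S" "continuous_on S (\<lambda>z. Ln (z / ?e))"
    "\<And>z. z \<in> S \<Longrightarrow> exp (Ln (z / ?e)) = z / ?e"
    using continuous_branches[of ?e] by auto
  have "exp (2 * \<i> * (Ln (z / ?e) / (2 * \<i>) + f0)) = z" if "z \<in> S" for z
  proof -
    have "2 * \<i> * (X / (2 * \<i>) + f0) = X + 2 * \<i> * f0" for X
      unfolding distrib_left by simp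
    then show ?thesis using S(5)[OF that] by (simp add: exp_add)
  qed
  then show ?thesis
    using S by (intro that[of S "\<lambda>z. Ln (z / ?e) / (2 * \<i>) + f0"]) (auto intro!: continuous_intros)
qed

lemma exp_cos_sin: "exp (2 * \<i> * f) = cos (2 * f) + \<i> * sin (2 * f :: complex)"
  using exp_Euler[of "2 * f"] by (simp add: mult_ac)

text \<open>On \<open>model_cover\<close> the sine of \<open>2 f\<close> and \<open>u\<close> do not
  both vanish. If \<open>u\<close> is nonzero, it is a branch of the square root of
  \<open>m\<close>, and the sine is \<open>w / u\<close>; otherwise the sine is a branch of the
  square root of \<open>1 - c^2\<close>, and \<open>u\<close> is \<open>w\<close> divided by it.
  Then \<open>f\<close> comes from a logarithm of \<open>c\<close> plus \<open>\<i>\<close> times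
  the sine. These sections are what makes \<open>model_map\<close> open.\<close>

lemma model_map_local_section:
  assumes "x \<in> model_cover"
  obtains V s where "openin (top_of_set model) V" "model_map x \<in> V" "continuous_on V s"
    "s ` V \<subseteq> model_cover" "\<And>y. y \<in> V \<Longrightarrow> model_map (s y) = y" "s (model_map x) = x"
proof -
  obtain f0 u0 where x: "x = (f0, u0)" by fastforce
  obtain L l where l: "open L" "exp (2 * \<i> * f0) \<in> L" "continuous_on L l" "l (exp (2 * \<i> * f0)) = f0"
    "\<And>z. z \<in> L \<Longrightarrow> exp (2 * \<i> * l z) = z"
    using continuous_angle_branch by metis
  have in_cover: "y \<in> model_cover" if "model_map y \<in> model" for y
    using that by (auto simp: model_map_def model_def model_cover_def cos_squared_eq split: prod.splits)
  show ?thesis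
  proof (cases "u0 = 0")
    case False
    obtain R r where r: "open R" "u0\<^sup>2 \<in> R" "continuous_on R r" "r (u0\<^sup>2) = u0"
      "\<And>z. z \<in> R \<Longrightarrow> (r z)\<^sup>2 = z" "\<And>z. z \<in> R \<Longrightarrow> r z \<noteq> 0"
      using continuous_sqrt_branch[OF False] by metis
    let ?E = "\<lambda>(c, w, m). c + \<i> * (w / r m)"
    have contE: "continuous_on {(c, w, m). m \<in> R} ?E"
      unfolding case_prod_beta'
      by (intro continuous_intros continuous_on_compose2[OF r(3)]) (auto simp: r(6))
    have "{(c::complex, w::complex, m). m \<in> R} = UNIV \<times> UNIV \<times> R" by auto
    then have opR: "open {(c::complex, w::complex, m). m \<in> R}"
      using r(1) by (simp add: open_Times)
    have opE: "open ({(c, w, m). m \<in> R} \<inter> ?E -` L)"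
      using continuous_open_preimage[OF contE opR l(1)] .
    let ?V = "model \<inter> ({(c, w, m). m \<in> R} \<inter> ?E -` L)" and ?s = "\<lambda>(c, w, m). (l (c + \<i> * (w / r m)), r m)"
    show ?thesis
    proof (rule that[of ?V ?s])
      show "openin (top_of_set model) ?V"
        using opE by (rule openin_open_Int)
      show "model_map x \<in> ?V"
        using model_map_in_model[OF assms] r l False
        by (simp add: x model_map_def exp_cos_sin)
      show "continuous_on ?V ?s"
        unfolding case_prod_beta'
        by (intro continuous_intros continuous_on_compose2[OF r(3)] continuous_on_compose2[OF l(3)])
          (auto simp: r(6))
      show sec: "model_map (?s y) = y"
        if "y \<in> ?V" for y
      proof -
        obtain c w m where y: "y = (c, w, m)" by (cases y)
        have *: "w\<^sup>2 = (1 - c\<^sup>2) * m" "m \<in> R" "c + \<i> * (w / r m) \<in> L" using that by (auto simp: y model_def)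
        have "m \<noteq> 0" using r(5)[OF *(2)] r(6)[OF *(2)] by auto
        then have "(w / r m)\<^sup>2 = 1 - c\<^sup>2"
          using * r(5)[OF *(2)] r(6)[OF *(2)] by (simp add: power_divide field_simps)
        then show ?thesis
          using * r(5)[OF *(2)] r(6)[OF *(2)] l(5)[OF *(3)] unfolding y prod.case
          by (intro model_map_of_exp) auto
      qed
      show "?s ` ?V \<subseteq> model_cover"
      proof (rule image_subsetI)
        fix y assume y: "y \<in> ?V"
        show "?s y \<in> model_cover"
          by (rule in_cover) (use sec[OF y] y in simp)
      qed
      show "?s (model_map x) = x"
        using r(4) l(4) False by (simp add: x model_map_def exp_cos_sin)
    qed
  next
    case True
    then have s0: "sin (2 * f0) \<noteq> 0" using assms by (simp add: x model_cover_def)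
    obtain R r where r: "open R" "(sin (2 * f0))\<^sup>2 \<in> R" "continuous_on R r" "r ((sin (2 * f0))\<^sup>2) = sin (2 * f0)"
      "\<And>z. z \<in> R \<Longrightarrow> (r z)\<^sup>2 = z" "\<And>z. z \<in> R \<Longrightarrow> r z \<noteq> 0"
      using continuous_sqrt_branch[OF s0] by metis
    have sc: "1 - (cos (2 * f0))\<^sup>2 = (sin (2 * f0))\<^sup>2" by (simp add: sin_squared_eq)
    let ?S = "{(c::complex, w::complex, m::complex). 1 - c\<^sup>2 \<in> R}"
    let ?E = "\<lambda>(c, w::complex, m::complex). c + \<i> * r (1 - c\<^sup>2)"
    have contE: "continuous_on ?S ?E"
      unfolding case_prod_beta'
      by (intro continuous_intros continuous_on_compose2[OF r(3)]) auto
    have "?S = (\<lambda>(c, w, m). 1 - c\<^sup>2) -` R" by auto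
    moreover have "open ((\<lambda>(c::complex, w::complex, m::complex). 1 - c\<^sup>2) -` R)"
      unfolding case_prod_beta' by (intro open_vimage r continuous_intros)
    ultimately have opR: "open ?S" by simp
    have opE: "open (?S \<inter> ?E -` L)"
      using continuous_open_preimage[OF contE opR l(1)] .
    let ?V = "model \<inter> (?S \<inter> ?E -` L)" and ?s = "\<lambda>(c, w, m). (l (c + \<i> * r (1 - c\<^sup>2)), w / r (1 - c\<^sup>2))"
    show ?thesis
    proof (rule that[of ?V ?s])
      show "openin (top_of_set model) ?V"
        using opE by (rule openin_open_Int)
      show "model_map x \<in> ?V"
        using model_map_in_model[OF assms] r l
        by (simp add: x model_map_def exp_cos_sin sc)
      show "continuous_on ?V ?s"
        unfolding case_prod_beta'
        by (intro continuous_intros continuous_on_compose2[OF r(3)] continuous_on_compose2[OF l(3)])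
          (auto simp: r(6))
      show sec: "model_map (?s y) = y"
        if "y \<in> ?V" for y
      proof -
        obtain c w m where y: "y = (c, w, m)" by (cases y)
        have *: "w\<^sup>2 = (1 - c\<^sup>2) * m" "1 - c\<^sup>2 \<in> R" "c + \<i> * r (1 - c\<^sup>2) \<in> L" using that by (auto simp: y model_def)
        have "1 - c\<^sup>2 \<noteq> 0" using r(5)[OF *(2)] r(6)[OF *(2)] by auto
        then have "(w / r (1 - c\<^sup>2))\<^sup>2 = m"
          unfolding power_divide r(5)[OF *(2)] *(1) by simp
        then show ?thesis
          using * r(5)[OF *(2)] r(6)[OF *(2)] l(5)[OF *(3)] unfolding y prod.case
          by (intro model_map_of_exp) auto
      qed
      show "?s ` ?V \<subseteq> model_cover"
      proof (rule image_subsetI)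
        fix y assume y: "y \<in> ?V"
        show "?s y \<in> model_cover"
          by (rule in_cover) (use sec[OF y] y in simp)
      qed
      show "?s (model_map x) = x"
        using r(4) l(4) True by (simp add: x model_map_def exp_cos_sin sc)
    qed
  qed
qed

abbreviation deck_group :: "(complex \<times> complex \<Rightarrow> complex \<times> complex) set" where
  "deck_group \<equiv> {h. \<exists>k s. h = deck k s}"

lemma openin_model_map_image:
  assumes W: "openin (top_of_set model_cover) W"
  shows "openin (top_of_set model) (model_map ` W)"
proof (subst openin_subopen, rule ballI)
  fix y assume "y \<in> model_map ` W"
  then obtain x where x: "x \<in> W" "y = model_map x" by blast
  have xc: "x \<in> model_cover" using x openin_imp_subset[OF W] by blast
  obtain V s where V: "openin (top_of_set model) V" "model_map x \<in> V" "continuous_on V s"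
    "s ` V \<subseteq> model_cover" "\<And>y. y \<in> V \<Longrightarrow> model_map (s y) = y" "s (model_map x) = x"
    using model_map_local_section[OF xc] by metis
  have "openin (top_of_set V) (V \<inter> s -` W)"
    using continuous_openin_preimage[OF V(3) _ W] V(4) by blast
  then have "openin (top_of_set model) (V \<inter> s -` W)"
    using openin_trans V(1) by blast
  moreover have "y \<in> V \<inter> s -` W" using V x by simp
  moreover have "V \<inter> s -` W \<subseteq> model_map ` W"
    using V(5) by force
  ultimately show "\<exists>T. openin (top_of_set model) T \<and> y \<in> T \<and> T \<subseteq> model_map ` W" by blast
qed

lemma model_map_surj: "model_map ` model_cover = model"
proof
  show "model_map ` model_cover \<subseteq> model" by (rule image_subsetI) (rule model_map_in_model)
  show "model \<subseteq> model_map ` model_cover"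
  proof
    fix y assume y: "y \<in> model"
    obtain c w m where ycwm: "y = (c, w, m)" by (cases y)
    obtain f where f: "cos (2 * f) = c"
      using that[of "Arccos c / 2"] by simp
    have "\<exists>u. u * sin (2 * f) = w \<and> u\<^sup>2 = m"
    proof (cases "sin (2 * f) = 0")
      case True
      then have "c\<^sup>2 = 1" using sin_squared_eq[of "2 * f"] f by simp
      then have "w = 0" using y by (simp add: ycwm model_def)
      then show ?thesis using True by (intro exI[of _ "csqrt m"]) simp
    next
      case False
      then have "1 - c\<^sup>2 = (sin (2 * f))\<^sup>2" using f sin_squared_eq[of "2 * f"] by simp
      then have "(w / sin (2 * f))\<^sup>2 = m" using y False by (simp add: ycwm model_def power_divide)
      then show ?thesis using False by (intro exI[of _ "w / sin (2 * f)"]) simp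
    qed
    then obtain u where u: "u * sin (2 * f) = w" "u\<^sup>2 = m" by blast
    have "model_map (f, u) = y" using u f by (simp add: model_map_def ycwm)
    moreover have "\<not> (sin (2 * f) = 0 \<and> u = 0)"
    proof
      assume "sin (2 * f) = 0 \<and> u = 0"
      then have "c\<^sup>2 = 1" "m = 0" using sin_squared_eq[of "2 * f"] f u(2) by simp_all
      then show False using y by (simp add: ycwm model_def)
    qed
    then have "(f, u) \<in> model_cover" by (simp add: model_cover_def)
    ultimately show "y \<in> model_map ` model_cover" by (metis imageI)
  qed
qed

lemma continuous_on_model_map: "continuous_on S model_map"
  unfolding model_map_def case_prod_beta' by (intro continuous_intros)

lemma continuous_on_deck: "continuous_on S (deck k s)"
  unfolding deck_def case_prod_beta' by (cases s) (auto intro!: continuous_intros)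

lemma model_map_eq_iff:
  assumes "x \<in> model_cover" "y \<in> model_cover"
  shows "model_map x = model_map y \<longleftrightarrow> (\<exists>k s. y = deck k s x)"
  using model_map_eq_imp_deck[OF assms] by (auto simp: model_map_deck)

lemma covering_space_model_map: "covering_space model_cover model_map model"
proof (rule covering_space_isometric_deck[where G = deck_group])
  fix h u assume h: "h \<in> deck_group"
  then obtain k s where ks: "h = deck k s" by blast
  show "h u \<in> model_cover" if "u \<in> model_cover"
    using deck_in_model_cover that by (simp add: ks)
  show "dist (h u) (h v) = dist u v" for v by (simp add: ks dist_deck)
  have inv: "deck k s (deck (if s then k else - k) s z) = z"
    "deck (if s then k else - k) s (deck k s z) = z" for z
    by (simp_all add: deck_deck)
  show "\<exists>v\<in>model_cover. h v = u" if "u \<in> model_cover"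
    using inv(1) deck_in_model_cover that ks by blast
next
  fix h k assume "h \<in> deck_group" "k \<in> deck_group"
  then obtain a s b t where *: "h = deck a s" "k = deck b t" by blast
  \<comment> \<open>This element is \<open>h\<close> times the inverse of \<open>k\<close> in the
    dihedral group.\<close>
  have "deck (if s = t then a - b else a + b) (s \<noteq> t) (k u) = h u" for u
    by (auto simp: * deck_deck)
  then show "\<exists>j\<in>deck_group. \<forall>u. j (k u) = h u"
    by (intro bexI[of _ "deck (if s = t then a - b else a + b) (s \<noteq> t)"]) blast+
next
  fix u v assume "u \<in> model_cover" "v \<in> model_cover"
  then show "model_map u = model_map v \<longleftrightarrow> (\<exists>h\<in>deck_group. v = h u)"
    unfolding model_map_eq_iff[OF \<open>u \<in> model_cover\<close> \<open>v \<in> model_cover\<close>] by blast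
next
  fix u assume "u \<in> model_cover"
  from deck_properly_discontinuous[OF this]
  obtain e where e: "e > 0" "\<forall>k s. (k = 0 \<and> \<not> s) \<or> e \<le> dist (deck k s u) u"
    by (elim exE conjE)
  show "\<exists>e>0. \<forall>h\<in>deck_group. (\<forall>v. h v = v) \<or> e \<le> dist (h u) u"
  proof (intro exI conjI ballI)
    show "e > 0" by (rule e)
    fix h assume "h \<in> deck_group"
    then obtain k s where h: "h = deck k s" by blast
    show "(\<forall>v. h v = v) \<or> e \<le> dist (h u) u"
      using e(2)[rule_format, of k s] unfolding h by (elim disjE conjE) simp_all
  qed
qed (rule continuous_on_model_map model_map_surj openin_model_map_image; assumption?)+

interpretation model: universal_cover model_cover model_map model deck_group
proof
  fix h u v assume *: "h \<in> deck_group"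
  then show "continuous_on model_cover h" using continuous_on_deck by blast
  show "h u \<in> model_cover" "model_map (h u) = model_map u" if "u \<in> model_cover"
    using * that deck_in_model_cover model_map_deck by blast+
next
  fix u v assume "u \<in> model_cover" "v \<in> model_cover" "model_map u = model_map v"
  then show "\<exists>h\<in>deck_group. v = h u"
    using model_map_eq_imp_deck by blast
qed (rule covering_space_model_map simply_connected_model_cover)+

section \<open>Deck orbits and the first homology of the model\<close>

lemma infinite_deck_orbit:
  assumes "x \<in> model_cover"
  shows "infinite (range (\<lambda>k. deck k False x))"
proof -
  have "inj (\<lambda>k. deck k False x)"
    using deck_free[OF assms] by (auto intro!: injI)
  then show ?thesis by (simp add: finite_image_iff infinite_UNIV_int)
qed

text \<open>A representative is chosen in every fibre, and the label names the deck map that carries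
  it to \<open>x\<close>. The inner choice depends on \<open>model_map x\<close> only, so all points
  of an orbit share one representative. No continuity is intended.\<close>

definition orbit_label :: "complex \<times> complex \<Rightarrow> int \<times> bool" where
  "orbit_label x = (SOME (k, s). x = deck k s (SOME y. y \<in> model_cover \<and> model_map y = model_map x))"

lemma orbit_label_deck:
  assumes x: "x \<in> model_cover" "orbit_label x = (l, t)"
  shows "orbit_label (deck k s x) = (if s then k - l else k + l, s \<noteq> t)"
proof -
  define r where "r = (SOME y. y \<in> model_cover \<and> model_map y = model_map x)"
  have r: "r \<in> model_cover" "model_map r = model_map x"
    using someI[of "\<lambda>y. y \<in> model_cover \<and> model_map y = model_map x" x] x unfolding r_def by auto
  have label: "\<exists>a b. orbit_label y = (a, b) \<and> y = deck a b r" if y: "y \<in> model_cover" "model_map y = model_map x" for y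
  proof -
    obtain a b where "y = deck a b r" using model_map_eq_imp_deck[OF r(1) y(1)] r(2) y(2) by auto
    then have "case (a, b) of (a, b) \<Rightarrow> y = deck a b r" by simp
    then have "case orbit_label y of (a, b) \<Rightarrow> y = deck a b r"
      unfolding orbit_label_def y(2) r_def[symmetric] by (rule someI)
    then show ?thesis by (cases "orbit_label y") auto
  qed
  have xl: "x = deck l t r" using label[OF x(1) refl] x(2) by auto
  obtain a b where ab: "orbit_label (deck k s x) = (a, b)" "deck k s x = deck a b r"
    using label[OF deck_in_model_cover[OF x(1)] model_map_deck] by blast
  have "deck (if s then k - l else k + l) (s \<noteq> t) r = deck a b r"
    using ab(2) unfolding xl by (simp add: deck_deck)
  from deck_free[OF r(1) this] ab(1) show ?thesis by simp
qed

text \<open>The parity of \<open>k\<close> and the bit \<open>s\<close> are two independent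
  homomorphisms from the infinite dihedral group to the group of order 2; the index
  \<open>k - l\<close> produced by reflections is as good as \<open>k + l\<close> modulo 2.\<close>

lemma orbit_label_parity:
  assumes "x \<in> model_cover"
  shows "odd (fst (orbit_label (deck k s x))) \<longleftrightarrow> (odd (fst (orbit_label x)) \<noteq> odd k)"
    "snd (orbit_label (deck k s x)) \<longleftrightarrow> (snd (orbit_label x) \<noteq> s)"
proof -
  obtain l t where l: "orbit_label x = (l, t)" by (cases "orbit_label x")
  show "odd (fst (orbit_label (deck k s x))) \<longleftrightarrow> (odd (fst (orbit_label x)) \<noteq> odd k)"
    "snd (orbit_label (deck k s x)) \<longleftrightarrow> (snd (orbit_label x) \<noteq> s)"
    unfolding orbit_label_deck[OF assms l] l by (cases s; auto)+
qed

text \<open>With \<open>a\<close> the class of the translation by \<open>pi\<close> and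
  \<open>b\<close> that of a reflection, \<open>joining_chain_comp\<close> makes the class of
  \<open>F k s\<close> equal to \<open>k a\<close>, plus \<open>b\<close> if \<open>s\<close> holds.
  The relations come from two involutions: \<open>deck 0 True\<close> has class \<open>b\<close> and
  \<open>deck 1 True\<close> has class \<open>a + b\<close>, so twice each of these is a
  boundary.\<close>

lemma homology_model:
  "finite (carrier (homology_group 1 (top_of_set model))) \<and> card (carrier (homology_group 1 (top_of_set model))) = 4"
proof -
  define u0 :: "complex \<times> complex" where "u0 = (0, 1)"
  have u0: "u0 \<in> model_cover" by (simp add: u0_def model_cover_def)
  define F where "F k s = model.joining_chain u0 (deck k s u0)" for k s
  define a where "a = F 1 False"
  define b where "b = F 0 True"
  note add = singular_relboundary_add[where p=1 and S="{}" and X="top_of_set model"]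
  note diff = singular_relboundary_diff[where p=1 and S="{}" and X="top_of_set model"]
  note cmul = singular_relboundary_cmul[where p=1 and S="{}" and X="top_of_set model"]
  have F_comp: "null_homologous model (F k s + F l t - F (if s then k - l else k + l) (s \<noteq> t))" for k s l t
    using model.joining_chain_comp[of "deck k s" "deck l t" u0, OF _ deck_in_model_cover[OF u0] u0]
    unfolding F_def deck_deck by blast
  have F_0: "null_homologous model (F 0 False)"
    using model.joining_chain_self[OF u0] by (simp add: F_def)
  have cyc: "singular_relcycle 1 (top_of_set model) {} (F k s)" for k s
    unfolding F_def by (rule model.cycle_joining_chain) (auto simp: u0 deck_in_model_cover model_map_deck)
  have F_False: "null_homologous model (F k False - frag_cmul k a)" for k
  proof (induction k rule: int_induct[where k = 0])
    case base
    then show ?case using F_0 by simp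
  next
    case (step1 k)
    have eq: "F (k + 1) False - frag_cmul (k + 1) a =
      (F k False - frag_cmul k a) - (F 1 False + F k False - F (1 + k) False)"
      by (simp add: a_def frag_cmul_distrib algebra_simps)
    show ?case unfolding eq
      using diff[OF step1(2) F_comp[of 1 False k False]] by (simp only: if_False simp_thms)
  next
    case (step2 k)
    have eq: "F (k - 1) False - frag_cmul (k - 1) a =
      (F k False - frag_cmul k a) + (F 1 False + F (k - 1) False - F (1 + (k - 1)) False)"
      by (simp add: a_def frag_cmul_diff_distrib algebra_simps)
    show ?case unfolding eq
      using add[OF step2(2) F_comp[of 1 False "k - 1" False]] by (simp only: if_False simp_thms)
  qed
  have F_True: "null_homologous model (F k True - (frag_cmul k a + b))" for k
  proof -
    have eq: "F k True - (frag_cmul k a + b) = (F k False - frag_cmul k a) - (F k False + F 0 True - F (k + 0) True)"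
      by (simp add: b_def algebra_simps)
    show ?thesis unfolding eq
      using diff[OF F_False F_comp[of k False 0 True]] by (simp only: if_False simp_thms)
  qed
  have bb: "null_homologous model (b + b)"
    using add[OF F_comp[of 0 True 0 True] F_0] by (simp add: b_def)
  have aa: "null_homologous model (a + a)"
  proof -
    have eq: "a + a = (F 1 True + F 1 True - F (1 - 1) False) + F 0 False - (F 1 True - (frag_cmul 1 a + b)) - (F 1 True - (frag_cmul 1 a + b)) - (b + b)"
      by (simp add: algebra_simps)
    show ?thesis unfolding eq
      using diff[OF diff[OF diff[OF add[OF F_comp[of 1 True 1 True] F_0] F_True] F_True] bb]
      by (simp only: if_True simp_thms)
  qed
  obtain k0 t0 where l0: "orbit_label u0 = (k0, t0)" by fastforce
  have parity: "\<exists>b. \<forall>u\<in>model_cover. (odd (fst (orbit_label (h u)))) \<longleftrightarrow> (odd (fst (orbit_label u)) \<noteq> b)"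
    "\<exists>b. \<forall>u\<in>model_cover. snd (orbit_label (h u)) \<longleftrightarrow> (snd (orbit_label u) \<noteq> b)"
    if hG: "h \<in> deck_group" for h
  proof -
    obtain k s where h: "h = deck k s" using hG by blast
    show "\<exists>b. \<forall>u\<in>model_cover. (odd (fst (orbit_label (h u)))) \<longleftrightarrow> (odd (fst (orbit_label u)) \<noteq> b)"
      unfolding h by (rule exI[of _ "odd k"], rule ballI, rule orbit_label_parity)
    show "\<exists>b. \<forall>u\<in>model_cover. snd (orbit_label (h u)) \<longleftrightarrow> (snd (orbit_label u) \<noteq> b)"
      unfolding h by (rule exI[of _ s], rule ballI, rule orbit_label_parity)
  qed
  have join: "path (model.joining_path u0 (deck k s u0))" "path_image (model.joining_path u0 (deck k s u0)) \<subseteq> model_cover"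
    "pathstart (model.joining_path u0 (deck k s u0)) = u0" "pathfinish (model.joining_path u0 (deck k s u0)) = deck k s u0" for k s
    using model.joining_path[OF u0 deck_in_model_cover[OF u0]] by auto
  obtain E where E: "\<And>c d. E (c + d) = E c + E d" "\<And>c. null_homologous model c \<Longrightarrow> even (E c)"
    "\<And>g. path g \<Longrightarrow> path_image g \<subseteq> model_cover \<Longrightarrow> E (path_chain (model_map \<circ> g)) =
      (of_bool (odd (fst (orbit_label (pathstart g))) \<noteq> odd (fst (orbit_label (pathfinish g)))) :: int)"
    using model.parity_cocycle[of "\<lambda>u. odd (fst (orbit_label u))", OF parity(1)] by metis
  \<comment> \<open>\<open>E\<close> counts translations modulo 2 and alone detects \<open>a\<close>
    and \<open>a + b\<close>. It does not see \<open>b\<close>, for which \<open>E'\<close> is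
    used.\<close>
  have Ea: "E a = 1" and Eb: "E b = 0"
    using orbit_label_deck[OF u0 l0] l0
    by (simp_all add: a_def b_def F_def model.joining_chain_def E(3) join)
  obtain E' where E': "\<And>c d. E' (c + d) = E' c + E' d" "\<And>c. null_homologous model c \<Longrightarrow> even (E' c)"
    "\<And>g. path g \<Longrightarrow> path_image g \<subseteq> model_cover \<Longrightarrow> E' (path_chain (model_map \<circ> g)) =
      (of_bool (snd (orbit_label (pathstart g)) \<noteq> snd (orbit_label (pathfinish g))) :: int)"
    using model.parity_cocycle[of "\<lambda>u. snd (orbit_label u)", OF parity(2)] by metis
  have E'b: "E' b = 1"
    using orbit_label_deck[OF u0 l0] l0
    by (simp add: b_def F_def model.joining_chain_def E'(3) join)
  show ?thesis
  proof (rule card_homology_group_4)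
    show "singular_relcycle 1 (top_of_set model) {} a" "singular_relcycle 1 (top_of_set model) {} b"
      unfolding a_def b_def by (rule cyc)+
    show "\<not> null_homologous model a" using E(2)[of a] Ea by auto
    show "\<not> null_homologous model b" using E'(2)[of b] E'b by auto
    show "\<not> null_homologous model (a + b)" using E(2)[of "a + b"] Ea Eb E(1) by auto
    fix c assume c: "singular_relcycle 1 (top_of_set model) {} c"
    show "\<exists>i j. null_homologous model (c - (frag_cmul i a + frag_cmul j b))"
    proof (rule model.cycles_generated_by_joining_chains[OF u0 _ _ _ c])
      fix c assume "null_homologous model c"
      then show "\<exists>i j. null_homologous model (c - (frag_cmul i a + frag_cmul j b))"
        by (intro exI[of _ 0]) simp
    next
      fix c d assume "\<exists>i j. null_homologous model (c - (frag_cmul i a + frag_cmul j b))"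
        "\<exists>i j. null_homologous model (d - (frag_cmul i a + frag_cmul j b))"
      then obtain i j k l where *: "null_homologous model (c - (frag_cmul i a + frag_cmul j b))"
        "null_homologous model (d - (frag_cmul k a + frag_cmul l b))" by blast
      have "c - d - (frag_cmul (i - k) a + frag_cmul (j - l) b) =
        (c - (frag_cmul i a + frag_cmul j b)) - (d - (frag_cmul k a + frag_cmul l b))"
        by (simp add: frag_cmul_diff_distrib algebra_simps)
      then show "\<exists>i j. null_homologous model (c - d - (frag_cmul i a + frag_cmul j b))"
        using diff[OF *] by metis
    next
      fix h assume "h \<in> deck_group"
      then obtain k s where h: "h = deck k s" by blast
      have "null_homologous model (F k s - (frag_cmul k a + frag_cmul (of_bool s) b))"
        using F_False[of k] F_True[of k] by (cases s) auto
      then show "\<exists>i j. null_homologous model (model.joining_chain u0 (h u0) - (frag_cmul i a + frag_cmul j b))"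
        unfolding h F_def by blast
    qed
  qed (rule aa bb)+
qed

section \<open>Homogeneous coordinates\<close>

lemma abs_cp2_eq_iff:
  assumes "v \<noteq> 0" "w \<noteq> 0"
  shows "abs_cp2 v = abs_cp2 w \<longleftrightarrow> (\<exists>c. w = c *s v)"
proof -
  have refl: "\<exists>c. v = c *s v" for v :: "complex ^ 3" by (rule exI[of _ 1]) simp
  show ?thesis
    using Quotient3_rel[OF Quotient3_cp2, of v w] assms refl by auto
qed

lemma rep_cp2: "rep_cp2 x \<noteq> 0" "abs_cp2 (rep_cp2 x) = x"
  using Quotient3_rep_reflp[OF Quotient3_cp2, of x] Quotient3_abs_rep[OF Quotient3_cp2, of x] by auto

definition dot :: "complex ^ 3 \<Rightarrow> complex ^ 3 \<Rightarrow> complex" where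
  "dot a x = (\<Sum>i\<in>UNIV. a $ i * x $ i)"

lemma dot_3: "dot a x = a $ 1 * x $ 1 + a $ 2 * x $ 2 + a $ 3 * x $ 3"
  by (simp add: dot_def sum_3)

lemma dot_smult [simp]: "dot a (c *s x) = c * dot a x" "dot (c *s a) x = c * dot a x"
  by (simp_all add: dot_3 algebra_simps)

lemma on_line_abs_cp2:
  assumes "a \<noteq> 0" "x \<noteq> 0"
  shows "on_line (abs_cp2 a) (abs_cp2 x) \<longleftrightarrow> dot a x = 0"
proof -
  have refl: "\<exists>c. v = c *s v" for v :: "complex ^ 3" by (rule exI[of _ 1]) simp
  show ?thesis unfolding dot_def using assms refl by (intro on_line.abs_eq) auto
qed

lemma continuous_on_dot [continuous_intros]:
  "continuous_on S f \<Longrightarrow> continuous_on S (\<lambda>x. dot a (f x))"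
  unfolding dot_def by (intro continuous_intros)

lemma continuous_on_abs_cp2:
  fixes f :: "'a::topological_space \<Rightarrow> complex ^ 3"
  assumes "continuous_on S f" "\<And>x. x \<in> S \<Longrightarrow> f x \<noteq> 0"
  shows "continuous_on S (\<lambda>x. abs_cp2 (f x))"
  unfolding continuous_on_open_invariant
proof (intro allI impI)
  fix B :: "cp2 set" assume "open B"
  then have "open {v. v \<noteq> 0 \<and> abs_cp2 v \<in> B}" by (simp add: open_cp2_def)
  with assms(1) obtain A where "open A" "A \<inter> S = f -` {v. v \<noteq> 0 \<and> abs_cp2 v \<in> B} \<inter> S"
    unfolding continuous_on_open_invariant by blast
  moreover have "f -` {v. v \<noteq> 0 \<and> abs_cp2 v \<in> B} \<inter> S = (\<lambda>x. abs_cp2 (f x)) -` B \<inter> S"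
    using assms(2) by auto
  ultimately show "\<exists>A. open A \<and> A \<inter> S = (\<lambda>x. abs_cp2 (f x)) -` B \<inter> S" by auto
qed

definition ratio :: "complex ^ 3 \<Rightarrow> complex ^ 3 \<Rightarrow> cp2 \<Rightarrow> complex" where
  "ratio a b x = dot a (rep_cp2 x) / dot b (rep_cp2 x)"

lemma dot_rep_cp2:
  assumes "v \<noteq> 0"
  obtains c where "c \<noteq> 0" "\<And>a. dot a (rep_cp2 (abs_cp2 v)) = c * dot a v"
proof -
  obtain c where c: "rep_cp2 (abs_cp2 v) = c *s v"
    using abs_cp2_eq_iff[of v "rep_cp2 (abs_cp2 v)"] rep_cp2 assms by metis
  then have "c \<noteq> 0" using rep_cp2(1)[of "abs_cp2 v"] by auto
  with c that show ?thesis by simp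
qed

lemma ratio_abs_cp2:
  assumes "v \<noteq> 0" shows "ratio a b (abs_cp2 v) = dot a v / dot b v"
  using dot_rep_cp2[OF assms] unfolding ratio_def by (metis mult_divide_mult_cancel_left)

text \<open>A set in the plane is open when its preimage among the nonzero vectors is. There the
  ratio is a quotient of linear forms, the same for all representatives, and a nonzero denominator
  already excludes the zero vector.\<close>

lemma continuous_on_ratio: "continuous_on {x. dot b (rep_cp2 x) \<noteq> 0} (ratio a b)"
proof -
  let ?W = "{x. dot b (rep_cp2 x) \<noteq> 0}"
  have nz: "dot b (rep_cp2 (abs_cp2 v)) \<noteq> 0 \<longleftrightarrow> dot b v \<noteq> 0" if "v \<noteq> 0" for v
    using dot_rep_cp2[OF that] by (metis mult_eq_0_iff)
  have "open (ratio a b -` C \<inter> ?W)" if "open C" for C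
  proof -
    have b: "open {v. dot b v \<noteq> 0}" by (intro open_Collect_neq continuous_intros)
    have "continuous_on {v. dot b v \<noteq> 0} (\<lambda>v. dot a v / dot b v)"
      by (intro continuous_intros) auto
    from continuous_open_preimage[OF this b that]
    have op: "open ({v. dot b v \<noteq> 0} \<inter> (\<lambda>v. dot a v / dot b v) -` C)" .
    have "v \<noteq> 0 \<and> abs_cp2 v \<in> ratio a b -` C \<inter> ?W \<longleftrightarrow>
        v \<in> {v. dot b v \<noteq> 0} \<inter> (\<lambda>v. dot a v / dot b v) -` C" for v
    proof (cases "v = 0")
      case True
      then show ?thesis by (simp add: dot_3)
    next
      case False
      then show ?thesis using nz[OF False] by (auto simp: ratio_abs_cp2)
    qed
    then have "{v. v \<noteq> 0 \<and> abs_cp2 v \<in> ratio a b -` C \<inter> ?W} = {v. dot b v \<noteq> 0} \<inter> (\<lambda>v. dot a v / dot b v) -` C"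
      by blast
    then show ?thesis unfolding open_cp2_def using op by (simp only:)
  qed
  then show ?thesis unfolding continuous_on_open_invariant by blast
qed

lemma closed_line: "closed (line a)"
proof -
  have "v \<noteq> 0 \<and> abs_cp2 v \<in> - line a \<longleftrightarrow> dot (rep_cp2 a) v \<noteq> 0" for v
    using on_line_abs_cp2[of "rep_cp2 a" v] rep_cp2[of a]
    by (cases "v = 0") (auto simp: line_def dot_3)
  then have "{v. v \<noteq> 0 \<and> abs_cp2 v \<in> - line a} = {v. dot (rep_cp2 a) v \<noteq> 0}" by auto
  moreover have "open {v. dot (rep_cp2 a) v \<noteq> 0}" by (intro open_Collect_neq continuous_intros)
  ultimately show ?thesis unfolding closed_def open_cp2_def by simp
qed

lemma proportional_iff_minors:
  fixes v w :: "complex ^ 3"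
  assumes "v \<noteq> 0"
  shows "(\<exists>c. w = c *s v) \<longleftrightarrow> v $ 1 * w $ 2 = v $ 2 * w $ 1 \<and> v $ 1 * w $ 3 = v $ 3 * w $ 1 \<and> v $ 2 * w $ 3 = v $ 3 * w $ 2"
    (is "?l = ?r")
proof
  assume ?r
  from assms have "v $ 1 \<noteq> 0 \<or> v $ 2 \<noteq> 0 \<or> v $ 3 \<noteq> 0" by (auto simp: vec_eq_iff forall_3)
  then consider "v $ 1 \<noteq> 0" | "v $ 2 \<noteq> 0" | "v $ 3 \<noteq> 0" by blast
  then show ?l
  proof cases
    case 1
    then show ?thesis using \<open>?r\<close> by (intro exI[of _ "w $ 1 / v $ 1"]) (auto simp: vec_eq_iff forall_3 field_simps)
  next
    case 2
    then show ?thesis using \<open>?r\<close> by (intro exI[of _ "w $ 2 / v $ 2"]) (auto simp: vec_eq_iff forall_3 field_simps)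
  next
    case 3
    then show ?thesis using \<open>?r\<close> by (intro exI[of _ "w $ 3 / v $ 3"]) (auto simp: vec_eq_iff forall_3 field_simps)
  qed
qed (auto simp: mult_ac)

text \<open>Two vectors parallel to the same nonzero \<open>m\<close> are parallel to each other.
  Treating a single minor lets the other two follow by permuting the indices.\<close>

lemma parallel_minor:
  fixes a1 :: "'a::field"
  assumes "a1 * m2 = a2 * m1" "a1 * m3 = a3 * m1" "a2 * m3 = a3 * m2" "b1 * m2 = b2 * m1"
    and "m1 \<noteq> 0 \<or> m2 \<noteq> 0 \<or> m3 \<noteq> 0"
  shows "a1 * b2 = a2 * b1"
proof -
  have "m1 * (a1 * b2) = a1 * (b2 * m1)" by (simp add: mult_ac)
  also have "\<dots> = (a1 * m2) * b1" unfolding assms(4)[symmetric] by (simp add: mult_ac)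
  also have "\<dots> = m1 * (a2 * b1)" unfolding assms(1) by (simp add: mult_ac)
  finally have 1: "m1 * (a1 * b2) = m1 * (a2 * b1)" .
  have "m2 * (a1 * b2) = (a1 * m2) * b2" by (simp add: mult_ac)
  also have "\<dots> = a2 * (b2 * m1)" unfolding assms(1) by (simp add: mult_ac)
  also have "\<dots> = m2 * (a2 * b1)" unfolding assms(4)[symmetric] by (simp add: mult_ac)
  finally have 2: "m2 * (a1 * b2) = m2 * (a2 * b1)" .
  have "m3 * (a1 * b2) = (a1 * m3) * b2" by (simp add: mult_ac)
  also have "\<dots> = a3 * (b2 * m1)" unfolding assms(2) by (simp add: mult_ac)
  also have "\<dots> = (a3 * m2) * b1" unfolding assms(4)[symmetric] by (simp add: mult_ac)
  also have "\<dots> = m3 * (a2 * b1)" unfolding assms(3)[symmetric] by (simp add: mult_ac)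
  finally have 3: "m3 * (a1 * b2) = m3 * (a2 * b1)" .
  from assms(5) show ?thesis
  proof (elim disjE)
    assume "m1 \<noteq> 0" then show ?thesis using 1 by simp
  next
    assume "m2 \<noteq> 0" then show ?thesis using 2 by simp
  next
    assume "m3 \<noteq> 0" then show ?thesis using 3 by simp
  qed
qed

text \<open>To differ from a fixed point means that one of three minors is nonzero, an open
  condition on vectors.\<close>

lemma closed_cp2_singleton: "closed {x :: cp2}"
proof -
  let ?r = "rep_cp2 x"
  have "v \<noteq> 0 \<and> abs_cp2 v \<in> - {x} \<longleftrightarrow>
      ?r $ 1 * v $ 2 \<noteq> ?r $ 2 * v $ 1 \<or> ?r $ 1 * v $ 3 \<noteq> ?r $ 3 * v $ 1 \<or> ?r $ 2 * v $ 3 \<noteq> ?r $ 3 * v $ 2" for v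
  proof (cases "v = 0")
    case False
    then show ?thesis
      using abs_cp2_eq_iff[of ?r v] rep_cp2[of x] proportional_iff_minors[of ?r v] by auto
  qed auto
  then have "{v. v \<noteq> 0 \<and> abs_cp2 v \<in> - {x}} = {v. ?r $ 1 * v $ 2 \<noteq> ?r $ 2 * v $ 1} \<union>
      {v. ?r $ 1 * v $ 3 \<noteq> ?r $ 3 * v $ 1} \<union> {v. ?r $ 2 * v $ 3 \<noteq> ?r $ 3 * v $ 2}" by blast
  moreover have "open {v. ?r $ i * v $ j \<noteq> ?r $ j * v $ i}" for i j
    by (intro open_Collect_neq continuous_intros)
  ultimately show ?thesis unfolding closed_def open_cp2_def by (simp only: open_Un)
qed

lemma closed_finite_cp2: "finite (F :: cp2 set) \<Longrightarrow> closed F"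
  using closed_Union[of "(\<lambda>x. {x}) ` F"] closed_cp2_singleton by auto

text \<open>Homogeneous coordinates in which the points \<open>pt v\<close> and the lines \<open>cov a\<close> are given by vectors and
  covectors of a basis, the columns of \<open>M\<close>.\<close>

locale projective_frame =
  fixes M N :: "complex ^ 3 ^ 3"
  assumes NM: "N ** M = mat 1" and MN: "M ** N = mat 1"
begin

definition pt :: "complex \<Rightarrow> complex \<Rightarrow> complex \<Rightarrow> cp2" where
  "pt a b c = abs_cp2 (M *v vector [a, b, c])"

text \<open>Covectors transform by the inverse matrix, so that the pairing with \<open>pt\<close> is
  the standard one in every frame (\<open>dot_frame\<close>).\<close>

definition cov :: "complex \<Rightarrow> complex \<Rightarrow> complex \<Rightarrow> cp2" where
  "cov a b c = abs_cp2 (vector [a, b, c] v* N)"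

lemma vector_eq_0: "(vector [a, b, c] :: complex ^ 3) = 0 \<longleftrightarrow> a = 0 \<and> b = 0 \<and> c = 0"
  by (auto simp: vec_eq_iff forall_3)

lemma vector_components: "(v :: complex ^ 3) = vector [v $ 1, v $ 2, v $ 3]"
  by (simp add: vec_eq_iff forall_3)

lemma M_eq_0: "M *v v = 0 \<longleftrightarrow> v = 0"
  by (metis NM matrix_vector_mul_assoc matrix_vector_mul_lid matrix_vector_mult_0_right)

lemma N_eq_0: "v v* N = 0 \<longleftrightarrow> v = 0"
  by (metis NM vector_matrix_mul_assoc vector_matrix_mul_rid vector_matrix_mult_0 MN)

lemma dot_frame: "dot (a v* N) (M *v v) = dot a v"
proof -
  have "dot (a v* N) w = dot a (N *v w)" for w
    by (simp add: dot_3 vector_matrix_mult_def matrix_vector_mult_def sum_3 algebra_simps)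
  then show ?thesis by (simp add: matrix_vector_mul_assoc NM)
qed

lemma pt_exhaust:
  obtains a b c where "x = pt a b c" "\<not> (a = 0 \<and> b = 0 \<and> c = 0)"
proof -
  define v where "v = N *v rep_cp2 x"
  have "M *v v = rep_cp2 x" by (simp add: v_def matrix_vector_mul_assoc MN)
  then have "x = pt (v $ 1) (v $ 2) (v $ 3)" "v \<noteq> 0"
    using rep_cp2[of x] M_eq_0[of v] by (auto simp: pt_def simp flip: vector_components)
  then show ?thesis using that vector_components[of v] vector_eq_0 by metis
qed

lemma cov_exhaust:
  obtains a b c where "x = cov a b c" "\<not> (a = 0 \<and> b = 0 \<and> c = 0)"
proof -
  define v where "v = rep_cp2 x v* M"
  have "v v* N = rep_cp2 x" by (simp add: v_def vector_matrix_mul_assoc MN)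
  then have "x = cov (v $ 1) (v $ 2) (v $ 3)" "v \<noteq> 0"
    using rep_cp2[of x] N_eq_0[of v] by (auto simp: cov_def simp flip: vector_components)
  then show ?thesis using that vector_components[of v] vector_eq_0 by metis
qed

lemma smult_M: "M *v w = c *s (M *v v) \<longleftrightarrow> w = c *s v"
proof -
  have "M *v w = c *s (M *v v) \<longleftrightarrow> M *v (w - c *s v) = 0"
    by (simp add: matrix_vector_mult_diff_distrib vector_scalar_commute)
  then show ?thesis by (simp add: M_eq_0)
qed

lemma smult_N: "w v* N = c *s (v v* N) \<longleftrightarrow> w = c *s v"
proof -
  have "(w - c *s v) v* N = w v* N - c *s (v v* N)"
    by (simp add: vec_eq_iff vector_matrix_mult_def sum_3 algebra_simps)
  then have "w v* N = c *s (v v* N) \<longleftrightarrow> (w - c *s v) v* N = 0" by simp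
  then show ?thesis by (simp add: N_eq_0)
qed

lemma pt_eq_iff:
  assumes "\<not> (a = 0 \<and> b = 0 \<and> c = 0)" "\<not> (a' = 0 \<and> b' = 0 \<and> c' = 0)"
  shows "pt a b c = pt a' b' c' \<longleftrightarrow> a * b' = b * a' \<and> a * c' = c * a' \<and> b * c' = c * b'"
  unfolding pt_def using assms
  by (subst abs_cp2_eq_iff) (simp_all add: M_eq_0 vector_eq_0 smult_M proportional_iff_minors)

lemma cov_eq_iff:
  assumes "\<not> (a = 0 \<and> b = 0 \<and> c = 0)" "\<not> (a' = 0 \<and> b' = 0 \<and> c' = 0)"
  shows "cov a b c = cov a' b' c' \<longleftrightarrow> a * b' = b * a' \<and> a * c' = c * a' \<and> b * c' = c * b'"
  unfolding cov_def using assms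
  by (subst abs_cp2_eq_iff) (simp_all add: N_eq_0 vector_eq_0 smult_N proportional_iff_minors)

lemma pt_in_line:
  assumes "\<not> (a = 0 \<and> b = 0 \<and> c = 0)" "\<not> (x = 0 \<and> y = 0 \<and> z = 0)"
  shows "pt x y z \<in> line (cov a b c) \<longleftrightarrow> a * x + b * y + c * z = 0"
  unfolding pt_def cov_def line_def using assms
  by (simp add: on_line_abs_cp2 M_eq_0 N_eq_0 vector_eq_0 dot_frame) (simp add: dot_3)

lemma continuous_on_vector3 [continuous_intros]:
  fixes f g h :: "'a::topological_space \<Rightarrow> complex"
  assumes "continuous_on S f" "continuous_on S g" "continuous_on S h"
  shows "continuous_on S (\<lambda>x. vector [f x, g x, h x] :: complex ^ 3)"
proof -
  have "(vector [f x, g x, h x] :: complex ^ 3) = (\<chi> i. if i = 1 then f x else if i = 2 then g x else h x)" for x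
    by (simp add: vec_eq_iff forall_3)
  moreover have "continuous_on S (\<lambda>x. if i = 1 then f x else if i = 2 then g x else h x)" for i :: 3
    using assms by (cases "i = 1"; cases "i = 2") simp_all
  ultimately show ?thesis by (simp add: continuous_on_vec_lambda)
qed

lemma continuous_on_pt:
  assumes "continuous_on S f" "continuous_on S g" "continuous_on S h"
    and "\<And>x. x \<in> S \<Longrightarrow> \<not> (f x = 0 \<and> g x = 0 \<and> h x = 0)"
  shows "continuous_on S (\<lambda>x. pt (f x) (g x) (h x))"
  unfolding pt_def
proof (rule continuous_on_abs_cp2)
  show "continuous_on S (\<lambda>x. M *v vector [f x, g x, h x])"
    unfolding matrix_vector_mult_def
    by (intro continuous_intros continuous_on_vec_lambda assms continuous_on_vector3)
qed (use assms(4) in \<open>simp add: M_eq_0 vector_eq_0\<close>)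

lemma continuous_on_cov:
  assumes "continuous_on S f" "continuous_on S g" "continuous_on S h"
    and "\<And>x. x \<in> S \<Longrightarrow> \<not> (f x = 0 \<and> g x = 0 \<and> h x = 0)"
  shows "continuous_on S (\<lambda>x. cov (f x) (g x) (h x))"
  unfolding cov_def
proof (rule continuous_on_abs_cp2)
  show "continuous_on S (\<lambda>x. vector [f x, g x, h x] v* N)"
    unfolding vector_matrix_mult_def
    by (intro continuous_intros continuous_on_vec_lambda assms continuous_on_vector3)
qed (use assms(4) in \<open>simp add: N_eq_0 vector_eq_0\<close>)

lemma dot_commute: "dot a b = dot b a"
  by (simp add: dot_3 mult.commute)

lemma dot_frame': "dot (M *v v) (a v* N) = dot v a"
  by (metis dot_commute dot_frame)

definition pt_ratio :: "complex ^ 3 \<Rightarrow> complex ^ 3 \<Rightarrow> cp2 \<Rightarrow> complex" where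
  "pt_ratio a b = ratio (a v* N) (b v* N)"

definition cov_ratio :: "complex ^ 3 \<Rightarrow> complex ^ 3 \<Rightarrow> cp2 \<Rightarrow> complex" where
  "cov_ratio v w = ratio (M *v v) (M *v w)"

lemma pt_ratio_pt:
  "\<not> (x = 0 \<and> y = 0 \<and> z = 0) \<Longrightarrow> pt_ratio a b (pt x y z) = dot a (vector [x, y, z]) / dot b (vector [x, y, z])"
  unfolding pt_ratio_def pt_def by (subst ratio_abs_cp2) (simp_all add: M_eq_0 vector_eq_0 dot_frame)

lemma cov_ratio_cov:
  "\<not> (x = 0 \<and> y = 0 \<and> z = 0) \<Longrightarrow> cov_ratio a b (cov x y z) = dot a (vector [x, y, z]) / dot b (vector [x, y, z])"
  unfolding cov_ratio_def cov_def
  by (subst ratio_abs_cp2) (simp_all add: N_eq_0 vector_eq_0 dot_frame')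

lemma continuous_on_pt_ratio:
  assumes "continuous_on S f"
    and "\<And>s. s \<in> S \<Longrightarrow> \<exists>x y z. f s = pt x y z \<and> \<not> (x = 0 \<and> y = 0 \<and> z = 0) \<and> dot b (vector [x, y, z]) \<noteq> 0"
  shows "continuous_on S (\<lambda>s. pt_ratio a b (f s))"
  unfolding pt_ratio_def
proof (rule continuous_on_compose2[OF continuous_on_ratio assms(1)], rule image_subsetI)
  fix s assume "s \<in> S"
  then obtain x y z where *: "f s = pt x y z" "\<not> (x = 0 \<and> y = 0 \<and> z = 0)" "dot b (vector [x, y, z]) \<noteq> 0"
    using assms(2) by blast
  have "M *v vector [x, y, z] \<noteq> 0" using *(2) by (simp add: M_eq_0 vector_eq_0)
  from dot_rep_cp2[OF this] obtain c where "c \<noteq> 0" "\<And>a. dot a (rep_cp2 (f s)) = c * dot a (M *v vector [x, y, z])"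
    unfolding *(1) pt_def by metis
  then show "f s \<in> {x. dot (b v* N) (rep_cp2 x) \<noteq> 0}" using *(3) by (simp add: dot_frame)
qed

lemma continuous_on_cov_ratio:
  assumes "continuous_on S f"
    and "\<And>s. s \<in> S \<Longrightarrow> \<exists>x y z. f s = cov x y z \<and> \<not> (x = 0 \<and> y = 0 \<and> z = 0) \<and> dot b (vector [x, y, z]) \<noteq> 0"
  shows "continuous_on S (\<lambda>s. cov_ratio a b (f s))"
  unfolding cov_ratio_def
proof (rule continuous_on_compose2[OF continuous_on_ratio assms(1)], rule image_subsetI)
  fix s assume "s \<in> S"
  then obtain x y z where *: "f s = cov x y z" "\<not> (x = 0 \<and> y = 0 \<and> z = 0)" "dot b (vector [x, y, z]) \<noteq> 0"
    using assms(2) by blast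
  have "vector [x, y, z] v* N \<noteq> 0" using *(2) by (simp add: N_eq_0 vector_eq_0)
  from dot_rep_cp2[OF this] obtain c where "c \<noteq> 0" "\<And>a. dot a (rep_cp2 (f s)) = c * dot a (vector [x, y, z] v* N)"
    unfolding *(1) cov_def by metis
  then show "f s \<in> {x. dot (M *v b) (rep_cp2 x) \<noteq> 0}"
    using *(3) by (simp add: dot_frame')
qed

text \<open>The cross product \<open>m\<close> of vectors for \<open>p\<close> and \<open>q\<close>
  is nonzero, and every covector that vanishes on both vectors is parallel to
  \<open>m\<close>.\<close>

lemma line_unique:
  assumes "p \<noteq> q" "p \<in> line a" "q \<in> line a" "p \<in> line b" "q \<in> line b"
  shows "a = b"
proof -
  obtain p1 p2 p3 where p: "p = pt p1 p2 p3" "\<not> (p1 = 0 \<and> p2 = 0 \<and> p3 = 0)" by (rule pt_exhaust)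
  obtain q1 q2 q3 where q: "q = pt q1 q2 q3" "\<not> (q1 = 0 \<and> q2 = 0 \<and> q3 = 0)" by (rule pt_exhaust)
  obtain a1 a2 a3 where a: "a = cov a1 a2 a3" "\<not> (a1 = 0 \<and> a2 = 0 \<and> a3 = 0)" by (rule cov_exhaust)
  obtain b1 b2 b3 where b: "b = cov b1 b2 b3" "\<not> (b1 = 0 \<and> b2 = 0 \<and> b3 = 0)" by (rule cov_exhaust)
  have e: "a1 * p1 + a2 * p2 + a3 * p3 = 0" "a1 * q1 + a2 * q2 + a3 * q3 = 0"
    "b1 * p1 + b2 * p2 + b3 * p3 = 0" "b1 * q1 + b2 * q2 + b3 * q3 = 0"
    using assms(2-) unfolding p(1) q(1) a(1) b(1)
    by (simp_all add: pt_in_line[OF a(2) p(2)] pt_in_line[OF a(2) q(2)] pt_in_line[OF b(2) p(2)] pt_in_line[OF b(2) q(2)])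
  define m1 where "m1 = p2 * q3 - p3 * q2"
  define m2 where "m2 = p3 * q1 - p1 * q3"
  define m3 where "m3 = p1 * q2 - p2 * q1"
  have m: "m1 \<noteq> 0 \<or> m2 \<noteq> 0 \<or> m3 \<noteq> 0"
    using assms(1) unfolding p(1) q(1) pt_eq_iff[OF p(2) q(2)] m1_def m2_def m3_def by auto
  have "a1 * m2 - a2 * m1 = p3 * (a1 * q1 + a2 * q2 + a3 * q3) - q3 * (a1 * p1 + a2 * p2 + a3 * p3)"
    "a1 * m3 - a3 * m1 = q2 * (a1 * p1 + a2 * p2 + a3 * p3) - p2 * (a1 * q1 + a2 * q2 + a3 * q3)"
    "a2 * m3 - a3 * m2 = p1 * (a1 * q1 + a2 * q2 + a3 * q3) - q1 * (a1 * p1 + a2 * p2 + a3 * p3)"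
    "b1 * m2 - b2 * m1 = p3 * (b1 * q1 + b2 * q2 + b3 * q3) - q3 * (b1 * p1 + b2 * p2 + b3 * p3)"
    "b1 * m3 - b3 * m1 = q2 * (b1 * p1 + b2 * p2 + b3 * p3) - p2 * (b1 * q1 + b2 * q2 + b3 * q3)"
    "b2 * m3 - b3 * m2 = p1 * (b1 * q1 + b2 * q2 + b3 * q3) - q1 * (b1 * p1 + b2 * p2 + b3 * p3)"
    by (simp_all add: m1_def m2_def m3_def algebra_simps)
  then have am: "a1 * m2 = a2 * m1" "a1 * m3 = a3 * m1" "a2 * m3 = a3 * m2"
    "b1 * m2 = b2 * m1" "b1 * m3 = b3 * m1" "b2 * m3 = b3 * m2"
    by (simp_all add: e)
  have "a1 * b2 = a2 * b1"
    by (rule parallel_minor[of a1 m2 a2 m1 m3 a3]) (use am m in auto)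
  moreover have "a1 * b3 = a3 * b1"
    by (rule parallel_minor[of a1 m3 a3 m1 m2 a2]) (use am m in auto)
  moreover have "a2 * b3 = a3 * b2"
    by (rule parallel_minor[of a2 m3 a3 m2 m1 a1]) (use am m in auto)
  ultimately show ?thesis
    unfolding a(1) b(1) cov_eq_iff[OF a(2) b(2)] by simp
qed

end

section \<open>Strict transforms of lines\<close>

lemma continuous_on_snd_coordinate: "continuous_on S (\<lambda>p :: 'a::topological_space \<times> ('b \<Rightarrow> 'c::topological_space). snd p i)"
  by (rule continuous_on_product_then_coordinatewise) (intro continuous_intros)

context projective_frame
begin

text \<open>At every \<open>s\<close> other than \<open>y\<close> the line \<open>l s\<close> is
  forced to be the one joining \<open>s\<close> and \<open>y\<close>; only the line at
  \<open>y\<close> itself is free.\<close>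

lemma blowup_eqI:
  assumes "(y, l) \<in> blowup S" "(y, l') \<in> blowup S" "y \<in> S \<Longrightarrow> l y = l' y"
  shows "l = l'"
proof (rule extensionalityI[of _ S])
  show "l \<in> extensional S" "l' \<in> extensional S" using assms by (auto simp: blowup_def)
  fix s assume s: "s \<in> S"
  show "l s = l' s"
  proof (cases "s = y")
    case False
    then show ?thesis using assms(1,2) s by (intro line_unique[of s y]) (auto simp: blowup_def)
  qed (use assms(3) s in auto)
qed

text \<open>For the reverse inclusion, a point over \<open>y \<in> S\<close> is approached along the line: the line through
  \<open>s \<in> S\<close> and a moving point of the line depends continuously on that point, because it is the line
  itself when \<open>s\<close> lies on it, and otherwise \<open>s\<close> stays away from the moving point.\<close>

lemma strict_transform_line:
  assumes S: "finite S"
  shows "strict_transform S (line a) = {(y, l) \<in> blowup S. y \<in> line a \<and> (y \<in> S \<longrightarrow> l y = a)}"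
proof -
  let ?A = "{y \<in> blowup S. fst y \<in> line a - S}"
  have closure: "strict_transform S (line a) = blowup S \<inter> closure ?A"
    unfolding strict_transform_def closure_of_subtopology by (simp add: Int_absorb1 Collect_mono_iff)
  have "blowup S \<inter> closure ?A \<subseteq> {(y, l) \<in> blowup S. y \<in> line a \<and> (y \<in> S \<longrightarrow> l y = a)}"
  proof -
    \<comment> \<open>Over a point of the line outside \<open>S\<close>, the family has the value
      \<open>a\<close> at every point of \<open>S\<close> on that line. This is a closed condition
      and survives in the closure.\<close>
    let ?T = "{p. fst p \<in> line a} \<inter> (\<Inter>s\<in>S \<inter> line a. {p :: cp2 \<times> (cp2 \<Rightarrow> cp2). snd p s \<in> {a}})"
    have "closed {p :: cp2 \<times> (cp2 \<Rightarrow> cp2). fst p \<in> line a}"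
      using closed_vimage[OF closed_line, of fst a] by (simp add: vimage_def continuous_on_fst continuous_on_id)
    moreover have "closed {p :: cp2 \<times> (cp2 \<Rightarrow> cp2). snd p s \<in> {a}}" for s
      using closed_vimage[OF closed_cp2_singleton continuous_on_snd_coordinate, of s a] by (simp add: vimage_def)
    ultimately have "closed ?T" by (intro closed_Int closed_INT) auto
    moreover have "?A \<subseteq> ?T"
    proof (rule subsetI)
      fix p assume p: "p \<in> ?A"
      have "snd p s = a" if "s \<in> S" "s \<in> line a" for s
        using p that by (intro line_unique[of s "fst p"]) (auto simp: blowup_def case_prod_beta')
      then show "p \<in> ?T" using p by auto
    qed
    ultimately have T: "closure ?A \<subseteq> ?T" by (rule closure_minimal[rotated])
    show ?thesis
    proof (rule subsetI)
      fix p assume "p \<in> blowup S \<inter> closure ?A"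
      then have "p \<in> blowup S" "p \<in> ?T" using T by blast+
      then show "p \<in> {(y, l) \<in> blowup S. y \<in> line a \<and> (y \<in> S \<longrightarrow> l y = a)}" by (cases p) auto
    qed
  qed
  moreover have "(y, l) \<in> closure ?A" if yl: "(y, l) \<in> blowup S" "y \<in> line a" "y \<in> S \<longrightarrow> l y = a" for y l
  proof (cases "y \<in> S")
    case False
    then have "(y, l) \<in> ?A" using yl by simp
    then show ?thesis by (rule closure_subset[THEN subsetD])
  next
    case True
    obtain a1 a2 a3 where a: "a = cov a1 a2 a3" "\<not> (a1 = 0 \<and> a2 = 0 \<and> a3 = 0)" by (rule cov_exhaust)
    obtain v1 v2 v3 where v: "y = pt v1 v2 v3" "\<not> (v1 = 0 \<and> v2 = 0 \<and> v3 = 0)" by (rule pt_exhaust)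
    have av: "a1 * v1 + a2 * v2 + a3 * v3 = 0" using yl(2) by (simp add: a(1) v(1) pt_in_line[OF a(2) v(2)])
    \<comment> \<open>\<open>w\<close> is a second point of the line, independent of
      \<open>v\<close>. Vectors annihilated by \<open>a\<close>, such as
      \<open>(- a3, 0, a1)\<close>, provide it; the cases ensure that some minor with
      \<open>v\<close> is a product of two nonzero numbers.\<close>
    obtain w1 w2 w3 where aw: "a1 * w1 + a2 * w2 + a3 * w3 = 0"
      and vw: "v1 * w2 \<noteq> v2 * w1 \<or> v1 * w3 \<noteq> v3 * w1 \<or> v2 * w3 \<noteq> v3 * w2"
    proof -
      consider "a1 \<noteq> 0" | "a2 \<noteq> 0" | "a3 \<noteq> 0" using a(2) by blast
      then show ?thesis
      proof cases
        case 1
        then have "v2 \<noteq> 0 \<or> v3 \<noteq> 0" using v(2) av by auto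
        then show ?thesis
        proof
          assume "v2 \<noteq> 0" then show ?thesis using 1 by (intro that[of "- a3" 0 a1]) (auto simp: algebra_simps)
        next
          assume "v3 \<noteq> 0" then show ?thesis using 1 by (intro that[of "- a2" a1 0]) (auto simp: algebra_simps)
        qed
      next
        case 2
        then have "v1 \<noteq> 0 \<or> v3 \<noteq> 0" using v(2) av by auto
        then show ?thesis
        proof
          assume "v1 \<noteq> 0" then show ?thesis using 2 by (intro that[of 0 "- a3" a2]) (auto simp: algebra_simps)
        next
          assume "v3 \<noteq> 0" then show ?thesis using 2 by (intro that[of a2 "- a1" 0]) (auto simp: algebra_simps)
        qed
      next
        case 3
        then have "v1 \<noteq> 0 \<or> v2 \<noteq> 0" using v(2) av by auto
        then show ?thesis
        proof
          assume "v1 \<noteq> 0" then show ?thesis using 3 by (intro that[of 0 a3 "- a2"]) (auto simp: algebra_simps)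
        next
          assume "v2 \<noteq> 0" then show ?thesis using 3 by (intro that[of a3 0 "- a1"]) (auto simp: algebra_simps)
        qed
      qed
    qed
    define x1 where "x1 e = v1 + e * w1" for e
    define x2 where "x2 e = v2 + e * w2" for e
    define x3 where "x3 e = v3 + e * w3" for e
    have minors: "x1 e * x2 e' - x2 e * x1 e' = (e' - e) * (v1 * w2 - v2 * w1)"
      "x1 e * x3 e' - x3 e * x1 e' = (e' - e) * (v1 * w3 - v3 * w1)"
      "x2 e * x3 e' - x3 e * x2 e' = (e' - e) * (v2 * w3 - v3 * w2)" for e e'
      by (simp_all add: x1_def x2_def x3_def algebra_simps)
    have nz: "\<not> (x1 e = 0 \<and> x2 e = 0 \<and> x3 e = 0)" for e
    proof
      assume "x1 e = 0 \<and> x2 e = 0 \<and> x3 e = 0"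
      with minors[of e "e + 1"] vw show False by simp
    qed
    have inj: "e = e'" if "pt (x1 e) (x2 e) (x3 e) = pt (x1 e') (x2 e') (x3 e')" for e e'
    proof (rule ccontr)
      assume "e \<noteq> e'"
      with that minors[of e e'] vw show False by (simp add: pt_eq_iff[OF nz nz])
    qed
    have x_line: "pt (x1 e) (x2 e) (x3 e) \<in> line a" for e
    proof -
      have "a1 * x1 e + a2 * x2 e + a3 * x3 e = (a1 * v1 + a2 * v2 + a3 * v3) + e * (a1 * w1 + a2 * w2 + a3 * w3)"
        by (simp add: x1_def x2_def x3_def algebra_simps)
      then show ?thesis by (simp add: a(1) pt_in_line[OF a(2) nz] av aw)
    qed
    have "\<exists>s1 s2 s3. s = pt s1 s2 s3 \<and> \<not> (s1 = 0 \<and> s2 = 0 \<and> s3 = 0)" for s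
      by (rule pt_exhaust[of s]) blast
    then obtain s1 s2 s3 where s: "\<And>s. s = pt (s1 s) (s2 s) (s3 s)" "\<And>s. \<not> (s1 s = 0 \<and> s2 s = 0 \<and> s3 s = 0)"
      by metis
    \<comment> \<open>The covector is the cross product of \<open>s\<close> with the moving point,
      that is, the line joining them.\<close>
    define k where "k e s = cov (s2 s * x3 e - s3 s * x2 e) (s3 s * x1 e - s1 s * x3 e) (s1 s * x2 e - s2 s * x1 e)" for e s
    have k_nz: "\<not> (s2 s * x3 e - s3 s * x2 e = 0 \<and> s3 s * x1 e - s1 s * x3 e = 0 \<and> s1 s * x2 e - s2 s * x1 e = 0)"
      if "s \<notin> line a" for e s
    proof
      assume "s2 s * x3 e - s3 s * x2 e = 0 \<and> s3 s * x1 e - s1 s * x3 e = 0 \<and> s1 s * x2 e - s2 s * x1 e = 0"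
      then have "pt (s1 s) (s2 s) (s3 s) = pt (x1 e) (x2 e) (x3 e)"
        unfolding pt_eq_iff[OF s(2) nz] by auto
      with x_line[of e] that s(1)[of s] show False by simp
    qed
    have k_line: "s \<in> line (k e s)" "pt (x1 e) (x2 e) (x3 e) \<in> line (k e s)" if "s \<notin> line a" for e s
    proof -
      have "pt (s1 s) (s2 s) (s3 s) \<in> line (k e s)"
        unfolding k_def pt_in_line[OF k_nz[OF that] s(2)] by (simp add: algebra_simps)
      then show "s \<in> line (k e s)" using s(1)[of s] by simp
      show "pt (x1 e) (x2 e) (x3 e) \<in> line (k e s)"
        unfolding k_def pt_in_line[OF k_nz[OF that] nz] by (simp add: algebra_simps)
    qed
    define c where "c e = (pt (x1 e) (x2 e) (x3 e), restrict (\<lambda>s. if s \<in> line a then a else k e s) S)" for e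
    have c_blowup: "c e \<in> blowup S" for e
      using x_line k_line by (auto simp: c_def blowup_def)
    have "continuous_on UNIV x1" "continuous_on UNIV x2" "continuous_on UNIV x3"
      unfolding x1_def x2_def x3_def by (intro continuous_intros)+
    note cx = this
    have cont: "continuous_on UNIV c"
      unfolding c_def
    proof (intro continuous_on_Pair continuous_on_coordinatewise_then_product)
      show "continuous_on UNIV (\<lambda>e. pt (x1 e) (x2 e) (x3 e))"
        using nz by (intro continuous_on_pt cx) auto
      fix s
      have "continuous_on UNIV (\<lambda>e. k e s)" if "s \<notin> line a"
        unfolding k_def using k_nz[OF that] by (intro continuous_on_cov continuous_intros cx) auto
      then show "continuous_on UNIV (\<lambda>e. restrict (\<lambda>s. if s \<in> line a then a else k e s) S s)"
        by (cases "s \<in> S"; cases "s \<in> line a") simp_all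
    qed
    have c0: "c 0 = (y, l)"
    proof -
      have "fst (c 0) = y" by (simp add: c_def x1_def x2_def x3_def v(1))
      moreover have "snd (c 0) y = l y" if "y \<in> S" using yl that by (simp add: c_def)
      ultimately show ?thesis
        using blowup_eqI[of y "snd (c 0)" S l] c_blowup[of 0] yl(1) by (cases "c 0") auto
    qed
    \<comment> \<open>Only finitely many parameters lead into \<open>S\<close>. The others are
      dense, so continuity of \<open>c\<close> puts \<open>c 0\<close> into the closure.\<close>
    define F where "F = {e. pt (x1 e) (x2 e) (x3 e) \<in> S}"
    have "finite F"
      unfolding F_def using finite_vimageI[OF S, of "\<lambda>e. pt (x1 e) (x2 e) (x3 e)"] inj by (auto simp: inj_def vimage_def)
    then have "interior F = {}"
      using finite_imp_not_open[of "interior F"] finite_subset[OF interior_subset] by blast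
    then have "closure (- F) = UNIV" by (simp add: closure_complement)
    moreover have "c ` (- F) \<subseteq> closure ?A"
    proof (rule image_subsetI, rule closure_subset[THEN subsetD])
      fix e assume "e \<in> - F"
      then have "fst (c e) \<in> line a - S" using x_line by (simp add: c_def F_def)
      then show "c e \<in> ?A" using c_blowup by blast
    qed
    ultimately have "c ` UNIV \<subseteq> closure ?A"
      using image_closure_subset[of "- F" c "closure ?A"] cont by (metis closed_closure)
    then have "c 0 \<in> closure ?A" by blast
    then show ?thesis using c0 by simp
  qed
  ultimately show ?thesis unfolding closure by blast
qed

section \<open>The partial compactification\<close>

definition quad_points :: "cp2 set" where
  "quad_points = {pt 1 0 0, pt 0 1 0, pt 0 0 1, pt 1 1 1, pt 1 1 0, pt 0 1 1, pt 1 0 1}"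

definition quad_covectors :: "cp2 set" where
  "quad_covectors = {cov 1 0 0, cov 0 1 0, cov 0 0 1, cov 1 (-1) 0, cov 1 0 (-1), cov 0 1 (-1)}"

text \<open>\<open>pt 1 1 1\<close> is the triple point \<open>t\<close>, and
  \<open>pt 1 1 0\<close> is the double point \<open>d\<close>, the node of the conic
  \<open>x3 (x1 - x2) = 0\<close>.\<close>

definition filled_quad :: "(cp2 \<times> (cp2 \<Rightarrow> cp2)) set" where
  "filled_quad = blowup quad_points -
    \<Union>(strict_transform quad_points ` line ` quad_covectors \<union>
      exceptional_divisor quad_points ` {pt 1 1 1, pt 1 1 0})"

lemma finite_quad_points: "finite quad_points"
  by (simp add: quad_points_def)

lemma filled_quad_iff:
  "(y, l) \<in> filled_quad \<longleftrightarrow> (y, l) \<in> blowup quad_points \<and> y \<noteq> pt 1 1 1 \<and> y \<noteq> pt 1 1 0 \<and>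
    (\<forall>a\<in>quad_covectors. y \<in> line a \<longrightarrow> y \<in> quad_points \<and> l y \<noteq> a)"
  unfolding filled_quad_def exceptional_divisor_def
  by (auto simp: strict_transform_line[OF finite_quad_points])

section \<open>The monomial parametrization of the surface\<close>

definition family :: "cp2 \<Rightarrow> cp2 \<Rightarrow> cp2 \<Rightarrow> cp2 \<Rightarrow> cp2 \<Rightarrow> cp2 \<Rightarrow> cp2 \<Rightarrow> cp2 \<Rightarrow> cp2" where
  "family a b c d e f g = restrict (\<lambda>s.
    if s = pt 1 0 0 then a else if s = pt 0 1 0 then b else if s = pt 0 0 1 then c else
    if s = pt 1 1 1 then d else if s = pt 1 1 0 then e else if s = pt 0 1 1 then f else g) quad_points"

lemma family_simps [simp]:
  "family a b c d e f g (pt 1 0 0) = a" "family a b c d e f g (pt 0 1 0) = b" "family a b c d e f g (pt 0 0 1) = c"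
  "family a b c d e f g (pt 1 1 1) = d" "family a b c d e f g (pt 1 1 0) = e" "family a b c d e f g (pt 0 1 1) = f"
  "family a b c d e f g (pt 1 0 1) = g"
  by (simp_all add: family_def quad_points_def pt_eq_iff)

lemma family_extensional: "family a b c d e f g \<in> extensional quad_points"
  by (simp add: family_def)

lemma pt_minus: "pt (- a) (- b) (- c) = pt a b c"
proof (cases "a = 0 \<and> b = 0 \<and> c = 0")
  case False
  then show ?thesis by (subst pt_eq_iff) auto
qed auto

lemma cov_minus: "cov (- a) (- b) (- c) = cov a b c"
proof (cases "a = 0 \<and> b = 0 \<and> c = 0")
  case False
  then show ?thesis by (subst cov_eq_iff) auto
qed auto

text \<open>Here \<open>al\<close>, \<open>be\<close> stand for the sine and the cosine of the first coordinate of \<open>model_cover\<close>, and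
  \<open>u\<close> for the second one.  With the abbreviations \<open>A = al + u be\<close> and \<open>B = al u - be\<close> the six linear forms
  of the arrangement are, at the point \<open>(al u A, be u B, A B)\<close>, up to sign the monomials
  \<open>al u A\<close>, \<open>be u B\<close>, \<open>A B\<close>, \<open>u\<close>, \<open>be A\<close> and \<open>al B\<close>.\<close>

definition admissible :: "complex \<Rightarrow> complex \<Rightarrow> complex \<Rightarrow> complex \<Rightarrow> complex \<Rightarrow> bool" where
  "admissible al be u A B \<longleftrightarrow> A = al + u * be \<and> B = al * u - be \<and> al\<^sup>2 + be\<^sup>2 = 1 \<and>
    \<not> (al = 0 \<and> u = 0) \<and> \<not> (be = 0 \<and> u = 0)"

text \<open>Each covector is, up to sign, the cross product of a blown-up point with the moving
  point after a common factor has been cancelled: in the order of \<open>family\<close>, the factors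
  are \<open>B\<close>, \<open>A\<close>, \<open>u\<close>, none, none, \<open>al\<close>,
  \<open>be\<close>. What is left never vanishes (\<open>adm_nonzero\<close>), so the formulas
  extend over the exceptional curves.\<close>

definition quad_param :: "complex \<Rightarrow> complex \<Rightarrow> complex \<Rightarrow> complex \<Rightarrow> complex \<Rightarrow> cp2 \<times> (cp2 \<Rightarrow> cp2)" where
  "quad_param al be u A B = (pt (al * u * A) (be * u * B) (A * B),
    family (cov 0 A (- (be * u))) (cov B 0 (- (al * u))) (cov (be * B) (- (al * A)) 0)
      (cov (- (al * B)) (- (be * A)) u) (cov (A * B) (- (A * B)) (- u))
      (cov B (u * A) (- (u * A))) (cov (u * B) (- A) (- (u * B))))"

context
  fixes al be u A B assumes adm: "admissible al be u A B"
begin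

lemma adm_A: "A = al + u * be" and adm_B: "B = al * u - be" and adm_sq: "al * al + be * be = 1"
  using adm by (simp_all add: admissible_def power2_eq_square)

lemma adm_diff: "al * A - be * B = 1" "be * A + al * B = u"
proof -
  have "al * A - be * B = al * al + be * be" "be * A + al * B = u * (al * al + be * be)"
    by (simp_all add: adm_A adm_B algebra_simps)
  then show "al * A - be * B = 1" "be * A + al * B = u" by (simp_all add: adm_sq)
qed

lemma adm_form_diff: "al * u * A - be * u * B = u" "al * u * A - A * B = be * A" "be * u * B - A * B = - (al * B)"
proof -
  have "al * u * A - be * u * B = u * (al * A - be * B)" by (simp add: algebra_simps)
  then show "al * u * A - be * u * B = u" by (simp add: adm_diff)
  have "al * u * A - A * B = A * (al * u - B)" by (simp add: algebra_simps)
  then show "al * u * A - A * B = be * A" by (simp add: adm_B)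
  have "be * u * B - A * B = - (B * (A - u * be))" by (simp add: algebra_simps)
  then show "be * u * B - A * B = - (al * B)" by (simp add: adm_A)
qed

text \<open>The zero sets of \<open>al\<close>, \<open>be\<close>, \<open>u\<close>,
  \<open>A\<close>, \<open>B\<close> are the surviving exceptional curves over
  \<open>pt 0 1 1\<close>, \<open>pt 1 0 1\<close>, \<open>pt 0 0 1\<close>,
  \<open>pt 0 1 0\<close>, \<open>pt 1 0 0\<close>, which are disjoint. Algebraically,
  \<open>al = u = 0\<close> and \<open>be = u = 0\<close> lie over the singular points of the model
  and are excluded by \<open>admissible\<close>; the other pairs follow from the relations.\<close>

lemma adm_one_zero:
  "\<not> (al = 0 \<and> be = 0)" "\<not> (al = 0 \<and> u = 0)" "\<not> (be = 0 \<and> u = 0)" "\<not> (A = 0 \<and> B = 0)"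
  "\<not> (al = 0 \<and> A = 0)" "\<not> (al = 0 \<and> B = 0)" "\<not> (be = 0 \<and> A = 0)" "\<not> (be = 0 \<and> B = 0)"
  "\<not> (u = 0 \<and> A = 0)" "\<not> (u = 0 \<and> B = 0)"
proof -
  show a: "\<not> (al = 0 \<and> be = 0)" using adm_sq by auto
  show b: "\<not> (al = 0 \<and> u = 0)" "\<not> (be = 0 \<and> u = 0)" using adm by (simp_all add: admissible_def)
  show "\<not> (A = 0 \<and> B = 0)" using adm_diff(1) by auto
  show "\<not> (al = 0 \<and> A = 0)" "\<not> (al = 0 \<and> B = 0)" "\<not> (be = 0 \<and> A = 0)" "\<not> (be = 0 \<and> B = 0)"
    "\<not> (u = 0 \<and> A = 0)" "\<not> (u = 0 \<and> B = 0)"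
    using a b unfolding adm_A adm_B by auto
qed

lemma adm_nonzero:
  "\<not> (al * u * A = 0 \<and> be * u * B = 0 \<and> A * B = 0)"
  "\<not> (0 = (0::complex) \<and> A = 0 \<and> - (be * u) = 0)" "\<not> (B = 0 \<and> 0 = (0::complex) \<and> - (al * u) = 0)"
  "\<not> (be * B = 0 \<and> - (al * A) = 0 \<and> 0 = (0::complex))" "\<not> (- (al * B) = 0 \<and> - (be * A) = 0 \<and> u = 0)"
  "\<not> (A * B = 0 \<and> - (A * B) = 0 \<and> - u = 0)" "\<not> (B = 0 \<and> u * A = 0 \<and> - (u * A) = 0)"
  "\<not> (u * B = 0 \<and> - A = 0 \<and> - (u * B) = 0)"
  using adm_one_zero by auto

lemma quad_param_fst_cases:
  "al = 0 \<Longrightarrow> fst (quad_param al be u A B) = pt 0 1 1" "be = 0 \<Longrightarrow> fst (quad_param al be u A B) = pt 1 0 1"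
  "u = 0 \<Longrightarrow> fst (quad_param al be u A B) = pt 0 0 1" "A = 0 \<Longrightarrow> fst (quad_param al be u A B) = pt 0 1 0"
  "B = 0 \<Longrightarrow> fst (quad_param al be u A B) = pt 1 0 0"
  using adm_one_zero adm_form_diff adm_nonzero(1)
  by (auto simp: quad_param_def pt_eq_iff)

lemma quad_param_in_blowup: "quad_param al be u A B \<in> blowup quad_points"
proof -
  note nz = adm_nonzero(1)
  have "- (al * B) + - (be * A) + u = 0" by (simp add: adm_diff(2)[symmetric])
  then have "pt 1 1 1 \<in> line (cov (- (al * B)) (- (be * A)) u)"
    using pt_in_line[OF adm_nonzero(5), of 1 1 1] by simp
  moreover
  have "pt 1 0 0 \<in> line (cov 0 A (- (be * u)))" "pt 0 1 0 \<in> line (cov B 0 (- (al * u)))"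
    "pt 0 0 1 \<in> line (cov (be * B) (- (al * A)) 0)"
    "pt 1 1 0 \<in> line (cov (A * B) (- (A * B)) (- u))" "pt 0 1 1 \<in> line (cov B (u * A) (- (u * A)))"
    "pt 1 0 1 \<in> line (cov (u * B) (- A) (- (u * B)))"
    using pt_in_line[OF adm_nonzero(2), of 1 0 0] pt_in_line[OF adm_nonzero(3), of 0 1 0]
      pt_in_line[OF adm_nonzero(4), of 0 0 1] pt_in_line[OF adm_nonzero(6), of 1 1 0]
      pt_in_line[OF adm_nonzero(7), of 0 1 1] pt_in_line[OF adm_nonzero(8), of 1 0 1] by simp_all
  moreover have "pt (al * u * A) (be * u * B) (A * B) \<in> line (cov 0 A (- (be * u)))"
    unfolding pt_in_line[OF adm_nonzero(2) nz] by (simp add: algebra_simps)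
  moreover have "pt (al * u * A) (be * u * B) (A * B) \<in> line (cov B 0 (- (al * u)))"
    unfolding pt_in_line[OF adm_nonzero(3) nz] by (simp add: algebra_simps)
  moreover have "pt (al * u * A) (be * u * B) (A * B) \<in> line (cov (be * B) (- (al * A)) 0)"
    unfolding pt_in_line[OF adm_nonzero(4) nz] by (simp add: algebra_simps)
  moreover have "pt (al * u * A) (be * u * B) (A * B) \<in> line (cov (- (al * B)) (- (be * A)) u)"
  proof -
    have "- (al * B) * (al * u * A) + - (be * A) * (be * u * B) + u * (A * B) = u * A * B * (1 - (al * al + be * be))"
      by (simp add: algebra_simps)
    then show ?thesis unfolding pt_in_line[OF adm_nonzero(5) nz] by (simp add: adm_sq)
  qed
  moreover have "pt (al * u * A) (be * u * B) (A * B) \<in> line (cov (A * B) (- (A * B)) (- u))"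
  proof -
    have "A * B * (al * u * A) + - (A * B) * (be * u * B) + - u * (A * B) = u * A * B * (al * A - be * B - 1)"
      by (simp add: algebra_simps)
    then show ?thesis unfolding pt_in_line[OF adm_nonzero(6) nz] by (simp add: adm_diff)
  qed
  moreover have "pt (al * u * A) (be * u * B) (A * B) \<in> line (cov B (u * A) (- (u * A)))"
  proof -
    have "B * (al * u * A) + u * A * (be * u * B) + - (u * A) * (A * B) = u * A * B * (al + u * be - A)"
      by (simp add: algebra_simps)
    then show ?thesis unfolding pt_in_line[OF adm_nonzero(7) nz] by (simp add: adm_A)
  qed
  moreover have "pt (al * u * A) (be * u * B) (A * B) \<in> line (cov (u * B) (- A) (- (u * B)))"
  proof -
    have "u * B * (al * u * A) + - A * (be * u * B) + - (u * B) * (A * B) = u * A * B * (al * u - be - B)"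
      by (simp add: algebra_simps)
    then show ?thesis unfolding pt_in_line[OF adm_nonzero(8) nz] by (simp add: adm_B)
  qed
  ultimately show ?thesis
    by (simp add: quad_param_def blowup_def family_extensional) (simp add: quad_points_def)
qed

lemma quad_param_in_filled_quad: "quad_param al be u A B \<in> filled_quad"
proof -
  let ?y = "pt (al * u * A) (be * u * B) (A * B)"
  define l where "l = snd (quad_param al be u A B)"
  have q: "quad_param al be u A B = (?y, l)" by (simp add: l_def quad_param_def)
  have l: "l (pt 1 0 0) = cov 0 A (- (be * u))" "l (pt 0 1 0) = cov B 0 (- (al * u))"
    "l (pt 0 0 1) = cov (be * B) (- (al * A)) 0" "l (pt 0 1 1) = cov B (u * A) (- (u * A))"
    "l (pt 1 0 1) = cov (u * B) (- A) (- (u * B))"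
    by (simp_all add: l_def quad_param_def)
  note y = quad_param_fst_cases[unfolded q fst_conv]
  have ne: "?y \<noteq> pt 1 1 1" "?y \<noteq> pt 1 1 0"
  proof -
    show "?y \<noteq> pt 1 1 1"
    proof
      assume "?y = pt 1 1 1"
      then have eqs: "al * u * A = be * u * B" "al * u * A = A * B" "be * u * B = A * B"
        by (simp_all add: pt_eq_iff[OF adm_nonzero(1)])
      have "u = 0" using adm_form_diff(1) unfolding eqs(1) diff_self by (rule sym)
      moreover have "be * A = 0" using adm_form_diff(2) unfolding eqs(2) diff_self by (rule sym)
      moreover have "- (al * B) = 0" using adm_form_diff(3) unfolding eqs(3) diff_self by (rule sym)
      ultimately show False using adm_one_zero unfolding neg_equal_0_iff_equal mult_eq_0_iff by blast
    qed
    show "?y \<noteq> pt 1 1 0"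
    proof
      assume "?y = pt 1 1 0"
      then have eqs: "al * u * A = be * u * B" "A = 0 \<or> B = 0"
        using pt_eq_iff[OF adm_nonzero(1), of 1 1 0] adm_one_zero(9,10) by auto
      have "u = 0" using adm_form_diff(1) unfolding eqs(1) diff_self by (rule sym)
      then show False using eqs(2) adm_one_zero by blast
    qed
  qed
  have nz: "\<not> (1 = (0::complex) \<and> b = (0::complex) \<and> c = (0::complex))"
    "\<not> (b = (0::complex) \<and> 1 = (0::complex) \<and> c = (0::complex))" "\<not> (b = (0::complex) \<and> c = (0::complex) \<and> 1 = (0::complex))" for b c
    by simp_all
  have forms: "?y \<in> line (cov 1 0 0) \<longleftrightarrow> al * u * A = 0" "?y \<in> line (cov 0 1 0) \<longleftrightarrow> be * u * B = 0"
    "?y \<in> line (cov 0 0 1) \<longleftrightarrow> A * B = 0" "?y \<in> line (cov 1 (-1) 0) \<longleftrightarrow> u = 0"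
    "?y \<in> line (cov 1 0 (-1)) \<longleftrightarrow> be * A = 0" "?y \<in> line (cov 0 1 (-1)) \<longleftrightarrow> al * B = 0"
    using pt_in_line[OF nz(1) adm_nonzero(1)] pt_in_line[OF nz(2) adm_nonzero(1)] pt_in_line[OF nz(3) adm_nonzero(1)]
    by (simp_all del: mult_eq_0_iff add: adm_form_diff)
  have S: "pt 0 1 1 \<in> quad_points" "pt 1 0 1 \<in> quad_points" "pt 0 0 1 \<in> quad_points" "pt 0 1 0 \<in> quad_points" "pt 1 0 0 \<in> quad_points"
    by (simp_all add: quad_points_def)
  have "?y \<in> quad_points \<and> l ?y \<noteq> a" if "a \<in> quad_covectors" "?y \<in> line a" for a
  proof -
    have "a = cov 1 0 0 \<and> al * u * A = 0 \<or> a = cov 0 1 0 \<and> be * u * B = 0 \<or> a = cov 0 0 1 \<and> A * B = 0 \<or>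
      a = cov 1 (-1) 0 \<and> u = 0 \<or> a = cov 1 0 (-1) \<and> be * A = 0 \<or> a = cov 0 1 (-1) \<and> al * B = 0"
      using that unfolding quad_covectors_def insert_iff empty_iff by (elim disjE) (simp_all only: forms simp_thms)
    \<comment> \<open>All six linear forms are monomials in the five factors. The list sorts the
      lines by the vanishing factor, hence by the multiple point through which they pass.\<close>
    then have "al = 0 \<and> (a = cov 1 0 0 \<or> a = cov 0 1 (-1)) \<or> be = 0 \<and> (a = cov 0 1 0 \<or> a = cov 1 0 (-1)) \<or>
      u = 0 \<and> (a = cov 1 0 0 \<or> a = cov 0 1 0 \<or> a = cov 1 (-1) 0) \<or>
      A = 0 \<and> (a = cov 1 0 0 \<or> a = cov 0 0 1 \<or> a = cov 1 0 (-1)) \<or>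
      B = 0 \<and> (a = cov 0 1 0 \<or> a = cov 0 0 1 \<or> a = cov 0 1 (-1))"
      unfolding mult_eq_0_iff by blast
    then consider "al = 0" "a = cov 1 0 0 \<or> a = cov 0 1 (-1)" | "be = 0" "a = cov 0 1 0 \<or> a = cov 1 0 (-1)"
      | "u = 0" "a = cov 1 0 0 \<or> a = cov 0 1 0 \<or> a = cov 1 (-1) 0"
      | "A = 0" "a = cov 1 0 0 \<or> a = cov 0 0 1 \<or> a = cov 1 0 (-1)"
      | "B = 0" "a = cov 0 1 0 \<or> a = cov 0 0 1 \<or> a = cov 0 1 (-1)" by blast
    then show ?thesis
    proof cases
      case 1
      then have "A \<noteq> 0" "B \<noteq> 0" "u \<noteq> 0" using adm_one_zero by auto
      then show ?thesis unfolding y(1)[OF 1(1)] l using 1(2) S by (auto simp: cov_eq_iff)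
    next
      case 2
      then have "A \<noteq> 0" "B \<noteq> 0" "u \<noteq> 0" using adm_one_zero by auto
      then show ?thesis unfolding y(2)[OF 2(1)] l using 2(2) S by (auto simp: cov_eq_iff)
    next
      case 3
      then have "A \<noteq> 0" "B \<noteq> 0" "al \<noteq> 0" "be \<noteq> 0" "al * A \<noteq> be * B" using adm_one_zero adm_diff(1) by auto
      then show ?thesis unfolding y(3)[OF 3(1)] l using 3(2) S by (auto simp: cov_eq_iff)
    next
      case 4
      then have "B \<noteq> 0" "al \<noteq> 0" "u \<noteq> 0" "be \<noteq> 0" using adm_one_zero by auto
      moreover have "B \<noteq> al * u" using \<open>be \<noteq> 0\<close> adm_B by auto
      ultimately show ?thesis unfolding y(4)[OF 4(1)] l using 4(2) S by (auto simp: cov_eq_iff)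
    next
      case 5
      then have "A \<noteq> 0" "be \<noteq> 0" "u \<noteq> 0" "al \<noteq> 0" using adm_one_zero by auto
      moreover have "A \<noteq> be * u" using \<open>al \<noteq> 0\<close> adm_A by auto
      ultimately show ?thesis unfolding y(5)[OF 5(1)] l using 5(2) S by (auto simp: cov_eq_iff)
    qed
  qed
  then show ?thesis
    unfolding q filled_quad_iff using quad_param_in_blowup ne by (simp add: q)
qed

end

text \<open>With \<open>al = sin f\<close> and \<open>be = cos f\<close> these sign changes are the
  effects of \<open>deck 1 False\<close> and \<open>deck 0 True\<close>, which generate the deck
  group.\<close>

lemma quad_param_minus:
  "quad_param (- al) (- be) u (- A) (- B) = quad_param al be u A B"
  "quad_param (- al) be (- u) (- A) B = quad_param al be u A B"
  using cov_minus[of 0 A "- (be * u)"] cov_minus[of "B" 0 "- (al * u)"] cov_minus[of "- (al * B)" "- (be * A)" u]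
    cov_minus[of "A * B" "- (A * B)" "- u"] cov_minus[of "B" "u * A" "- (u * A)"] cov_minus[of "u * B" "- A" "- (u * B)"]
    pt_minus[of "al * u * A" "be * u * B" "A * B"] cov_minus[of "be * B" "- (al * A)" 0]
  by (simp_all add: quad_param_def)

section \<open>Surjectivity of the parametrization\<close>

lemma filled_quad_eqI:
  assumes "(y, l) \<in> filled_quad" "admissible al be u A B" "fst (quad_param al be u A B) = y"
    and "y \<in> quad_points \<Longrightarrow> l y = snd (quad_param al be u A B) y"
  shows "(y, l) = quad_param al be u A B"
proof -
  have "(y, snd (quad_param al be u A B)) \<in> blowup quad_points"
    using quad_param_in_blowup[OF assms(2)] assms(3) by (metis prod.collapse)
  then have "l = snd (quad_param al be u A B)"
    using assms(1,4) unfolding filled_quad_iff by (intro blowup_eqI[of y l quad_points]) auto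
  then show ?thesis using assms(3) by (metis prod.collapse)
qed

lemma quad_param_surj_generic:
  assumes yl: "(y, l) \<in> filled_quad" and y: "y \<notin> quad_points"
  obtains al be u A B where "admissible al be u A B" "(y, l) = quad_param al be u A B"
proof -
  obtain x1 x2 x3 where x: "y = pt x1 x2 x3" "\<not> (x1 = 0 \<and> x2 = 0 \<and> x3 = 0)" by (rule pt_exhaust)
  have "y \<notin> line a" if "a \<in> quad_covectors" for a
    using yl y that unfolding filled_quad_iff by blast
  then have "y \<notin> line (cov 1 0 0)" "y \<notin> line (cov 0 1 0)" "y \<notin> line (cov 0 0 1)"
    "y \<notin> line (cov 1 (-1) 0)" "y \<notin> line (cov 1 0 (-1))" "y \<notin> line (cov 0 1 (-1))"
    by (simp_all add: quad_covectors_def)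
  then have nz: "x1 \<noteq> 0" "x2 \<noteq> 0" "x3 \<noteq> 0" "x1 - x2 \<noteq> 0" "x1 - x3 \<noteq> 0" "x2 - x3 \<noteq> 0"
    unfolding x(1) by (simp_all add: pt_in_line[OF _ x(2)])
  define D where "D = (x1 - x2) * x3"
  have D: "D \<noteq> 0" using nz by (simp add: D_def)
  define al where "al = csqrt (- (x2 - x3) * x1 / D)"
  define be where "be = csqrt (x2 * (x1 - x3) / D)"
  have al2: "al\<^sup>2 = - (x2 - x3) * x1 / D" and be2: "be\<^sup>2 = x2 * (x1 - x3) / D"
    by (simp_all add: al_def be_def)
  have D2: "al\<^sup>2 * D = - (x2 - x3) * x1" "be\<^sup>2 * D = x2 * (x1 - x3)" using D al2 be2 by simp_all
  have ab: "al \<noteq> 0" "be \<noteq> 0" using nz D by (simp_all add: al_def be_def)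
  \<comment> \<open>The form \<open>x1 - x2\<close> has the value \<open>u\<close> at the
    parametrised point, which fixes the scale as \<open>u * x3 / D\<close>. Comparing the
    coordinates with \<open>al * u * A\<close>, \<open>be * u * B\<close> and \<open>A * B\<close>
    then yields \<open>A\<close>, \<open>B\<close> and \<open>u\<close>.\<close>
  define u where "u = x1 * x2 / (al * be * D)"
  define A where "A = x1 * x3 / (al * D)"
  define B where "B = x2 * x3 / (be * D)"
  have "al + u * be = (al\<^sup>2 * D + x1 * x2) / (al * D)"
    using ab D by (simp add: u_def field_simps power2_eq_square)
  moreover have "al\<^sup>2 * D + x1 * x2 = x1 * x3" unfolding D2 by (simp add: algebra_simps)
  ultimately have A: "A = al + u * be" unfolding A_def by simp
  have "al * u - be = (x1 * x2 - be\<^sup>2 * D) / (be * D)"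
    using ab D by (simp add: u_def field_simps power2_eq_square)
  moreover have "x1 * x2 - be\<^sup>2 * D = x2 * x3" unfolding D2 by (simp add: algebra_simps)
  ultimately have B: "B = al * u - be" unfolding B_def by simp
  have "al\<^sup>2 + be\<^sup>2 = (- (x2 - x3) * x1 + x2 * (x1 - x3)) / D" by (simp add: al2 be2 add_divide_distrib)
  also have "- (x2 - x3) * x1 + x2 * (x1 - x3) = D" by (simp add: D_def algebra_simps)
  finally have "al\<^sup>2 + be\<^sup>2 = 1" using D by simp
  then have adm: "admissible al be u A B" using A B ab by (simp add: admissible_def)
  have *: "al * u * A = (u * x3 / D) * x1" "be * u * B = (u * x3 / D) * x2" "A * B = (u * x3 / D) * x3"
    using ab D by (simp_all add: A_def B_def u_def field_simps)
  have "fst (quad_param al be u A B) = pt (al * u * A) (be * u * B) (A * B)" by (simp add: quad_param_def)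
  also have "\<dots> = y"
    unfolding x(1) pt_eq_iff[OF adm_nonzero(1)[OF adm] x(2)] unfolding * by (simp add: mult_ac)
  finally show ?thesis using filled_quad_eqI[OF yl adm] y adm that by blast
qed

lemma cov_of_point:
  assumes "(y, l) \<in> blowup quad_points" "y = pt p1 p2 p3" "\<not> (p1 = 0 \<and> p2 = 0 \<and> p3 = 0)" "y \<in> quad_points"
  obtains n1 n2 n3 where "l y = cov n1 n2 n3" "\<not> (n1 = 0 \<and> n2 = 0 \<and> n3 = 0)" "n1 * p1 + n2 * p2 + n3 * p3 = 0"
proof -
  obtain n1 n2 n3 where n: "l y = cov n1 n2 n3" "\<not> (n1 = 0 \<and> n2 = 0 \<and> n3 = 0)" by (rule cov_exhaust)
  have "y \<in> line (l y)" using assms by (auto simp: blowup_def)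
  then have "pt p1 p2 p3 \<in> line (cov n1 n2 n3)" using n(1) assms(2) by simp
  then have "n1 * p1 + n2 * p2 + n3 * p3 = 0" by (simp only: pt_in_line[OF n(2) assms(3)])
  with n that show ?thesis by blast
qed

text \<open>On each surviving exceptional curve one factor is zero, and the ratio of the
  coefficients of \<open>l y\<close> determines the others up to sign. The lines of the arrangement
  through \<open>y\<close> are the excluded values of \<open>l y\<close>; excluding them keeps the
  denominators and the required square roots nonzero.\<close>

lemma quad_param_surj_special:
  assumes yl: "(y, l) \<in> filled_quad" and y: "y \<in> quad_points"
  obtains al be u A B where "admissible al be u A B" "(y, l) = quad_param al be u A B"
proof -
  have bl: "(y, l) \<in> blowup quad_points" and ne: "y \<noteq> pt 1 1 1" "y \<noteq> pt 1 1 0"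
    and ST: "\<And>a. a \<in> quad_covectors \<Longrightarrow> y \<in> line a \<Longrightarrow> l y \<noteq> a"
    using yl unfolding filled_quad_iff by blast+
  have C: "cov 1 0 0 \<in> quad_covectors" "cov 0 1 0 \<in> quad_covectors" "cov 0 0 1 \<in> quad_covectors"
    "cov 1 (-1) 0 \<in> quad_covectors" "cov 1 0 (-1) \<in> quad_covectors" "cov 0 1 (-1) \<in> quad_covectors"
    by (simp_all add: quad_covectors_def)
  have found: thesis if "admissible al be u A B" "fst (quad_param al be u A B) = y"
    "l y = snd (quad_param al be u A B) y" for al be u A B
    using filled_quad_eqI[OF yl that(1,2)] that \<open>\<And>al be u A B. admissible al be u A B \<Longrightarrow> (y, l) = quad_param al be u A B \<Longrightarrow> thesis\<close>
    by blast
  from y ne consider "y = pt 0 0 1" | "y = pt 0 1 0" | "y = pt 1 0 0" | "y = pt 0 1 1" | "y = pt 1 0 1"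
    unfolding quad_points_def by blast
  then show ?thesis
  proof cases
    case 1
    obtain n1 n2 n3 where n: "l y = cov n1 n2 n3" "\<not> (n1 = 0 \<and> n2 = 0 \<and> n3 = 0)" "n3 = 0"
      by (rule cov_of_point[OF bl 1 _ y]) auto
    have "y \<in> line (cov 1 0 0)" "y \<in> line (cov 0 1 0)" "y \<in> line (cov 1 (-1) 0)" by (simp_all add: 1 pt_in_line)
    then have nz: "n1 \<noteq> 0" "n2 \<noteq> 0" "n1 + n2 \<noteq> 0"
      using ST[OF C(1)] ST[OF C(2)] ST[OF C(4)] n by (auto simp: cov_eq_iff add_eq_0_iff)
    \<comment> \<open>Here \<open>u = 0\<close>, \<open>A = al\<close>, \<open>B = - be\<close>, and
      the line is \<open>(be^2, al^2, 0)\<close> up to scale; \<open>al^2 + be^2 = 1\<close> fixes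
      the scale.\<close>
    define al where "al = csqrt (n2 / (n1 + n2))"
    define be where "be = csqrt (n1 / (n1 + n2))"
    have ab: "al \<noteq> 0" "be \<noteq> 0" "al * al = n2 / (n1 + n2)" "be * be = n1 / (n1 + n2)"
      using nz by (simp_all add: al_def be_def flip: power2_eq_square)
    have "al\<^sup>2 + be\<^sup>2 = (n2 + n1) / (n1 + n2)" by (simp add: ab power2_eq_square add_divide_distrib)
    also have "\<dots> = 1" using nz by (simp add: add.commute)
    finally have adm: "admissible al be 0 al (- be)" using ab by (simp add: admissible_def)
    have y': "fst (quad_param al be 0 al (- be)) = y" using quad_param_fst_cases(3)[OF adm] 1 by simp
    moreover have "snd (quad_param al be 0 al (- be)) y = cov (- (be * be)) (- (al * al)) 0" by (simp add: quad_param_def 1)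
    moreover have "cov (- (be * be)) (- (al * al)) 0 = l y"
      unfolding n(1) using nz n(3) by (subst cov_eq_iff) (auto simp: ab field_simps)
    ultimately show ?thesis using adm found by metis
  next
    case 2
    obtain n1 n2 n3 where n: "l y = cov n1 n2 n3" "\<not> (n1 = 0 \<and> n2 = 0 \<and> n3 = 0)" "n2 = 0"
      by (rule cov_of_point[OF bl 2 _ y]) auto
    have "y \<in> line (cov 1 0 0)" "y \<in> line (cov 0 0 1)" "y \<in> line (cov 1 0 (-1))" by (simp_all add: 2 pt_in_line)
    then have nz: "n1 \<noteq> 0" "n3 \<noteq> 0" "n1 + n3 \<noteq> 0"
      using ST[OF C(1)] ST[OF C(3)] ST[OF C(5)] n by (auto simp: cov_eq_iff add_eq_0_iff)
    \<comment> \<open>\<open>A = 0\<close> forces \<open>u = - al / be\<close> and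
      \<open>B = - 1 / be\<close>, so the line is \<open>(1, 0, - al^2)\<close> up to scale.\<close>
    define al where "al = csqrt (- n3 / n1)"
    define be where "be = csqrt ((n1 + n3) / n1)"
    have ab: "al \<noteq> 0" "be \<noteq> 0" "al * al = - n3 / n1" "be * be = (n1 + n3) / n1"
      using nz by (simp_all add: al_def be_def flip: power2_eq_square)
    have sq: "al * al + be * be = 1" using nz by (simp add: ab field_simps)
    have "al * (- al / be) - be = - (al * al + be * be) / be" using ab by (simp add: field_simps)
    then have "- 1 / be = al * (- al / be) - be" unfolding sq by simp
    then have adm: "admissible al be (- al / be) 0 (- 1 / be)"
      using ab(1,2) sq by (simp add: admissible_def power2_eq_square)
    have y': "fst (quad_param al be (- al / be) 0 (- 1 / be)) = y" using quad_param_fst_cases(4)[OF adm] 2 by simp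
    moreover have "snd (quad_param al be (- al / be) 0 (- 1 / be)) y = cov (- 1 / be) 0 (- (al * (- al / be)))"
      by (simp add: quad_param_def 2)
    moreover have "cov (- 1 / be) 0 (- (al * (- al / be))) = l y"
    proof -
      have "- 1 / be * n3 = (al * al) / be * n1" using nz by (simp add: ab(3))
      then show ?thesis
        unfolding n(1) using n(2,3) ab(2) by (subst cov_eq_iff) auto
    qed
    ultimately show ?thesis using adm found by metis
  next
    case 3
    obtain n1 n2 n3 where n: "l y = cov n1 n2 n3" "\<not> (n1 = 0 \<and> n2 = 0 \<and> n3 = 0)" "n1 = 0"
      by (rule cov_of_point[OF bl 3 _ y]) auto
    have "y \<in> line (cov 0 1 0)" "y \<in> line (cov 0 0 1)" "y \<in> line (cov 0 1 (-1))" by (simp_all add: 3 pt_in_line)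
    then have nz: "n2 \<noteq> 0" "n3 \<noteq> 0" "n2 + n3 \<noteq> 0"
      using ST[OF C(2)] ST[OF C(3)] ST[OF C(6)] n by (auto simp: cov_eq_iff add_eq_0_iff)
    \<comment> \<open>\<open>B = 0\<close> forces \<open>u = be / al\<close> and
      \<open>A = 1 / al\<close>, so the line is \<open>(0, 1, - be^2)\<close> up to scale.\<close>
    define be where "be = csqrt (- n3 / n2)"
    define al where "al = csqrt ((n2 + n3) / n2)"
    have ab: "al \<noteq> 0" "be \<noteq> 0" "be * be = - n3 / n2" "al * al = (n2 + n3) / n2"
      using nz by (simp_all add: al_def be_def flip: power2_eq_square)
    have sq: "al * al + be * be = 1" using nz by (simp add: ab field_simps)
    have "al + (be / al) * be = (al * al + be * be) / al" using ab(1) by (simp add: add_divide_distrib)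
    then have "1 / al = al + (be / al) * be" unfolding sq by simp
    then have adm: "admissible al be (be / al) (1 / al) 0"
      using ab(1,2) sq by (simp add: admissible_def power2_eq_square)
    have y': "fst (quad_param al be (be / al) (1 / al) 0) = y" using quad_param_fst_cases(5)[OF adm] 3 by simp
    moreover have "snd (quad_param al be (be / al) (1 / al) 0) y = cov 0 (1 / al) (- (be * (be / al)))"
      by (simp add: quad_param_def 3)
    moreover have "cov 0 (1 / al) (- (be * (be / al))) = l y"
    proof -
      have "1 / al * n3 = - ((be * be) / al) * n2" using nz by (simp add: ab(3))
      then show ?thesis
        unfolding n(1) using n(2,3) ab(1) by (subst cov_eq_iff) auto
    qed
    ultimately show ?thesis using adm found by metis
  next
    case 4
    obtain n1 n2 n3 where n: "l y = cov n1 n2 n3" "\<not> (n1 = 0 \<and> n2 = 0 \<and> n3 = 0)" "n2 + n3 = 0"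
      by (rule cov_of_point[OF bl 4 _ y]) auto
    have "y \<in> line (cov 1 0 0)" "y \<in> line (cov 0 1 (-1))" by (simp_all add: 4 pt_in_line)
    then have nz: "n1 \<noteq> 0" "n2 \<noteq> 0" and n3: "n3 = - n2"
      using ST[OF C(1)] ST[OF C(6)] n by (auto simp: cov_eq_iff add_eq_0_iff)
    \<comment> \<open>\<open>al = 0\<close> allows \<open>be = 1\<close>; then \<open>A = u\<close>,
      \<open>B = - 1\<close>, and the line is \<open>(1, - u^2, u^2)\<close> up to scale.\<close>
    define u where "u = csqrt (- n2 / n1)"
    have u: "u \<noteq> 0" "u * u = - n2 / n1" using nz by (simp_all add: u_def flip: power2_eq_square)
    have adm: "admissible 0 1 u u (- 1)" using u by (simp add: admissible_def)
    have y': "fst (quad_param 0 1 u u (- 1)) = y" using quad_param_fst_cases(1)[OF adm] 4 by simp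
    moreover have "snd (quad_param 0 1 u u (- 1)) y = cov (- 1) (u * u) (- (u * u))" by (simp add: quad_param_def 4)
    moreover have "cov (- 1) (u * u) (- (u * u)) = l y"
      unfolding n(1) using nz n3 by (subst cov_eq_iff) (auto simp: u field_simps)
    ultimately show ?thesis using adm found by metis
  next
    case 5
    obtain n1 n2 n3 where n: "l y = cov n1 n2 n3" "\<not> (n1 = 0 \<and> n2 = 0 \<and> n3 = 0)" "n1 + n3 = 0"
      by (rule cov_of_point[OF bl 5 _ y]) auto
    have "y \<in> line (cov 0 1 0)" "y \<in> line (cov 1 0 (-1))" by (simp_all add: 5 pt_in_line)
    then have nz: "n1 \<noteq> 0" "n2 \<noteq> 0" and n3: "n3 = - n1"
      using ST[OF C(2)] ST[OF C(5)] n by (auto simp: cov_eq_iff add_eq_0_iff)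
    \<comment> \<open>\<open>be = 0\<close> allows \<open>al = 1\<close>; then \<open>A = 1\<close>,
      \<open>B = u\<close>, and the line is \<open>(u^2, - 1, - u^2)\<close>.\<close>
    define u where "u = csqrt (- n1 / n2)"
    have u: "u \<noteq> 0" "u * u = - n1 / n2" using nz by (simp_all add: u_def flip: power2_eq_square)
    have adm: "admissible 1 0 u 1 u" using u by (simp add: admissible_def)
    have y': "fst (quad_param 1 0 u 1 u) = y" using quad_param_fst_cases(2)[OF adm] 5 by simp
    moreover have "snd (quad_param 1 0 u 1 u) y = cov (u * u) (- 1) (- (u * u))" by (simp add: quad_param_def 5)
    moreover have "cov (u * u) (- 1) (- (u * u)) = l y"
      unfolding n(1) using nz n3 by (subst cov_eq_iff) (auto simp: u field_simps)
    ultimately show ?thesis using adm found by metis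
  qed
qed

lemma quad_param_surj:
  assumes "p \<in> filled_quad"
  obtains al be u A B where "admissible al be u A B" "p = quad_param al be u A B"
proof (cases p)
  case (Pair y l)
  with assms have yl: "(y, l) \<in> filled_quad" by simp
  show ?thesis
  proof (cases "y \<in> quad_points")
    case True
    from quad_param_surj_special[OF yl True] show ?thesis using that Pair by metis
  next
    case False
    from quad_param_surj_generic[OF yl False] show ?thesis using that Pair by metis
  qed
qed

end

section \<open>From the universal cover onto the surface\<close>

lemma complex_sin_cos_exists:
  fixes a b :: complex
  assumes "a\<^sup>2 + b\<^sup>2 = 1"
  obtains f where "sin f = a" "cos f = b"
proof -
  have "(sin (Arccos b))\<^sup>2 = a\<^sup>2"
    using assms unfolding sin_squared_eq cos_Arccos by (metis add_diff_cancel_right')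
  then consider "sin (Arccos b) = a" | "sin (- Arccos b) = a" by (auto simp: power2_eq_iff)
  then show ?thesis by cases (use that[of "Arccos b"] that[of "- Arccos b"] in simp_all)
qed

context projective_frame
begin

definition quad_map :: "complex \<times> complex \<Rightarrow> cp2 \<times> (cp2 \<Rightarrow> cp2)" where
  "quad_map = (\<lambda>(f, u). quad_param (sin f) (cos f) u (sin f + u * cos f) (sin f * u - cos f))"

lemma admissible_model_cover:
  "(f, u) \<in> model_cover \<longleftrightarrow> admissible (sin f) (cos f) u (sin f + u * cos f) (sin f * u - cos f)"
  by (auto simp: model_cover_def admissible_def sin_double)

lemma model_map_sin_cos: "model_map (f, u) = (1 - 2 * (sin f)\<^sup>2, 2 * sin f * cos f * u, u\<^sup>2)"
  unfolding model_map_def prod.case cos_double_sin sin_double by (simp add: mult_ac)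

lemma quad_map_image: "quad_map ` model_cover = filled_quad"
proof
  show "quad_map ` model_cover \<subseteq> filled_quad"
    using quad_param_in_filled_quad by (auto simp: quad_map_def admissible_model_cover)
  show "filled_quad \<subseteq> quad_map ` model_cover"
  proof
    fix p assume "p \<in> filled_quad"
    then obtain al be u A B where *: "admissible al be u A B" "p = quad_param al be u A B"
      by (rule quad_param_surj)
    then have AB: "A = al + u * be" "B = al * u - be" and "al\<^sup>2 + be\<^sup>2 = 1" by (simp_all add: admissible_def)
    then obtain f where "sin f = al" "cos f = be" using complex_sin_cos_exists by metis
    then show "p \<in> quad_map ` model_cover"
      using * AB by (intro image_eqI[of _ _ "(f, u)"]) (simp_all add: quad_map_def admissible_model_cover)
  qed
qed

lemma quad_map_add_pi: "quad_map (of_real (of_int k * pi) + f, u) = quad_map (f, u)"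
proof -
  define e :: complex where "e = cos (of_real (of_int k * pi))"
  have s: "sin (of_real (of_int k * pi) :: complex) = 0" using sin_eq_0 by blast
  then have "e\<^sup>2 = 1" unfolding e_def by (simp add: cos_squared_eq)
  then consider "e = 1" | "e = - 1" by (auto simp: power2_eq_1_iff)
  moreover have sc: "sin (of_real (of_int k * pi) + f) = e * sin f" "cos (of_real (of_int k * pi) + f) = e * cos f"
    unfolding sin_add cos_add s e_def[symmetric] by simp_all
  ultimately show ?thesis
  proof cases
    case 1
    then show ?thesis unfolding quad_map_def prod.case sc by simp
  next
    case 2
    have "quad_param (- sin f) (- cos f) u (- sin f + u * - cos f) (- sin f * u - - cos f) = quad_map (f, u)"
      using quad_param_minus(1)[of "sin f" "cos f" u "sin f + u * cos f" "sin f * u - cos f"]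
      by (simp add: quad_map_def)
    then show ?thesis unfolding quad_map_def prod.case sc using 2 by simp
  qed
qed

lemma quad_map_deck: "quad_map (deck k s x) = quad_map x"
proof (cases x)
  case (Pair f u)
  have "sin (- f) + - u * cos (- f) = - (sin f + u * cos f)" "sin (- f) * - u - cos (- f) = sin f * u - cos f"
    by simp_all
  then have "quad_map (- f, - u) = quad_map (f, u)"
    unfolding quad_map_def prod.case by (simp only: sin_minus cos_minus quad_param_minus)
  then show ?thesis
    using quad_map_add_pi[of k f u] quad_map_add_pi[of k "- f" "- u"] by (auto simp: Pair deck_def)
qed

lemma continuous_on_quad_map: "continuous_on model_cover quad_map"
proof -
  define A where "A = (\<lambda>x. sin (fst x) + snd x * cos (fst x) :: complex)"
  define B where "B = (\<lambda>x. sin (fst x) * snd x - cos (fst x) :: complex)"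
  have eq: "quad_map = (\<lambda>x. quad_param (sin (fst x)) (cos (fst x)) (snd x) (A x) (B x))"
    by (auto simp: quad_map_def A_def B_def)
  have adm: "admissible (sin (fst x)) (cos (fst x)) (snd x) (A x) (B x)" if "x \<in> model_cover" for x
    using that admissible_model_cover[of "fst x" "snd x"] by (simp add: A_def B_def)
  have c: "continuous_on model_cover A" "continuous_on model_cover B"
    unfolding A_def B_def by (intro continuous_intros)+
  have fam: "continuous_on model_cover (\<lambda>x. family (a x) (b x) (c x) (d x) (e x) (f x) (g x) s)"
    if "continuous_on model_cover a" "continuous_on model_cover b" "continuous_on model_cover c"
      "continuous_on model_cover d" "continuous_on model_cover e" "continuous_on model_cover f" "continuous_on model_cover g"
    for a b c d e f g s
  proof -
    have if_const: "continuous_on model_cover (\<lambda>x. if P then h x else k x)"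
      if "continuous_on model_cover h" "continuous_on model_cover k" for P and h k :: "complex \<times> complex \<Rightarrow> cp2"
      using that by (cases P) simp_all
    show ?thesis unfolding family_def restrict_def by (intro if_const that continuous_on_const)
  qed
  show ?thesis
    unfolding eq quad_param_def
    by (intro continuous_on_Pair continuous_on_coordinatewise_then_product fam continuous_on_pt continuous_on_cov
        continuous_intros c; (drule adm)?; (erule adm_nonzero)?)
qed

section \<open>Charts and continuity of the three coordinates\<close>

lemma continuous_on_pt_ratio_fst:
  assumes "\<And>p. p \<in> T \<Longrightarrow> \<exists>al be u A B. admissible al be u A B \<and> p = quad_param al be u A B \<and>
      dot b (vector [al * u * A, be * u * B, A * B]) \<noteq> 0"
  shows "continuous_on T (\<lambda>p. pt_ratio a b (fst p))"
proof (rule continuous_on_pt_ratio)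
  show "continuous_on T fst" by (intro continuous_intros)
  fix p assume "p \<in> T"
  then obtain al be u A B where *: "admissible al be u A B" "p = quad_param al be u A B"
      "dot b (vector [al * u * A, be * u * B, A * B]) \<noteq> 0" using assms by blast
  have "fst p = pt (al * u * A) (be * u * B) (A * B)" by (simp add: *(2) quad_param_def)
  then show "\<exists>x y z. fst p = pt x y z \<and> \<not> (x = 0 \<and> y = 0 \<and> z = 0) \<and> dot b (vector [x, y, z]) \<noteq> 0"
    using adm_nonzero(1)[OF *(1)] *(3) by blast
qed

lemma continuous_on_cov_ratio_snd:
  assumes "\<And>p. p \<in> T \<Longrightarrow> \<exists>x y z. snd p c = cov x y z \<and> \<not> (x = 0 \<and> y = 0 \<and> z = 0) \<and> dot b (vector [x, y, z]) \<noteq> 0"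
  shows "continuous_on T (\<lambda>p. cov_ratio a b (snd p c))"
  by (rule continuous_on_cov_ratio[OF continuous_on_snd_coordinate assms])

text \<open>For a surviving centre \<open>c\<close> this open part of the surface keeps only the
  exceptional curve over \<open>c\<close>, so four of the five factors are nonzero on it. The five
  surviving centres give a cover.\<close>

definition chart_domain :: "cp2 \<Rightarrow> (cp2 \<times> (cp2 \<Rightarrow> cp2)) set" where
  "chart_domain c = {p \<in> filled_quad. fst p \<notin> quad_points - {c}}"

lemma chart_params:
  assumes "p \<in> chart_domain c"
  obtains al be u A B where "admissible al be u A B" "p = quad_param al be u A B"
    "c \<noteq> pt 0 1 1 \<Longrightarrow> al \<noteq> 0" "c \<noteq> pt 1 0 1 \<Longrightarrow> be \<noteq> 0" "c \<noteq> pt 0 0 1 \<Longrightarrow> u \<noteq> 0"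
    "c \<noteq> pt 0 1 0 \<Longrightarrow> A \<noteq> 0" "c \<noteq> pt 1 0 0 \<Longrightarrow> B \<noteq> 0"
proof -
  obtain al be u A B where *: "admissible al be u A B" "p = quad_param al be u A B"
    using assms quad_param_surj unfolding chart_domain_def by blast
  have S: "pt 0 1 1 \<in> quad_points" "pt 1 0 1 \<in> quad_points" "pt 0 0 1 \<in> quad_points" "pt 0 1 0 \<in> quad_points" "pt 1 0 0 \<in> quad_points"
    by (simp_all add: quad_points_def)
  have n: "fst (quad_param al be u A B) \<notin> quad_points - {c}" using assms * by (simp add: chart_domain_def)
  show ?thesis
  proof (rule that[OF *])
    assume "c \<noteq> pt 0 1 1" then show "al \<noteq> 0"
      using quad_param_fst_cases(1)[OF *(1)] n S(1) by (metis DiffI singletonD)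
  next
    assume "c \<noteq> pt 1 0 1" then show "be \<noteq> 0"
      using quad_param_fst_cases(2)[OF *(1)] n S(2) by (metis DiffI singletonD)
  next
    assume "c \<noteq> pt 0 0 1" then show "u \<noteq> 0"
      using quad_param_fst_cases(3)[OF *(1)] n S(3) by (metis DiffI singletonD)
  next
    assume "c \<noteq> pt 0 1 0" then show "A \<noteq> 0"
      using quad_param_fst_cases(4)[OF *(1)] n S(4) by (metis DiffI singletonD)
  next
    assume "c \<noteq> pt 1 0 0" then show "B \<noteq> 0"
      using quad_param_fst_cases(5)[OF *(1)] n S(5) by (metis DiffI singletonD)
  qed
qed

lemma chart_forms:
  assumes "admissible al be u A B"
  shows "be * B - al * A = - 1" "B - al * u = - be" "A - be * u = al"
proof -
  show "be * B - al * A = - 1" using adm_diff(1)[OF assms] by (metis minus_diff_eq)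
  show "B - al * u = - be" using adm_B[OF assms] by simp
  show "A - be * u = al" using adm_A[OF assms] by (simp add: mult.commute)
qed

definition chart_nonzero :: "cp2 \<Rightarrow> complex \<Rightarrow> complex \<Rightarrow> complex \<Rightarrow> complex \<Rightarrow> complex \<Rightarrow> bool" where
  "chart_nonzero c al be u A B \<longleftrightarrow> (c \<noteq> pt 0 1 1 \<longrightarrow> al \<noteq> 0) \<and> (c \<noteq> pt 1 0 1 \<longrightarrow> be \<noteq> 0) \<and>
    (c \<noteq> pt 0 0 1 \<longrightarrow> u \<noteq> 0) \<and> (c \<noteq> pt 0 1 0 \<longrightarrow> A \<noteq> 0) \<and> (c \<noteq> pt 1 0 0 \<longrightarrow> B \<noteq> 0)"

lemma chart_exhaust:
  assumes "p \<in> chart_domain c"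
  obtains al be u A B where "admissible al be u A B" "p = quad_param al be u A B" "chart_nonzero c al be u A B"
  by (rule chart_params[OF assms], rule that) (auto simp: chart_nonzero_def)

lemma continuous_on_chart_pt:
  assumes "\<And>al be u A B. admissible al be u A B \<Longrightarrow> chart_nonzero c al be u A B \<Longrightarrow>
    dot b (vector [al * u * A, be * u * B, A * B]) \<noteq> 0"
  shows "continuous_on (chart_domain c) (\<lambda>p. pt_ratio a b (fst p))"
proof (rule continuous_on_pt_ratio_fst)
  fix p assume "p \<in> chart_domain c"
  then obtain al be u A B where "admissible al be u A B" "p = quad_param al be u A B" "chart_nonzero c al be u A B"
    by (rule chart_exhaust)
  with assms show "\<exists>al be u A B. admissible al be u A B \<and> p = quad_param al be u A B \<and>
      dot b (vector [al * u * A, be * u * B, A * B]) \<noteq> 0"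
    by blast
qed

lemma continuous_on_chart_cov:
  assumes "\<And>al be u A B. admissible al be u A B \<Longrightarrow> chart_nonzero c al be u A B \<Longrightarrow>
    \<exists>x y z. snd (quad_param al be u A B) c = cov x y z \<and> \<not> (x = 0 \<and> y = 0 \<and> z = 0) \<and> dot b (vector [x, y, z]) \<noteq> 0"
  shows "continuous_on (chart_domain c) (\<lambda>p. cov_ratio a b (snd p c))"
proof (rule continuous_on_cov_ratio_snd)
  fix p assume "p \<in> chart_domain c"
  then obtain al be u A B where *: "admissible al be u A B" "p = quad_param al be u A B" "chart_nonzero c al be u A B"
    by (rule chart_exhaust)
  show "\<exists>x y z. snd p c = cov x y z \<and> \<not> (x = 0 \<and> y = 0 \<and> z = 0) \<and> dot b (vector [x, y, z]) \<noteq> 0"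
    unfolding *(2) by (rule assms[OF *(1,3)])
qed

lemma pt_ratio_quad_param:
  assumes "admissible al be u A B"
  shows "pt_ratio a b (fst (quad_param al be u A B)) =
    dot a (vector [al * u * A, be * u * B, A * B]) / dot b (vector [al * u * A, be * u * B, A * B])"
  unfolding quad_param_def fst_conv by (rule pt_ratio_pt[OF adm_nonzero(1)[OF assms]])

lemma cov_ratio_quad_param:
  assumes "admissible al be u A B"
  shows "cov_ratio a b (snd (quad_param al be u A B) (pt 1 0 0)) =
      dot a (vector [0, A, - (be * u)]) / dot b (vector [0, A, - (be * u)])"
    "cov_ratio a b (snd (quad_param al be u A B) (pt 0 1 0)) =
      dot a (vector [B, 0, - (al * u)]) / dot b (vector [B, 0, - (al * u)])"
    "cov_ratio a b (snd (quad_param al be u A B) (pt 0 0 1)) =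
      dot a (vector [be * B, - (al * A), 0]) / dot b (vector [be * B, - (al * A), 0])"
    "cov_ratio a b (snd (quad_param al be u A B) (pt 0 1 1)) =
      dot a (vector [B, u * A, - (u * A)]) / dot b (vector [B, u * A, - (u * A)])"
    "cov_ratio a b (snd (quad_param al be u A B) (pt 1 0 1)) =
      dot a (vector [u * B, - A, - (u * B)]) / dot b (vector [u * B, - A, - (u * B)])"
  unfolding quad_param_def snd_conv family_simps
  using adm_nonzero[OF assms] by (simp_all add: cov_ratio_cov)

lemma dot_vector: "dot (vector [a, b, c]) (vector [x, y, z]) = a * x + b * y + c * z"
  by (simp add: dot_3)

text \<open>The functions \<open>cos 2f\<close>, \<open>u sin 2f\<close> and \<open>u\<^sup>2\<close> are rational functions on the plane; at a point blown up
  the ratio of two forms that vanish there is read off the line instead.\<close>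

lemma coordinates_chart:
  assumes "c \<in> {pt 1 0 0, pt 0 1 0, pt 0 0 1, pt 0 1 1, pt 1 0 1}"
  obtains h where "continuous_on (chart_domain c) h"
    "\<And>al be u A B. admissible al be u A B \<Longrightarrow> chart_nonzero c al be u A B \<Longrightarrow>
      h (quad_param al be u A B) = (1 - 2 * al\<^sup>2, 2 * al * be * u, u\<^sup>2)"
proof -
  define r where "r a b p = pt_ratio a b (fst p)" for a b and p :: "cp2 \<times> (cp2 \<Rightarrow> cp2)"
  define k where "k a b p = cov_ratio a b (snd p c)" for a b and p :: "cp2 \<times> (cp2 \<Rightarrow> cp2)"
  have cont_r: "continuous_on (chart_domain c) (r a b)" if "\<And>al be u A B. admissible al be u A B \<Longrightarrow>
      chart_nonzero c al be u A B \<Longrightarrow> dot b (vector [al * u * A, be * u * B, A * B]) \<noteq> 0" for a b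
    unfolding r_def using that by (rule continuous_on_chart_pt)
  have cont_k: "continuous_on (chart_domain c) (k a b)"
    if "\<And>al be u A B. admissible al be u A B \<Longrightarrow> chart_nonzero c al be u A B \<Longrightarrow>
        snd (quad_param al be u A B) c = cov (x al be u A B) (y al be u A B) (z al be u A B) \<and>
        dot b (vector [x al be u A B, y al be u A B, z al be u A B]) \<noteq> 0" for a b x y z
    unfolding k_def
  proof (rule continuous_on_chart_cov)
    fix al be u A B assume "admissible al be u A B" "chart_nonzero c al be u A B"
    from that[OF this] show "\<exists>x y z. snd (quad_param al be u A B) c = cov x y z \<and>
        \<not> (x = 0 \<and> y = 0 \<and> z = 0) \<and> dot b (vector [x, y, z]) \<noteq> 0"
      by (intro exI conjI) (auto simp: dot_3)
  qed
  note forms = dot_vector adm_form_diff chart_forms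
  note value_simps = r_def k_def pt_ratio_quad_param cov_ratio_quad_param forms power2_eq_square
  from assms consider "c = pt 0 0 1" | "c = pt 0 1 0" | "c = pt 1 0 0" | "c = pt 0 1 1" | "c = pt 1 0 1" by blast
  then show ?thesis
  proof cases
    case 1
    have nz: "al \<noteq> 0 \<and> be \<noteq> 0 \<and> A \<noteq> 0 \<and> B \<noteq> 0" if "chart_nonzero c al be u A B" for al be u A B
      using that by (simp add: chart_nonzero_def 1 pt_eq_iff)
    \<comment> \<open>In the rational expressions of the coordinates only
      \<open>x1 / (x1 - x2)\<close> is indeterminate at this point. It equals
      \<open>n2 / (n1 + n2)\<close>, where \<open>n\<close> is the covector of the line.\<close>
    define h where "h p = (1 + 2 * (r (vector [0,1,-1]) (vector [0,0,1]) p * k (vector [0,1,0]) (vector [1,1,0]) p),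
        2 * r (vector [0,1,0]) (vector [0,0,1]) p * k (vector [0,1,0]) (vector [1,1,0]) p,
        - (r (vector [1,0,0]) (vector [1,0,-1]) p * r (vector [0,1,0]) (vector [0,1,-1]) p))" for p
    show ?thesis
    proof
      have "continuous_on (chart_domain c) (r a (vector [0,0,1]))" "continuous_on (chart_domain c) (r a (vector [1,0,-1]))"
        "continuous_on (chart_domain c) (r a (vector [0,1,-1]))" for a
        by (rule cont_r; simp add: forms del: mult_eq_0_iff; simp add: nz)+
      moreover have "continuous_on (chart_domain c) (k a (vector [1,1,0]))" for a
        by (rule cont_k[of "\<lambda>al be u A B. be * B" "\<lambda>al be u A B. - (al * A)" "\<lambda>al be u A B. 0"];
            simp add: 1 quad_param_def forms nz)+
      ultimately show "continuous_on (chart_domain c) h"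
        unfolding h_def by (intro continuous_intros)
      fix al be u A B assume adm: "admissible al be u A B" and n: "chart_nonzero c al be u A B"
      show "h (quad_param al be u A B) = (1 - 2 * al\<^sup>2, 2 * al * be * u, u\<^sup>2)"
        using adm nz[OF n] by (simp add: h_def value_simps 1)
    qed
  next
    case 2
    have nz: "al \<noteq> 0 \<and> be \<noteq> 0 \<and> u \<noteq> 0 \<and> B \<noteq> 0" if "chart_nonzero c al be u A B" for al be u A B
      using that by (simp add: chart_nonzero_def 2 pt_eq_iff)
    \<comment> \<open>Here \<open>x1 / x3\<close> is read as \<open>- n3 / n1\<close>, and
      \<open>x1 / (x1 - x3)\<close> as \<open>n3 / (n1 + n3)\<close>.\<close>
    define h where "h p = (1 - 2 * (r (vector [0,1,-1]) (vector [1,-1,0]) p * k (vector [0,0,1]) (vector [1,0,0]) p),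
        - (2 * r (vector [0,1,0]) (vector [1,-1,0]) p * k (vector [0,0,1]) (vector [1,0,0]) p),
        - (r (vector [0,1,0]) (vector [0,1,-1]) p * k (vector [0,0,1]) (vector [1,0,1]) p))" for p
    show ?thesis
    proof
      have "continuous_on (chart_domain c) (r a (vector [1,-1,0]))"
        "continuous_on (chart_domain c) (r a (vector [0,1,-1]))" for a
        by (rule cont_r; simp add: forms del: mult_eq_0_iff; simp add: nz)+
      moreover have "continuous_on (chart_domain c) (k a (vector [1,0,0]))" "continuous_on (chart_domain c) (k a (vector [1,0,1]))" for a
        by (rule cont_k[of "\<lambda>al be u A B. B" "\<lambda>al be u A B. 0" "\<lambda>al be u A B. - (al * u)"];
            simp add: 2 quad_param_def forms nz)+
      ultimately show "continuous_on (chart_domain c) h"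
        unfolding h_def by (intro continuous_intros)
      fix al be u A B assume adm: "admissible al be u A B" and n: "chart_nonzero c al be u A B"
      show "h (quad_param al be u A B) = (1 - 2 * al\<^sup>2, 2 * al * be * u, u\<^sup>2)"
        using adm nz[OF n] by (simp add: h_def value_simps 2)
    qed
  next
    case 3
    have nz: "al \<noteq> 0 \<and> be \<noteq> 0 \<and> u \<noteq> 0 \<and> A \<noteq> 0" if "chart_nonzero c al be u A B" for al be u A B
      using that by (simp add: chart_nonzero_def 3 pt_eq_iff)
    \<comment> \<open>Here \<open>x2 / x3\<close> is read as \<open>- n3 / n2\<close>,
      \<open>(x3 - x2) / x3\<close> as \<open>(n2 + n3) / n2\<close>, and
      \<open>x2 / (x2 - x3)\<close> as \<open>n3 / (n2 + n3)\<close>.\<close>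
    define h where "h p = (1 - 2 * (r (vector [1,0,0]) (vector [1,-1,0]) p * k (vector [0,1,1]) (vector [0,1,0]) p),
        - (2 * r (vector [1,0,0]) (vector [1,-1,0]) p * k (vector [0,0,1]) (vector [0,1,0]) p),
        - (r (vector [1,0,0]) (vector [1,0,-1]) p * k (vector [0,0,1]) (vector [0,1,1]) p))" for p
    show ?thesis
    proof
      have "continuous_on (chart_domain c) (r a (vector [1,-1,0]))"
        "continuous_on (chart_domain c) (r a (vector [1,0,-1]))" for a
        by (rule cont_r; simp add: forms del: mult_eq_0_iff; simp add: nz)+
      moreover have "continuous_on (chart_domain c) (k a (vector [0,1,0]))" "continuous_on (chart_domain c) (k a (vector [0,1,1]))" for a
        by (rule cont_k[of "\<lambda>al be u A B. 0" "\<lambda>al be u A B. A" "\<lambda>al be u A B. - (be * u)"];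
            simp add: 3 quad_param_def forms nz)+
      ultimately show "continuous_on (chart_domain c) h"
        unfolding h_def by (intro continuous_intros)
      fix al be u A B assume adm: "admissible al be u A B" and n: "chart_nonzero c al be u A B"
      show "h (quad_param al be u A B) = (1 - 2 * al\<^sup>2, 2 * al * be * u, u\<^sup>2)"
        using adm nz[OF n] by (simp add: h_def value_simps 3)
    qed
  next
    case 4
    have nz: "be \<noteq> 0 \<and> u \<noteq> 0 \<and> A \<noteq> 0 \<and> B \<noteq> 0" if "chart_nonzero c al be u A B" for al be u A B
      using that by (simp add: chart_nonzero_def 4 pt_eq_iff)
    \<comment> \<open>At a double point only the last coordinate involves the line:
      \<open>x1 / (x2 - x3)\<close> is \<open>- n2 / n1\<close>.\<close>
    define h where "h p = (1 + 2 * (r (vector [0,1,-1]) (vector [1,-1,0]) p * r (vector [1,0,0]) (vector [0,0,1]) p),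
        2 * r (vector [1,0,0]) (vector [0,0,1]) p * r (vector [0,1,0]) (vector [1,-1,0]) p,
        r (vector [0,1,0]) (vector [1,0,-1]) p * k (vector [0,1,0]) (vector [1,0,0]) p)" for p
    show ?thesis
    proof
      have "continuous_on (chart_domain c) (r a (vector [1,-1,0]))" "continuous_on (chart_domain c) (r a (vector [0,0,1]))"
        "continuous_on (chart_domain c) (r a (vector [1,0,-1]))" for a
        by (rule cont_r; simp add: forms del: mult_eq_0_iff; simp add: nz)+
      moreover have "continuous_on (chart_domain c) (k a (vector [1,0,0]))" for a
        by (rule cont_k[of "\<lambda>al be u A B. B" "\<lambda>al be u A B. u * A" "\<lambda>al be u A B. - (u * A)"];
            simp add: 4 quad_param_def forms nz)+
      ultimately show "continuous_on (chart_domain c) h"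
        unfolding h_def by (intro continuous_intros)
      fix al be u A B assume adm: "admissible al be u A B" and n: "chart_nonzero c al be u A B"
      show "h (quad_param al be u A B) = (1 - 2 * al\<^sup>2, 2 * al * be * u, u\<^sup>2)"
        using adm nz[OF n] by (simp add: h_def value_simps 4)
    qed
  next
    case 5
    have nz: "al \<noteq> 0 \<and> u \<noteq> 0 \<and> A \<noteq> 0 \<and> B \<noteq> 0" if "chart_nonzero c al be u A B" for al be u A B
      using that by (simp add: chart_nonzero_def 5 pt_eq_iff)
    \<comment> \<open>Again only the last coordinate involves the line:
      \<open>x2 / (x1 - x3)\<close> is \<open>- n1 / n2\<close>.\<close>
    define h where "h p = (1 + 2 * (r (vector [0,1,-1]) (vector [1,-1,0]) p * r (vector [1,0,0]) (vector [0,0,1]) p),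
        2 * r (vector [1,0,0]) (vector [0,0,1]) p * r (vector [0,1,0]) (vector [1,-1,0]) p,
        r (vector [1,0,0]) (vector [0,1,-1]) p * k (vector [1,0,0]) (vector [0,1,0]) p)" for p
    show ?thesis
    proof
      have "continuous_on (chart_domain c) (r a (vector [1,-1,0]))" "continuous_on (chart_domain c) (r a (vector [0,0,1]))"
        "continuous_on (chart_domain c) (r a (vector [0,1,-1]))" for a
        by (rule cont_r; simp add: forms del: mult_eq_0_iff; simp add: nz)+
      moreover have "continuous_on (chart_domain c) (k a (vector [0,1,0]))" for a
        by (rule cont_k[of "\<lambda>al be u A B. u * B" "\<lambda>al be u A B. - A" "\<lambda>al be u A B. - (u * B)"];
            simp add: 5 quad_param_def forms nz)+
      ultimately show "continuous_on (chart_domain c) h"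
        unfolding h_def by (intro continuous_intros)
      fix al be u A B assume adm: "admissible al be u A B" and n: "chart_nonzero c al be u A B"
      show "h (quad_param al be u A B) = (1 - 2 * al\<^sup>2, 2 * al * be * u, u\<^sup>2)"
        using adm nz[OF n] by (simp add: h_def value_simps 5)
    qed
  qed
qed

text \<open>\<open>F\<close> is defined through an arbitrary preimage, but on each chart it
  coincides with the function from \<open>coordinates_chart\<close>. That gives both its continuity
  and its independence of the preimage.\<close>

lemma quad_coordinates:
  "\<exists>F. continuous_on filled_quad F \<and> (\<forall>x\<in>model_cover. F (quad_map x) = model_map x)"
proof -
  define F where "F p = model_map (SOME x. x \<in> model_cover \<and> quad_map x = p)" for p
  let ?C = "{pt 1 0 0, pt 0 1 0, pt 0 0 1, pt 0 1 1, pt 1 0 1}"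
  have F: "F p = h p" if h: "\<And>al be u A B. admissible al be u A B \<Longrightarrow> chart_nonzero c al be u A B \<Longrightarrow>
      h (quad_param al be u A B) = (1 - 2 * al\<^sup>2, 2 * al * be * u, u\<^sup>2)" and p: "p \<in> chart_domain c" for h c p
  proof -
    have "p \<in> quad_map ` model_cover" using p by (simp add: quad_map_image chart_domain_def)
    then obtain x0 where "x0 \<in> model_cover \<and> quad_map x0 = p" by (elim imageE) simp
    then have some: "(SOME x. x \<in> model_cover \<and> quad_map x = p) \<in> model_cover \<and>
        quad_map (SOME x. x \<in> model_cover \<and> quad_map x = p) = p"
      by (rule someI)
    obtain f u where fu: "(SOME x. x \<in> model_cover \<and> quad_map x = p) = (f, u)" by fastforce
    have x: "F p = model_map (f, u)" "(f, u) \<in> model_cover" "quad_map (f, u) = p"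
      using some unfolding F_def fu by simp_all
    have adm: "admissible (sin f) (cos f) u (sin f + u * cos f) (sin f * u - cos f)"
      using x(2) admissible_model_cover by blast
    have pq: "p = quad_param (sin f) (cos f) u (sin f + u * cos f) (sin f * u - cos f)"
      using x(3) by (simp add: quad_map_def)
    have "chart_nonzero c (sin f) (cos f) u (sin f + u * cos f) (sin f * u - cos f)"
      using p quad_param_fst_cases[OF adm] unfolding pq chart_domain_def chart_nonzero_def
      by (auto simp: quad_points_def)
    then have "h p = (1 - 2 * (sin f)\<^sup>2, 2 * sin f * cos f * u, u\<^sup>2)" unfolding pq by (rule h[OF adm])
    then show ?thesis by (simp only: x(1) model_map_sin_cos)
  qed
  have dom: "\<exists>c\<in>?C. p \<in> chart_domain c" if "p \<in> filled_quad" for p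
  proof (cases "fst p \<in> quad_points")
    case True
    have "fst p \<noteq> pt 1 1 1" "fst p \<noteq> pt 1 1 0" using that filled_quad_iff[of "fst p" "snd p"] by auto
    then have "fst p \<in> ?C" using True by (auto simp: quad_points_def)
    then show ?thesis using that by (intro bexI[of _ "fst p"]) (auto simp: chart_domain_def)
  next
    case False
    then show ?thesis using that by (auto simp: chart_domain_def)
  qed
  have cont: "continuous_on filled_quad F"
    unfolding continuous_on_def
  proof
    fix p assume p: "p \<in> filled_quad"
    then obtain c where c: "c \<in> ?C" "p \<in> chart_domain c" using dom by blast
    obtain h where h: "continuous_on (chart_domain c) h"
      "\<And>al be u A B. admissible al be u A B \<Longrightarrow> chart_nonzero c al be u A B \<Longrightarrow>
        h (quad_param al be u A B) = (1 - 2 * al\<^sup>2, 2 * al * be * u, u\<^sup>2)"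
      using coordinates_chart[OF c(1)] by metis
    have "continuous_on (chart_domain c) F"
      using h(1) by (rule continuous_on_eq) (use F[OF h(2)] in simp)
    then have "(F \<longlongrightarrow> F p) (at p within chart_domain c)"
      using c(2) by (simp add: continuous_on_def)
    \<comment> \<open>The other multiple points form a finite, hence closed set, so the chart is a
      neighbourhood of \<open>p\<close> in the surface and continuity can be tested on it.\<close>
    moreover have "at p within filled_quad = at p within chart_domain c"
    proof (rule at_within_nhd)
      have "closed (quad_points - {c})" by (rule closed_finite_cp2) (simp add: finite_quad_points)
      then have "closed (fst -` (quad_points - {c}) :: (cp2 \<times> (cp2 \<Rightarrow> cp2)) set)"
        by (rule closed_vimage) (rule continuous_on_fst[OF continuous_on_id])
      then show "open (- fst -` (quad_points - {c}) :: (cp2 \<times> (cp2 \<Rightarrow> cp2)) set)" by (rule open_Compl)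
      show "p \<in> - fst -` (quad_points - {c})" using c(2) by (simp add: chart_domain_def)
      show "filled_quad \<inter> - fst -` (quad_points - {c}) - {p} = chart_domain c \<inter> - fst -` (quad_points - {c}) - {p}"
        by (auto simp: chart_domain_def)
    qed
    ultimately show "(F \<longlongrightarrow> F p) (at p within filled_quad)" by simp
  qed
  have val: "F (quad_map x) = model_map x" if x: "x \<in> model_cover" for x
  proof -
  obtain f u where fu: "x = (f, u)" by (cases x)
  have "quad_map x \<in> filled_quad" using x quad_map_image by blast
  then obtain c where c: "c \<in> ?C" "quad_map x \<in> chart_domain c" using dom by blast
  obtain h where h: "\<And>al be u A B. admissible al be u A B \<Longrightarrow> chart_nonzero c al be u A B \<Longrightarrow>
        h (quad_param al be u A B) = (1 - 2 * al\<^sup>2, 2 * al * be * u, u\<^sup>2)"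
    using coordinates_chart[OF c(1)] by metis
  have adm: "admissible (sin f) (cos f) u (sin f + u * cos f) (sin f * u - cos f)"
    using x admissible_model_cover fu by blast
  have qx: "quad_map x = quad_param (sin f) (cos f) u (sin f + u * cos f) (sin f * u - cos f)"
    by (simp add: fu quad_map_def)
  have "chart_nonzero c (sin f) (cos f) u (sin f + u * cos f) (sin f * u - cos f)"
    using c(2) quad_param_fst_cases[OF adm] unfolding qx chart_domain_def chart_nonzero_def
    by (auto simp: quad_points_def)
  then have "h (quad_map x) = (1 - 2 * (sin f)\<^sup>2, 2 * sin f * cos f * u, u\<^sup>2)" unfolding qx by (rule h[OF adm])
  moreover have "F (quad_map x) = h (quad_map x)" using h c(2) by (rule F)
  ultimately show ?thesis by (simp add: fu model_map_sin_cos)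
  qed
  show ?thesis using cont val by blast
qed

text \<open>The maps \<open>quad_map\<close> and \<open>model_map\<close> have the same fibres, so
  each descends along the other. The map \<open>G\<close> is well defined because
  \<open>quad_map\<close> is constant on deck orbits, and continuous because
  \<open>model_map\<close> is open.\<close>

lemma filled_quad_homeomorphic_model: "top_of_set filled_quad homeomorphic_space top_of_set model"
proof -
  obtain F where F: "continuous_on filled_quad F" and "\<forall>x\<in>model_cover. F (quad_map x) = model_map x"
    using quad_coordinates by blast
  then have F_quad: "F (quad_map x) = model_map x" if "x \<in> model_cover" for x using that by simp
  define G where "G y = quad_map (SOME x. x \<in> model_cover \<and> model_map x = y)" for y
  have G: "G (model_map x) = quad_map x" if x: "x \<in> model_cover" for x
  proof -
    define x' where "x' = (SOME x'. x' \<in> model_cover \<and> model_map x' = model_map x)"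
    have x': "x' \<in> model_cover \<and> model_map x' = model_map x"
      unfolding x'_def by (rule someI[of _ x]) (simp add: x)
    then obtain k s where "x = deck k s x'" using model_map_eq_imp_deck[of x' x] x by auto
    then show ?thesis unfolding G_def x'_def[symmetric] by (simp add: quad_map_deck)
  qed
  have contG: "continuous_on model G"
    unfolding continuous_openin_preimage_eq
  proof (intro allI impI)
    fix T :: "(cp2 \<times> (cp2 \<Rightarrow> cp2)) set" assume "open T"
    then have "openin (top_of_set model_cover) (model_cover \<inter> quad_map -` T)"
      by (rule continuous_openin_preimage_gen[OF continuous_on_quad_map])
    then have "openin (top_of_set model) (model_map ` (model_cover \<inter> quad_map -` T))"
      by (rule openin_model_map_image)
    moreover have "model_map ` (model_cover \<inter> quad_map -` T) = model \<inter> G -` T"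
      unfolding model_map_surj[symmetric] by (auto simp: G)
    ultimately show "openin (top_of_set model) (model \<inter> G -` T)" by simp
  qed
  have *: "F p \<in> model" "G (F p) = p" if "p \<in> filled_quad" for p
    using that unfolding quad_map_image[symmetric] by (auto simp: F_quad G model_map_in_model)
  have **: "G y \<in> filled_quad" "F (G y) = y" if "y \<in> model" for y
    using that unfolding model_map_surj[symmetric] quad_map_image[symmetric] by (auto simp: F_quad G)
  have "homeomorphic_maps (top_of_set filled_quad) (top_of_set model) F G"
    unfolding homeomorphic_maps_def by (simp add: F contG * ** Pi_iff)
  then show ?thesis unfolding homeomorphic_space_def by blast
qed

lemma infinite_fundamental_group_filled_quad:
  assumes "p \<in> filled_quad"
  shows "infinite (carrier (fundamental_group filled_quad p))"
proof -
  obtain F where F: "continuous_on filled_quad F" and "\<forall>x\<in>model_cover. F (quad_map x) = model_map x"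
    using quad_coordinates by blast
  then have F_quad: "F (quad_map x) = model_map x" if "x \<in> model_cover" for x using that by simp
  have Fim: "F ` filled_quad \<subseteq> model"
    unfolding quad_map_image[symmetric] by (auto simp: F_quad model_map_in_model)
  obtain x where x: "x \<in> model_cover" "quad_map x = p" using assms unfolding quad_map_image[symmetric] by (elim imageE) simp
  have "range (\<lambda>k. deck k False x) \<subseteq> {u \<in> model_cover. quad_map u = p}"
    by (rule image_subsetI) (simp add: x deck_in_model_cover quad_map_deck)
  then have "infinite {u \<in> model_cover. quad_map u = p}"
    by (rule infinite_super[OF _ infinite_deck_orbit[OF x(1)]])
  then show ?thesis
    using infinite_fundamental_group[OF covering_space_model_map simply_connected_imp_path_connected[OF simply_connected_model_cover]
        continuous_on_quad_map equalityD1[OF quad_map_image] F Fim F_quad] by simp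
qed

lemma homology_filled_quad:
  "finite (carrier (homology_group 1 (top_of_set filled_quad))) \<and>
    card (carrier (homology_group 1 (top_of_set filled_quad))) = 4"
proof -
  have "homology_group 1 (top_of_set filled_quad) \<cong> homology_group 1 (top_of_set model)"
    by (rule homeomorphic_space_imp_isomorphic_homology_groups[OF filled_quad_homeomorphic_model])
  then obtain h where "h \<in> iso (homology_group 1 (top_of_set filled_quad)) (homology_group 1 (top_of_set model))"
    by (auto simp: is_iso_def)
  then have "bij_betw h (carrier (homology_group 1 (top_of_set filled_quad))) (carrier (homology_group 1 (top_of_set model)))"
    by (simp add: iso_def)
  then show ?thesis using homology_model bij_betw_finite bij_betw_same_card by metis
qed

section \<open>Reduction of an arbitrary complete quadrilateral to the standard frame\<close>

lemma lines_through_frame: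
  "{L \<in> range line. \<exists>p\<in>{pt 1 0 0, pt 0 1 0, pt 0 0 1, pt 1 1 1}. \<exists>q\<in>{pt 1 0 0, pt 0 1 0, pt 0 0 1, pt 1 1 1}.
      p \<noteq> q \<and> p \<in> L \<and> q \<in> L} = line ` quad_covectors" (is "?B = _")
proof
  show "line ` quad_covectors \<subseteq> ?B"
  proof (rule image_subsetI)
    fix a assume a: "a \<in> quad_covectors"
    let ?F = "{pt 1 0 0, pt 0 1 0, pt 0 0 1, pt 1 1 1}"
    have "\<exists>p\<in>?F. \<exists>q\<in>?F. p \<noteq> q \<and> p \<in> line a \<and> q \<in> line a"
      using a unfolding quad_covectors_def by (elim insertE emptyE) (simp_all add: pt_in_line pt_eq_iff)
    then show "line a \<in> ?B" by simp
  qed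
  show "?B \<subseteq> line ` quad_covectors"
  proof clarify
    fix a p q assume pq: "p \<in> {pt 1 0 0, pt 0 1 0, pt 0 0 1, pt 1 1 1}" "q \<in> {pt 1 0 0, pt 0 1 0, pt 0 0 1, pt 1 1 1}"
      "p \<noteq> q" "p \<in> line a" "q \<in> line a"
    have "\<exists>b\<in>quad_covectors. p \<in> line b \<and> q \<in> line b"
      using pq(1-3) unfolding quad_covectors_def by (elim insertE emptyE) (simp_all add: pt_in_line)
    then obtain b where b: "b \<in> quad_covectors" "p \<in> line b" "q \<in> line b" by blast
    then have "a = b" using line_unique pq by blast
    then show "line a \<in> line ` quad_covectors" using b by blast
  qed
qed

lemma Sing_quad: "Sing (line ` quad_covectors) = quad_points"
proof
  \<comment> \<open>\<open>Sing\<close> compares lines as sets of points, so distinct covectors must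
    be shown to have distinct lines. Each line contains two frame points, and these determine its
    covector.\<close>
  have inj: "line a \<noteq> line b" if "a \<in> quad_covectors" "b \<in> quad_covectors" "a \<noteq> b" for a b
  proof
    assume "line a = line b"
    moreover have "\<exists>p q. p \<noteq> q \<and> p \<in> line a \<and> q \<in> line a"
    proof -
      have "\<exists>p\<in>{pt 1 0 0, pt 0 1 0, pt 0 0 1, pt 1 1 1}. \<exists>q\<in>{pt 1 0 0, pt 0 1 0, pt 0 0 1, pt 1 1 1}. p \<noteq> q \<and> p \<in> line a \<and> q \<in> line a"
        using equalityD2[OF lines_through_frame] that(1) by blast
      then show ?thesis by blast
    qed
    ultimately show False using line_unique that(3) by metis
  qed
  show "quad_points \<subseteq> Sing (line ` quad_covectors)"
  proof
    fix x assume "x \<in> quad_points"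
    then have "\<exists>a\<in>quad_covectors. \<exists>b\<in>quad_covectors. a \<noteq> b \<and> x \<in> line a \<and> x \<in> line b"
      unfolding quad_points_def quad_covectors_def by (elim insertE emptyE) (simp_all add: pt_in_line cov_eq_iff)
    then obtain a b where "a \<in> quad_covectors" "b \<in> quad_covectors" "a \<noteq> b" "x \<in> line a" "x \<in> line b"
      by (elim bexE conjE)
    then show "x \<in> Sing (line ` quad_covectors)"
      unfolding Sing_def by (intro CollectI bexI[of _ "line a"] bexI[of _ "line b"] conjI inj imageI)
  qed
  show "Sing (line ` quad_covectors) \<subseteq> quad_points"
  proof
    fix x assume "x \<in> Sing (line ` quad_covectors)"
    then obtain a b where ab: "a \<in> quad_covectors" "b \<in> quad_covectors" "a \<noteq> b" "x \<in> line a" "x \<in> line b"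
      unfolding Sing_def by auto
    \<comment> \<open>Any two of the six lines meet in one of the seven points, and distinct lines
      have no second point in common.\<close>
    have "\<exists>y\<in>quad_points. y \<in> line a \<and> y \<in> line b"
      using ab(1-3) unfolding quad_points_def quad_covectors_def
      by (elim insertE emptyE) (simp_all add: pt_in_line)
    then obtain y where "y \<in> quad_points" "y \<in> line a" "y \<in> line b" by blast
    then show "x \<in> quad_points" using line_unique[of x y a b] ab by metis
  qed
qed

end

text \<open>Representatives of three of the points form a basis, which is rescaled so that the basis
  vectors add up to a representative of the fourth. General position makes the basis independent and
  the scale factors \<open>c\<close> nonzero.\<close>

lemma general_position_frame:
  assumes "card P = 4" "general_position P"
  obtains M N where "projective_frame M N"
    "P = {projective_frame.pt M 1 0 0, projective_frame.pt M 0 1 0, projective_frame.pt M 0 0 1, projective_frame.pt M 1 1 1}"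
proof -
  obtain p1 p2 p3 p4 where P: "P = {p1, p2, p3, p4}" and dist: "distinct [p1, p2, p3, p4]"
  proof -
    have "finite P" using assms(1) by (metis card.infinite zero_neq_numeral)
    then obtain xs where xs: "set xs = P" "distinct xs" using finite_distinct_list by blast
    then have "length xs = 4" using assms(1) distinct_card by metis
    then obtain a b c d where "xs = [a, b, c, d]"
      by (auto simp: numeral_eq_Suc length_Suc_conv)
    then show ?thesis using that[of a b c d] xs by auto
  qed
  have noncollinear: "a = 0" if "dot a (rep_cp2 x) = 0" "dot a (rep_cp2 y) = 0" "dot a (rep_cp2 z) = 0"
    "{x, y, z} \<subseteq> P" "distinct [x, y, z]" for a x y z
  proof (rule ccontr)
    assume a: "a \<noteq> 0"
    have "w \<in> line (abs_cp2 a)" if "dot a (rep_cp2 w) = 0" for w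
      using on_line_abs_cp2[OF a rep_cp2(1)[of w]] that by (simp add: line_def rep_cp2)
    then have "{x, y, z} \<subseteq> P \<inter> line (abs_cp2 a)" using that by blast
    then have "card {x, y, z} \<le> card (P \<inter> line (abs_cp2 a))"
      by (rule card_mono[rotated]) (simp add: P)
    also have "\<dots> \<le> 2" using assms(2) by (simp add: general_position_def)
    finally show False using that(5) by simp
  qed
  define v1 where "v1 = rep_cp2 p1"
  define v2 where "v2 = rep_cp2 p2"
  define v3 where "v3 = rep_cp2 p3"
  define v4 where "v4 = rep_cp2 p4"
  define R :: "complex ^ 3 ^ 3" where "R = vector [v1, v2, v3]"
  have R: "R *v a = vector [dot v1 a, dot v2 a, dot v3 a]" for a
    by (simp add: R_def vec_eq_iff forall_3 matrix_vector_mult_def dot_def)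
  have sym: "dot a b = dot b a" for a b by (simp add: dot_3 mult.commute)
  have "a = 0" if "R *v a = 0" for a
    using that noncollinear[of a p1 p2 p3] dist
    by (simp add: R vec_eq_iff forall_3 sym[of a] v1_def v2_def v3_def P)
  then obtain L where LR: "L ** R = mat 1"
    using matrix_left_invertible_ker[of R] by blast
  then have RL: "R ** L = mat 1" by (simp add: matrix_left_right_inverse)
  define c where "c = v4 v* L"
  have cR: "c v* R = v4" unfolding c_def vector_matrix_mul_assoc LR by simp
  have ci: "dot (L *v axis i 1) v4 = c $ i" for i
    by (simp add: c_def dot_def vector_matrix_mult_def matrix_vector_mult_def axis_def if_distrib mult.commute cong: if_cong)
  have RLi: "vector [dot v1 (L *v axis i 1), dot v2 (L *v axis i 1), dot v3 (L *v axis i 1)] = (axis i 1 :: complex ^ 3)" for i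
    unfolding R[symmetric] matrix_vector_mul_assoc RL by simp
  have nz: "L *v axis i 1 \<noteq> 0" for i
  proof
    assume "L *v axis i 1 = 0"
    then have "axis i 1 = (0 :: complex ^ 3)" using RLi[of i] by (simp add: vec_eq_iff forall_3 dot_3)
    then show False by (simp add: axis_eq_0_iff)
  qed
  \<comment> \<open>The covector \<open>L *v axis i 1\<close> is nonzero, vanishes on two of the
    basis vectors and has the value \<open>c $ i\<close> on \<open>v4\<close>. If that value were
    zero, three of the four points would be collinear.\<close>
  have c: "c $ 1 \<noteq> 0" "c $ 2 \<noteq> 0" "c $ 3 \<noteq> 0"
  proof -
    show "c $ 1 \<noteq> 0"
      using RLi[of 1] noncollinear[of "L *v axis 1 1" p2 p3 p4] nz[of 1] ci[of 1] dist
      by (auto simp: vec_eq_iff forall_3 axis_def sym[of _ "L *v _"] v2_def v3_def v4_def P)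
    show "c $ 2 \<noteq> 0"
      using RLi[of 2] noncollinear[of "L *v axis 2 1" p1 p3 p4] nz[of 2] ci[of 2] dist
      by (auto simp: vec_eq_iff forall_3 axis_def sym[of _ "L *v _"] v1_def v3_def v4_def P)
    show "c $ 3 \<noteq> 0"
      using RLi[of 3] noncollinear[of "L *v axis 3 1" p1 p2 p4] nz[of 3] ci[of 3] dist
      by (auto simp: vec_eq_iff forall_3 axis_def sym[of _ "L *v _"] v1_def v2_def v4_def P)
  qed
  have c0: "c $ i \<noteq> 0" for i using c exhaust_3[of i] by auto
  define M :: "complex ^ 3 ^ 3" where "M = (\<chi> i j. c $ j * R $ j $ i)"
  define N :: "complex ^ 3 ^ 3" where "N = (\<chi> i j. L $ j $ i / c $ i)"
  have "N ** M = mat 1"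
  proof -
    have "(N ** M) $ i $ j = (R ** L) $ j $ i * c $ j / c $ i" for i j
      by (simp add: N_def M_def matrix_matrix_mult_def sum_distrib_left sum_distrib_right sum_divide_distrib mult_ac)
    then show ?thesis unfolding RL using c0 by (simp add: vec_eq_iff mat_def)
  qed
  then have frame: "projective_frame M N"
    by unfold_locales (simp_all add: matrix_left_right_inverse)
  interpret projective_frame M N by (rule frame)
  have Mv: "M *v v = (v $ 1 * c $ 1) *s v1 + (v $ 2 * c $ 2) *s v2 + (v $ 3 * c $ 3) *s v3" for v
    by (simp add: M_def R_def vec_eq_iff matrix_vector_mult_def sum_3 mult_ac)
  have smult: "abs_cp2 (k *s rep_cp2 p) = p" if "k \<noteq> 0" for k p
    using abs_cp2_eq_iff[of "rep_cp2 p" "k *s rep_cp2 p"] that rep_cp2 by (metis vector_mul_eq_0)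
  have "pt 1 0 0 = p1" "pt 0 1 0 = p2" "pt 0 0 1 = p3"
    unfolding pt_def Mv using smult[OF c(1)] smult[OF c(2)] smult[OF c(3)] by (simp_all add: v1_def v2_def v3_def)
  moreover have "pt 1 1 1 = p4"
  proof -
    have "M *v vector [1, 1, 1] = c v* R"
      unfolding Mv by (simp add: R_def vec_eq_iff vector_matrix_mult_def sum_3 mult_ac)
    then show ?thesis unfolding pt_def cR by (simp add: v4_def rep_cp2)
  qed
  ultimately show ?thesis using that[OF frame] P by simp
qed

theorem theorem1p2:
  fixes B :: "cp2 set set"
  assumes "complete_quadrilateral B"
  shows "\<exists>\<C> \<subseteq> boundary_components B.
    let X = blowup (Sing B) - \<Union>\<C> in
      (\<forall>x\<in>X. infinite (carrier (fundamental_group X x))) \<and>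
      finite (carrier (homology_group 1 (top_of_set X))) \<and>
      card (carrier (homology_group 1 (top_of_set X))) = 4"
proof -
  obtain P where P: "card P = 4" "general_position P"
    "B = {L \<in> range line. \<exists>p\<in>P. \<exists>q\<in>P. p \<noteq> q \<and> p \<in> L \<and> q \<in> L}"
    using assms unfolding complete_quadrilateral_def by blast
  obtain M N where frame: "projective_frame M N"
    "P = {projective_frame.pt M 1 0 0, projective_frame.pt M 0 1 0, projective_frame.pt M 0 0 1, projective_frame.pt M 1 1 1}"
    using general_position_frame[OF P(1,2)] by blast
  interpret projective_frame M N by (rule frame(1))
  have B: "B = line ` quad_covectors" using lines_through_frame P(3) frame(2) by simp
  have Sing: "Sing B = quad_points" unfolding B by (rule Sing_quad)
  define \<C> where "\<C> = strict_transform (Sing B) ` B \<union> exceptional_divisor (Sing B) ` {pt 1 1 1, pt 1 1 0}"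
  have "\<C> \<subseteq> boundary_components B"
    unfolding \<C>_def boundary_components_def Sing by (auto simp: quad_points_def)
  moreover have "blowup (Sing B) - \<Union>\<C> = filled_quad"
    unfolding \<C>_def filled_quad_def Sing by (simp only: B)
  ultimately show ?thesis
    unfolding Let_def
    using infinite_fundamental_group_filled_quad homology_filled_quad by (intro exI[of _ \<C>]) simp
qed

end
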